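(* Let $\alpha\in(0,1)$, $\gamma\in(0,1/6)$, and let $G_n$ be the two-dimensional discrete torus $\mathcal V_n=\mathbb Z^2/2^n\mathbb Z^2$ with nearest-neighbour edges. Let $(\tau_x)$ be i.i.d. positive with $\lim_{u\to\infty}u^\alpha\mathbb P[\tau_x\ge u]=1$, and let $X_n$ be the continuous-time Markov chain on $\mathcal V_n$ started at $0$ with rates $w_{xy}=\tfrac14\tau_x^{-1}$ for neighbours $x,y$ (Bouchaud trap model with $a=0$, $\nu=1/4$). Put $t_w(n)=2^{2n/\alpha}n^{1-\gamma/\alpha}$. Then for every $\theta>0$ and $\mathbb P$-a.e. $\boldsymbol\tau$, \[\lim_{n\to\infty}\mathbb P[X_n(t_w(n))=X_n((1+\theta)t_w(n))\mid\boldsymbol\tau]=\mathrm{Asl}_\alpha\Big(\frac1{1+\theta}\Big).\]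
   Context: $\mathrm{Asl}_\alpha(u)=\frac{\sin\alpha\pi}{\pi}\int_0^u s^{\alpha-1}(1-s)^{-\alpha}ds$. *)

theory Defs
  imports "HOL-Probability.Probability"
begin

definition Asl :: "real \<Rightarrow> real \<Rightarrow> real" where
  "Asl \<alpha> u = sin (\<alpha> * pi) / pi *
      integral {0..u} (\<lambda>s. s powr (\<alpha> - 1) * (1 - s) powr (- \<alpha>))"

definition mmult :: "'a set \<Rightarrow> ('a \<Rightarrow> 'a \<Rightarrow> real) \<Rightarrow> ('a \<Rightarrow> 'a \<Rightarrow> real) \<Rightarrow> 'a \<Rightarrow> 'a \<Rightarrow> real" where
  "mmult S A B x y = (\<Sum>z\<in>S. A x z * B z y)"

fun mpow :: "'a set \<Rightarrow> ('a \<Rightarrow> 'a \<Rightarrow> real) \<Rightarrow> nat \<Rightarrow> 'a \<Rightarrow> 'a \<Rightarrow> real" where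
  "mpow S A 0 = (\<lambda>x y. if x = y then 1 else 0)"
| "mpow S A (Suc k) = mmult S A (mpow S A k)"

definition ctmc_trans :: "'a set \<Rightarrow> ('a \<Rightarrow> 'a \<Rightarrow> real) \<Rightarrow> real \<Rightarrow> 'a \<Rightarrow> 'a \<Rightarrow> real" where
  "ctmc_trans S Q t x y = (\<Sum>k. t ^ k / fact k * mpow S Q k x y)"

definition torus :: "nat \<Rightarrow> (int \<times> int) set" where
  "torus n = {0..<2^n} \<times> {0..<2^n}"

definition wrap :: "nat \<Rightarrow> int \<times> int \<Rightarrow> int \<times> int" where
  "wrap n z = (fst z mod 2^n, snd z mod 2^n)"

definition unit_dirs :: "(int \<times> int) list" where
  "unit_dirs = [(1,0), (-1,0), (0,1), (0,-1)]"

text \<open>Generator of the Bouchaud trap model (a = 0, nu = 1/4) on the torus: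
  jump rate from x to each of its four nearest neighbours is (1/4) tau_x^{-1}
  (neighbours counted with multiplicity; self-loops on tiny tori cancel).\<close>
definition btm_gen :: "nat \<Rightarrow> (int \<times> int \<Rightarrow> real) \<Rightarrow> int \<times> int \<Rightarrow> int \<times> int \<Rightarrow> real" where
  "btm_gen n \<tau> x y =
     real (length (filter (\<lambda>e. wrap n (fst x + fst e, snd x + snd e) = y) unit_dirs)) / (4 * \<tau> x)
     - (if x = y then 1 / \<tau> x else 0)"

text \<open>Quenched probability P[X_n(t) = X_n(s) | tau] for the chain started at 0, t \<le> s
  (Markov property at time t).\<close>
definition btm_same_pos :: "nat \<Rightarrow> (int \<times> int \<Rightarrow> real) \<Rightarrow> real \<Rightarrow> real \<Rightarrow> real" where
  "btm_same_pos n \<tau> t s =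
     (\<Sum>y\<in>torus n. ctmc_trans (torus n) (btm_gen n \<tau>) t (0,0) y *
                    ctmc_trans (torus n) (btm_gen n \<tau>) (s - t) y y)"

definition t_w :: "real \<Rightarrow> real \<Rightarrow> nat \<Rightarrow> real" where
  "t_w \<alpha> \<gamma> n = 2 powr (2 * real n / \<alpha>) * real n powr (1 - \<gamma> / \<alpha>)"

end

theory Submission
  imports Defs
begin

text \<open>
  The double-time probability is computed through the resolvent of the chain.  If \<open>P\<close> is the simple
  random walk on the torus and \<open>\<lambda> = a/t\<^sub>w\<close>, the resolvent at \<open>\<lambda>\<close> is \<open>G(x,y) \<tau>\<^sub>y\<close> with \<open>G\<close> the Green
  function of the walk killed at rate \<open>\<lambda>\<tau>\<close>.  Comparing \<open>G\<close> with the zero-mean Green kernel \<open>A\<close> of the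
  torus, \<open>g = A(0)\<close> of order \<open>n\<close>, gives a mean-field form: on the traps with \<open>v\<^sub>y = g\<tau>\<^sub>y/t\<^sub>w\<close> of order one,
  \<open>G(y,y)\<close> is close to \<open>g/(1+av\<^sub>y)\<close> and \<open>G(0,y)\<close> to a constant times \<open>1/(1+av\<^sub>y)\<close>.  The only error terms
  come from pairs of deep traps at which \<open>A\<close> exceeds \<open>n\<^bsup>3/4\<^esup>\<close>, and since \<open>\<Sum>A\<^sup>2\<close> is of order \<open>4\<^sup>n\<close>
  these are a.s. negligible.  About \<open>n\<^sup>\<gamma>\<close> traps are relevant, so their rescaled depths obey a law of
  large numbers with limit intensity \<open>\<alpha>v\<^bsup>-\<alpha>-1\<^esup>dv\<close>, and the constant \<open>g/n\<close> drops out by scaling.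

  Laplace transforms are inverted by a Tauberian argument.  It needs only one-sided regularity, which
  for return probabilities is monotonicity (reversibility) and for \<open>p\<^sub>t(0,y)\<close> is
  \<open>p\<^bsub>t+r\<^esub>(0,y) \<ge> p\<^sub>t(0,y) p\<^sub>r(y,y)\<close>.  The traps outside a window \<open>\<delta> \<le> v < \<Delta>\<close> carry little mass,
  because the mass found inside tends to one as the window grows.
\<close>

subsection \<open>Exponentials of finite matrices\<close>

text \<open>Two demands fix the threshold n^(3/4) between near and far pairs. With exponent \<beta>,
  the bound on the sum of A^2 leaves order 4^n n^(-2\<beta>) near partners per site, so near pairs
  among n^\<gamma> deep traps have mean number n^(2\<gamma>-2\<beta>), summable if \<beta> > 1/2 +
  \<gamma>; the joint effect of the far sites, b/g times n^\<gamma>, vanishes if \<beta> < 1 -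
  \<gamma>. The midpoint is 3/4. The environment is fixed before the limit, so only countably many
  almost sure statements may enter: transforms at integers a, windows \<delta> = 1/(j+1), \<Delta> =
  j+1. Integers suffice because they produce all polynomials in exp(-s). The Tauberian lemma has to
  be quantitative, since the comparison function exp(-s/v) changes with the trap and with n. Only
  the first time is transformed; the second enters as a weight p(y,y), evaluated beforehand by the
  same lemma. In the rates z = 1/v the limit transforms are mixtures of a^(-\<alpha>)/(a+z), the
  transform of a convolution of r^(\<alpha>-1) with exp(-rz); integrating over z gives the arcsine
  density.\<close>

lemma mpow_abs_le:
  assumes "finite S" "\<And>x. x \<in> S \<Longrightarrow> (\<Sum>z\<in>S. \<bar>Q x z\<bar>) \<le> C" "x \<in> S"
  shows "\<bar>mpow S Q k x y\<bar> \<le> C ^ k"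
  using assms(3)
proof (induction k arbitrary: x)
  case (Suc k)
  have C0: "C \<ge> 0"
    using assms(2)[OF Suc.prems] by (meson abs_ge_zero order_trans sum_nonneg)
  have "\<bar>mpow S Q (Suc k) x y\<bar> \<le> (\<Sum>z\<in>S. \<bar>Q x z * mpow S Q k z y\<bar>)"
    by (simp add: mmult_def)
  also have "\<dots> \<le> (\<Sum>z\<in>S. \<bar>Q x z\<bar> * C ^ k)"
    by (rule sum_mono) (simp add: abs_mult mult_left_mono Suc.IH)
  also have "\<dots> = (\<Sum>z\<in>S. \<bar>Q x z\<bar>) * C ^ k"
    by (simp add: sum_distrib_right)
  also have "\<dots> \<le> C * C ^ k"
    using assms(2)[OF Suc.prems] C0 by (intro mult_right_mono) auto
  finally show ?case by simp
qed auto

lemma mpow_add: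
  assumes "finite S" "x \<in> S"
  shows "mpow S Q (j + k) x y = (\<Sum>z\<in>S. mpow S Q j x z * mpow S Q k z y)"
  using assms(2)
proof (induction j arbitrary: x)
  case 0
  then show ?case using assms(1) by (simp add: if_distrib[of "\<lambda>u. u * _"] cong: if_cong)
next
  case (Suc j)
  have "mpow S Q (Suc j + k) x y = (\<Sum>w\<in>S. Q x w * (\<Sum>z\<in>S. mpow S Q j w z * mpow S Q k z y))"
    using Suc.IH by (simp add: mmult_def)
  also have "\<dots> = (\<Sum>w\<in>S. \<Sum>z\<in>S. Q x w * mpow S Q j w z * mpow S Q k z y)"
    by (simp add: sum_distrib_left mult.assoc)
  also have "\<dots> = (\<Sum>z\<in>S. \<Sum>w\<in>S. Q x w * mpow S Q j w z * mpow S Q k z y)"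
    by (rule sum.swap)
  also have "\<dots> = (\<Sum>z\<in>S. mpow S Q (Suc j) x z * mpow S Q k z y)"
    by (simp add: mmult_def sum_distrib_right)
  finally show ?case .
qed

lemma mpow_Suc_right:
  assumes "finite S" "x \<in> S" "y \<in> S"
  shows "mpow S Q (Suc k) x y = (\<Sum>z\<in>S. mpow S Q k x z * Q z y)"
proof -
  have 1: "mpow S Q 1 z y = Q z y" if "z \<in> S" for z
    using assms(1,3) that by (simp add: mmult_def if_distrib[of "\<lambda>u. _ * u"] cong: if_cong)
  have "mpow S Q (Suc k) x y = mpow S Q (k + 1) x y" by simp
  also have "\<dots> = (\<Sum>z\<in>S. mpow S Q k x z * mpow S Q 1 z y)"
    by (rule mpow_add[OF assms(1,2)])
  also have "\<dots> = (\<Sum>z\<in>S. mpow S Q k x z * Q z y)"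
    by (intro sum.cong refl) (simp only: 1)
  finally show ?thesis .
qed

lemma mpow_series_summable:
  assumes "finite S" "x \<in> S"
  shows "summable (\<lambda>k. mpow S Q k x y / fact k * t ^ k)"
proof -
  define C where "C = (\<Sum>x\<in>S. \<Sum>z\<in>S. \<bar>Q x z\<bar>)"
  have C: "(\<Sum>z\<in>S. \<bar>Q x z\<bar>) \<le> C" if "x \<in> S" for x
    unfolding C_def using assms(1) that by (intro member_le_sum) (auto intro: sum_nonneg)
  show ?thesis
  proof (rule summable_comparison_test[OF _ summable_exp[of "C * \<bar>t\<bar>"]], intro exI allI impI)
    fix k
    have "\<bar>mpow S Q k x y\<bar> * \<bar>t\<bar> ^ k \<le> C ^ k * \<bar>t\<bar> ^ k"
      using mpow_abs_le[OF assms(1) C assms(2)] by (intro mult_right_mono) auto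
    then show "norm (mpow S Q k x y / fact k * t ^ k) \<le> inverse (fact k) * (C * \<bar>t\<bar>) ^ k"
      by (simp add: abs_mult power_abs power_mult_distrib field_simps)
  qed
qed

lemma ctmc_trans_eq:
  "ctmc_trans S Q t x y = (\<Sum>k. mpow S Q k x y / fact k * t ^ k)"
  by (simp add: ctmc_trans_def mult.commute)

lemma ctmc_trans_0: "ctmc_trans S Q 0 x y = (if x = y then 1 else 0)"
proof -
  have "(\<Sum>k. mpow S Q k x y / fact k * 0 ^ k) = mpow S Q 0 x y / fact 0"
    by (rule powser_zero)
  then show ?thesis by (simp add: ctmc_trans_eq)
qed

lemma diffs_mpow_series:
  "diffs (\<lambda>k. mpow S Q k x y / fact k) k = mpow S Q (Suc k) x y / fact k"
  by (simp add: diffs_def del: mpow.simps of_nat_Suc)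

lemma ctmc_trans_deriv_series:
  assumes "finite S" "x \<in> S"
  shows "((\<lambda>t. ctmc_trans S Q t x y) has_real_derivative
           (\<Sum>k. mpow S Q (Suc k) x y / fact k * t ^ k)) (at t)"
  using termdiffs_strong_converges_everywhere[of "\<lambda>k. mpow S Q k x y / fact k" t]
    mpow_series_summable[OF assms]
  by (simp add: ctmc_trans_eq[abs_def] diffs_mpow_series del: mpow.simps)

lemma ctmc_trans_deriv:
  assumes "finite S" "x \<in> S"
  shows "((\<lambda>t. ctmc_trans S Q t x y) has_real_derivative
           (\<Sum>z\<in>S. Q x z * ctmc_trans S Q t z y)) (at t)"
proof -
  have "(\<Sum>z\<in>S. Q x z * ctmc_trans S Q t z y)
      = (\<Sum>z\<in>S. \<Sum>k. Q x z * (mpow S Q k z y / fact k * t ^ k))"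
    unfolding ctmc_trans_eq
    by (intro sum.cong refl suminf_mult[symmetric] mpow_series_summable assms)
  also have "\<dots> = (\<Sum>k. \<Sum>z\<in>S. Q x z * (mpow S Q k z y / fact k * t ^ k))"
    by (intro suminf_sum[symmetric] summable_mult mpow_series_summable assms)
  also have "\<dots> = (\<Sum>k. mpow S Q (Suc k) x y / fact k * t ^ k)"
    by (simp add: mmult_def sum_distrib_right sum_divide_distrib mult.assoc)
  finally show ?thesis using ctmc_trans_deriv_series[OF assms] by metis
qed

lemma ctmc_trans_deriv_right:
  assumes "finite S" "x \<in> S" "y \<in> S"
  shows "((\<lambda>t. ctmc_trans S Q t x y) has_real_derivative
           (\<Sum>z\<in>S. ctmc_trans S Q t x z * Q z y)) (at t)"
proof -
  have "(\<Sum>z\<in>S. ctmc_trans S Q t x z * Q z y)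
      = (\<Sum>z\<in>S. \<Sum>k. (mpow S Q k x z / fact k * t ^ k) * Q z y)"
    unfolding ctmc_trans_eq
    by (intro sum.cong refl suminf_mult2 mpow_series_summable assms)
  also have "\<dots> = (\<Sum>k. \<Sum>z\<in>S. (mpow S Q k x z / fact k * t ^ k) * Q z y)"
    by (intro suminf_sum[symmetric] summable_mult2 mpow_series_summable assms)
  also have "\<dots> = (\<Sum>k. mpow S Q (Suc k) x y / fact k * t ^ k)"
    unfolding mpow_Suc_right[OF assms]
    by (simp add: sum_distrib_right sum_distrib_left sum_divide_distrib algebra_simps)
  finally show ?thesis using ctmc_trans_deriv_series[OF assms(1,2)] by metis
qed

lemma ctmc_trans_continuous:
  assumes "finite S" "x \<in> S"
  shows "continuous_on A (\<lambda>t. ctmc_trans S Q t x y)"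
  using ctmc_trans_deriv[OF assms]
  by (meson DERIV_isCont continuous_at_imp_continuous_on)

text \<open>Differentiating \<open>s \<mapsto> \<Sum>z. p\<^bsub>t-s\<^esub>(x,z) f(s,z)\<close> gives zero, hence uniqueness.\<close>

lemma ctmc_trans_unique:
  assumes S: "finite S" "x \<in> S"
    and f: "\<And>s z. z \<in> S \<Longrightarrow> ((\<lambda>s. f s z) has_real_derivative (\<Sum>w\<in>S. Q z w * f s w)) (at s)"
  shows "f t x = (\<Sum>z\<in>S. ctmc_trans S Q t x z * f 0 z)"
proof -
  define D where "D = (\<lambda>s. \<Sum>z\<in>S. ctmc_trans S Q (t - s) x z * f s z)"
  have "(D has_real_derivative 0) (at s)" for s
  proof -
    have 1: "((\<lambda>s. ctmc_trans S Q (t - s) x z) has_real_derivative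
        - (\<Sum>w\<in>S. ctmc_trans S Q (t - s) x w * Q w z)) (at s)" if "z \<in> S" for z
    proof -
      have "((\<lambda>s. t - s) has_real_derivative - 1) (at s)"
        by (auto intro!: derivative_eq_intros)
      from DERIV_chain2[OF ctmc_trans_deriv_right[OF S that, of Q] this] show ?thesis by simp
    qed
    have "(D has_real_derivative
        (\<Sum>z\<in>S. - (\<Sum>w\<in>S. ctmc_trans S Q (t - s) x w * Q w z) * f s z
            + (\<Sum>w\<in>S. Q z w * f s w) * ctmc_trans S Q (t - s) x z)) (at s)"
      unfolding D_def by (intro DERIV_sum DERIV_mult 1 f)
    moreover have "(\<Sum>z\<in>S. (\<Sum>w\<in>S. ctmc_trans S Q (t - s) x w * Q w z) * f s z)
       = (\<Sum>z\<in>S. (\<Sum>w\<in>S. Q z w * f s w) * ctmc_trans S Q (t - s) x z)"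
      unfolding sum_distrib_right
      by (subst sum.swap) (intro sum.cong refl, simp)
    ultimately show ?thesis
      by (simp add: sum_subtractf)
  qed
  then have "D t = D 0" by (simp add: DERIV_isconst_all)
  moreover have "D t = f t x"
    using S by (simp add: D_def ctmc_trans_0 if_distrib[of "\<lambda>u. u * _"] cong: if_cong)
  moreover have "D 0 = (\<Sum>z\<in>S. ctmc_trans S Q t x z * f 0 z)"
    by (simp add: D_def)
  ultimately show ?thesis by simp
qed

text \<open>Chapman-Kolmogorov: as a function of r and z, p at time r + s solves the backward
  equation with initial value p at time s, so \<open>ctmc_trans_unique\<close> applies.\<close>

lemma ctmc_trans_add:
  assumes S: "finite S" "x \<in> S"
  shows "ctmc_trans S Q (t + s) x y = (\<Sum>z\<in>S. ctmc_trans S Q t x z * ctmc_trans S Q s z y)"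
proof -
  have "((\<lambda>r. ctmc_trans S Q (r + s) z y) has_real_derivative
      (\<Sum>w\<in>S. Q z w * ctmc_trans S Q (r + s) w y)) (at r)" if "z \<in> S" for r z
    using DERIV_shift[of "\<lambda>r. ctmc_trans S Q r z y" _ r s]
      ctmc_trans_deriv[OF S(1) that, of Q y "r + s"] by blast
  from ctmc_trans_unique[where f = "\<lambda>r z. ctmc_trans S Q (r + s) z y" and Q = Q, OF S this]
  show ?thesis by simp
qed

lemma mpow_nonneg:
  assumes "\<And>x y. x \<in> S \<Longrightarrow> y \<in> S \<Longrightarrow> B x y \<ge> 0" "x \<in> S"
  shows "mpow S B k x y \<ge> (0::real)"
  using assms(2)
  by (induction k arbitrary: x) (auto simp: mmult_def intro!: sum_nonneg mult_nonneg_nonneg assms(1))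

text \<open>Uniformisation: adding c times the identity makes the matrix entrywise nonnegative, and
  exp(cs) times the semigroup solves the backward equation of the shifted matrix \<open>B\<close>,
  whose exponential series has only nonnegative terms.\<close>

lemma ctmc_trans_nonneg:
  assumes S: "finite S" "x \<in> S" "y \<in> S" and t: "t \<ge> 0"
    and off: "\<And>x y. x \<in> S \<Longrightarrow> y \<in> S \<Longrightarrow> x \<noteq> y \<Longrightarrow> Q x y \<ge> 0"
  shows "ctmc_trans S Q t x y \<ge> 0"
proof -
  define c where "c = (\<Sum>x\<in>S. \<bar>Q x x\<bar>)"
  define B where "B = (\<lambda>x y. Q x y + (if x = y then c else 0))"
  have B0: "B x y \<ge> 0" if "x \<in> S" "y \<in> S" for x y
  proof (cases "x = y")
    case True
    have "\<bar>Q x x\<bar> \<le> c" unfolding c_def by (rule member_le_sum) (use S that in auto)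
    then show ?thesis using True by (simp add: B_def)
  next
    case False
    then show ?thesis using off[OF that] by (simp add: B_def)
  qed
  have *: "((\<lambda>s. exp (c * s) * ctmc_trans S Q s z y) has_real_derivative
      (\<Sum>w\<in>S. B z w * (exp (c * s) * ctmc_trans S Q s w y))) (at s)" if z: "z \<in> S" for s z
  proof -
    have "(\<Sum>w\<in>S. B z w * (exp (c * s) * ctmc_trans S Q s w y)) =
       exp (c * s) * (\<Sum>w\<in>S. Q z w * ctmc_trans S Q s w y) + c * exp (c * s) * ctmc_trans S Q s z y"
      using S(1) z
      by (simp add: B_def sum_distrib_left algebra_simps sum.distrib
         if_distrib[of "\<lambda>u. _ * u"] cong: if_cong)
    moreover have "((\<lambda>s. exp (c * s) * ctmc_trans S Q s z y) has_real_derivative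
       c * exp (c * s) * ctmc_trans S Q s z y
         + (\<Sum>w\<in>S. Q z w * ctmc_trans S Q s w y) * exp (c * s)) (at s)"
      by (intro DERIV_mult ctmc_trans_deriv S(1) z) (auto intro!: derivative_eq_intros)
    ultimately show ?thesis by (simp add: algebra_simps)
  qed
  have "exp (c * t) * ctmc_trans S Q t x y
      = (\<Sum>z\<in>S. ctmc_trans S B t x z * (exp (c * 0) * ctmc_trans S Q 0 z y))"
    by (rule ctmc_trans_unique[where f = "\<lambda>s z. exp (c * s) * ctmc_trans S Q s z y",
          OF S(1,2)]) (rule *)
  also have "\<dots> = ctmc_trans S B t x y"
    using S by (simp add: ctmc_trans_0 if_distrib[of "\<lambda>u. _ * u"] cong: if_cong)
  also have "\<dots> \<ge> 0"
    unfolding ctmc_trans_eq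
    by (intro suminf_nonneg mpow_series_summable S mult_nonneg_nonneg divide_nonneg_nonneg
          mpow_nonneg) (use B0 t in auto)
  finally show ?thesis by (simp add: zero_le_mult_iff)
qed

lemma ctmc_trans_row_sum:
  assumes S: "finite S" "x \<in> S" and row: "\<And>x. x \<in> S \<Longrightarrow> (\<Sum>y\<in>S. Q x y) = 0"
  shows "(\<Sum>y\<in>S. ctmc_trans S Q t x y) = 1"
proof -
  have "(1::real) = (\<Sum>z\<in>S. ctmc_trans S Q t x z * 1)"
    by (rule ctmc_trans_unique[where f = "\<lambda>s z. 1", OF S])
       (auto simp: row)
  then show ?thesis by simp
qed

lemma mpow_reversible:
  assumes S: "finite S" "x \<in> S" "y \<in> S"
    and sym: "\<And>x y. x \<in> S \<Longrightarrow> y \<in> S \<Longrightarrow> \<tau> x * Q x y = \<tau> y * Q y x"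
  shows "\<tau> x * mpow S Q k x y = \<tau> y * mpow S Q k y x"
  using S(2,3)
proof (induction k arbitrary: x y)
  case (Suc k)
  have "\<tau> x * mpow S Q (Suc k) x y = (\<Sum>z\<in>S. (\<tau> x * Q x z) * mpow S Q k z y)"
    by (simp add: mmult_def sum_distrib_left mult.assoc)
  also have "\<dots> = (\<Sum>z\<in>S. (\<tau> z * Q z x) * mpow S Q k z y)"
    using sym Suc.prems by simp
  also have "\<dots> = (\<Sum>z\<in>S. (\<tau> z * mpow S Q k z y) * Q z x)"
    by (simp add: algebra_simps)
  also have "\<dots> = (\<Sum>z\<in>S. (\<tau> y * mpow S Q k y z) * Q z x)"
    using Suc by simp
  also have "\<dots> = \<tau> y * mpow S Q (Suc k) y x"
    unfolding mpow_Suc_right[OF S(1) Suc.prems(2,1)] by (simp add: sum_distrib_left mult.assoc)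
  finally show ?case .
qed auto

lemma ctmc_trans_reversible:
  assumes S: "finite S" "x \<in> S" "y \<in> S"
    and sym: "\<And>x y. x \<in> S \<Longrightarrow> y \<in> S \<Longrightarrow> \<tau> x * Q x y = \<tau> y * Q y x"
  shows "\<tau> x * ctmc_trans S Q t x y = \<tau> y * ctmc_trans S Q t y x"
proof -
  have "\<tau> x * ctmc_trans S Q t x y = (\<Sum>k. \<tau> x * (mpow S Q k x y / fact k * t ^ k))"
    unfolding ctmc_trans_eq by (intro suminf_mult[symmetric] mpow_series_summable S)
  also have "\<dots> = (\<Sum>k. \<tau> y * (mpow S Q k y x / fact k * t ^ k))"
  proof -
    have "\<tau> x * (mpow S Q k x y / fact k * t ^ k) = \<tau> y * (mpow S Q k y x / fact k * t ^ k)" for k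
      using mpow_reversible[where \<tau> = \<tau> and Q = Q and k = k, OF S sym] by (simp add: field_simps)
    then show ?thesis by presburger
  qed
  also have "\<dots> = \<tau> y * ctmc_trans S Q t y x"
    unfolding ctmc_trans_eq by (intro suminf_mult mpow_series_summable S)
  finally show ?thesis .
qed

text \<open>The derivative of \<open>\<Sum>z. \<tau> z * p\<^sub>t(z,y)\<^sup>2\<close> is twice the (nonpositive) Dirichlet form of \<open>p\<^sub>t(\<cdot>,y)\<close>.\<close>

lemma ctmc_trans_diag_antimono:
  assumes S: "finite S" "y \<in> S" and pos: "\<And>x. x \<in> S \<Longrightarrow> \<tau> x > 0"
    and sym: "\<And>x y. x \<in> S \<Longrightarrow> y \<in> S \<Longrightarrow> \<tau> x * Q x y = \<tau> y * Q y x"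
    and dir: "\<And>f. (\<Sum>x\<in>S. \<tau> x * f x * (\<Sum>z\<in>S. Q x z * f z)) \<le> 0"
    and st: "s \<le> t"
  shows "ctmc_trans S Q t y y \<le> ctmc_trans S Q s y y"
proof -
  \<comment> \<open>Halving the time and reversing one of the halves makes the return probability a
    weighted square norm, to which the Dirichlet form applies.\<close>
  have eq: "\<tau> y * ctmc_trans S Q t y y = (\<Sum>z\<in>S. \<tau> z * (ctmc_trans S Q (t/2) z y)\<^sup>2)" for t
  proof -
    have "\<tau> y * ctmc_trans S Q (t/2 + t/2) y y
        = (\<Sum>z\<in>S. (\<tau> y * ctmc_trans S Q (t/2) y z) * ctmc_trans S Q (t/2) z y)"
      unfolding ctmc_trans_add[OF S] by (simp add: sum_distrib_left mult.assoc)
    also have "\<dots> = (\<Sum>z\<in>S. (\<tau> z * ctmc_trans S Q (t/2) z y) * ctmc_trans S Q (t/2) z y)"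
      using ctmc_trans_reversible[where \<tau> = \<tau> and Q = Q, OF S(1,2) _ sym] by (intro sum.cong) auto
    finally show ?thesis by (simp add: power2_eq_square mult.assoc)
  qed
  have "(\<Sum>z\<in>S. \<tau> z * (ctmc_trans S Q (t/2) z y)\<^sup>2) \<le> (\<Sum>z\<in>S. \<tau> z * (ctmc_trans S Q (s/2) z y)\<^sup>2)"
  proof (rule DERIV_nonpos_imp_nonincreasing
      [where f = "\<lambda>r. \<Sum>z\<in>S. \<tau> z * (ctmc_trans S Q r z y)\<^sup>2" and a = "s / 2" and b = "t / 2"])
    show "s / 2 \<le> t / 2" using st by simp
    fix r :: real
    have "((\<lambda>r. \<Sum>z\<in>S. \<tau> z * (ctmc_trans S Q r z y)\<^sup>2) has_real_derivative
        (\<Sum>z\<in>S. 2 * (\<tau> z * ctmc_trans S Q r z y * (\<Sum>w\<in>S. Q z w * ctmc_trans S Q r w y)))) (at r)"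
      by (intro DERIV_sum)
         (auto intro!: derivative_eq_intros ctmc_trans_deriv S(1) simp: mult.commute)
    moreover have "(\<Sum>z\<in>S. 2 * (\<tau> z * ctmc_trans S Q r z y * (\<Sum>w\<in>S. Q z w * ctmc_trans S Q r w y))) \<le> 0"
      unfolding sum_distrib_left[symmetric] using dir[of "\<lambda>z. ctmc_trans S Q r z y"] by simp
    ultimately show "\<exists>y'. ((\<lambda>r. \<Sum>z\<in>S. \<tau> z * (ctmc_trans S Q r z y)\<^sup>2) has_real_derivative y') (at r) \<and> y' \<le> 0"
      by blast
  qed
  then show ?thesis using pos[OF S(2)] by (simp flip: eq)
qed

subsection \<open>The discrete torus and its zero-mean Green kernel\<close>

lemma finite_torus [simp]: "finite (torus n)"
  by (simp add: torus_def)

lemma card_torus: "real (card (torus n)) = 4 ^ n"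
proof -
  have "card (torus n) = nat (2 ^ n) * nat (2 ^ n)" by (simp add: torus_def)
  also have "\<dots> = 4 ^ n" by (simp add: nat_power_eq flip: power_mult_distrib)
  finally show ?thesis by simp
qed

lemma zero_in_torus [simp]: "(0, 0) \<in> torus n"
  by (simp add: torus_def)

lemma wrap_in_torus [simp]: "wrap n z \<in> torus n"
  by (simp add: wrap_def torus_def)

lemma wrap_torus: "z \<in> torus n \<Longrightarrow> wrap n z = z"
  by (cases z) (auto simp: wrap_def torus_def)

lemma wrap_add_wrap: "wrap n (wrap n z + e) = wrap n (z + e)"
  by (simp add: wrap_def plus_prod_def mod_simps)

lemma wrap_diff_wrap: "wrap n (wrap n z - e) = wrap n (z - e)"
  by (simp add: wrap_def minus_prod_def mod_simps)

lemma wrap_wrap_diff: "wrap n (e - wrap n z) = wrap n (e - z)"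
  by (simp add: wrap_def minus_prod_def mod_simps)

lemma bij_betw_torus_shift: "bij_betw (\<lambda>z. wrap n (z + e)) (torus n) (torus n)"
  by (rule bij_betw_byWitness[where f' = "\<lambda>z. wrap n (z - e)"])
     (auto simp: wrap_add_wrap wrap_diff_wrap wrap_torus)

lemma bij_betw_torus_reflect: "bij_betw (\<lambda>z. wrap n (e - z)) (torus n) (torus n)"
  by (rule bij_betw_byWitness[where f' = "\<lambda>z. wrap n (e - z)"])
     (auto simp: wrap_wrap_diff wrap_torus)

lemma sum_torus_shift: "(\<Sum>z\<in>torus n. f (wrap n (z + e))) = (\<Sum>z\<in>torus n. f z)"
  using sum.reindex_bij_betw[OF bij_betw_torus_shift] .

lemma sum_torus_reflect: "(\<Sum>z\<in>torus n. f (wrap n (e - z))) = (\<Sum>z\<in>torus n. f z)"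
  using sum.reindex_bij_betw[OF bij_betw_torus_reflect] .

text \<open>Moves a shift from one factor to the other. The factor \<open>f\<close> lives on the
  whole lattice and is periodic, so it needs no wrapping.\<close>

lemma sum_torus_shift_mult:
  fixes f g :: "int \<times> int \<Rightarrow> real"
  assumes "\<And>z. f (wrap n z) = f z"
  shows "(\<Sum>z\<in>torus n. f z * g (wrap n (z + e))) = (\<Sum>z\<in>torus n. f (z - e) * g z)"
proof -
  have "f (wrap n (z + e) - e) = f z" for z
    by (metis assms wrap_diff_wrap add_diff_cancel_right')
  then have "(\<Sum>z\<in>torus n. f z * g (wrap n (z + e))) =
    (\<Sum>z\<in>torus n. (\<lambda>u. f (u - e) * g u) (wrap n (z + e)))" by simp
  also have "\<dots> = (\<Sum>z\<in>torus n. f (z - e) * g z)" by (rule sum_torus_shift)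
  finally show ?thesis .
qed

text \<open>The transition operator P of the walk. Neighbours are summed with multiplicity, which
  matches \<open>btm_gen\<close> also on tori of side 1 and 2.\<close>

definition srw :: "nat \<Rightarrow> (int \<times> int \<Rightarrow> real) \<Rightarrow> int \<times> int \<Rightarrow> real" where
  "srw n f x = (f (wrap n (x + (1,0))) + f (wrap n (x + (-1,0)))
              + f (wrap n (x + (0,1))) + f (wrap n (x + (0,-1)))) / 4"

lemma btm_gen_apply:
  assumes "\<tau> x > 0" "x \<in> torus n"
  shows "(\<Sum>z\<in>torus n. btm_gen n \<tau> x z * f z) = (srw n f x - f x) / \<tau> x"
proof -
  have len: "real (length (filter (\<lambda>e. wrap n (fst x + fst e, snd x + snd e) = z) unit_dirs)) =
     (if wrap n (x + (1,0)) = z then 1 else 0) + (if wrap n (x + (-1,0)) = z then 1 else 0)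
     + (if wrap n (x + (0,1)) = z then 1 else 0) + (if wrap n (x + (0,-1)) = z then 1 else 0)" for z
    by (auto simp: unit_dirs_def plus_prod_def)
  have ind: "(\<Sum>z\<in>torus n. (if w = z then 1 else 0) * f z) = f w" if "w \<in> torus n" for w
    using that by (simp add: if_distrib[of "\<lambda>u. u * _"] cong: if_cong)
  have "(\<Sum>z\<in>torus n. btm_gen n \<tau> x z * f z) =
     (\<Sum>z\<in>torus n. ((if wrap n (x + (1,0)) = z then 1 else 0) * f z
       + (if wrap n (x + (-1,0)) = z then 1 else 0) * f z
       + (if wrap n (x + (0,1)) = z then 1 else 0) * f z
       + (if wrap n (x + (0,-1)) = z then 1 else 0) * f z) / (4 * \<tau> x)
       - ((if x = z then 1 else 0) * f z) / \<tau> x)"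
    unfolding btm_gen_def len
    by (intro sum.cong refl) (simp add: algebra_simps add_divide_distrib)
  also have "\<dots> = (srw n f x - f x) / \<tau> x"
    unfolding sum_subtractf sum_divide_distrib[symmetric] sum.distrib
    using assms by (simp only: ind wrap_in_torus srw_def) (simp add: field_simps)
  finally show ?thesis .
qed

text \<open>Symmetry of P in the form needed for a kernel: \<open>f\<close> will be
  \<open>green n (x - z)\<close>, which receives the four neighbour shifts without wrapping.\<close>

lemma sum_mult_srw:
  assumes "\<And>z. f (wrap n z) = f z"
  shows "(\<Sum>z\<in>torus n. f z * srw n g z) =
    (\<Sum>z\<in>torus n. (f (z - (1,0)) + f (z + (1,0)) + f (z - (0,1)) + f (z + (0,1))) / 4 * g z)"
proof -
  have [simp]: "z - (-1,0) = z + (1,0)" "z - (0,-1) = z + (0,1)" for z :: "int \<times> int"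
    by (auto simp: minus_prod_def plus_prod_def)
  have "(\<Sum>z\<in>torus n. f z * srw n g z) =
     ((\<Sum>z\<in>torus n. f z * g (wrap n (z + (1,0)))) + (\<Sum>z\<in>torus n. f z * g (wrap n (z + (-1,0))))
     + (\<Sum>z\<in>torus n. f z * g (wrap n (z + (0,1)))) + (\<Sum>z\<in>torus n. f z * g (wrap n (z + (0,-1))))) / 4"
    by (simp add: srw_def sum.distrib[symmetric] sum_divide_distrib[symmetric] ring_distribs)
  also have "\<dots> = ((\<Sum>z\<in>torus n. f (z - (1,0)) * g z) + (\<Sum>z\<in>torus n. f (z + (1,0)) * g z)
     + (\<Sum>z\<in>torus n. f (z - (0,1)) * g z) + (\<Sum>z\<in>torus n. f (z + (0,1)) * g z)) / 4"
    by (simp only: sum_torus_shift_mult[where f = f, OF assms]) simp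
  also have "\<dots> = (\<Sum>z\<in>torus n. (f (z - (1,0)) + f (z + (1,0)) + f (z - (0,1)) + f (z + (0,1))) / 4 * g z)"
    unfolding sum.distrib[symmetric] sum_divide_distrib
    by (intro sum.cong refl) (simp add: field_simps)
  finally show ?thesis .
qed

text \<open>Apply 2ab \<le> a^2 + b^2 along each of the four directions; by shift invariance both
  squares have the same total.\<close>

lemma srw_dirichlet_nonpos: "(\<Sum>x\<in>torus n. f x * (srw n f x - f x)) \<le> (0::real)"
proof -
  have one: "(\<Sum>x\<in>torus n. f x * f (wrap n (x + e))) \<le> (\<Sum>x\<in>torus n. (f x)\<^sup>2)" for e
  proof -
    have "(\<Sum>x\<in>torus n. f x * f (wrap n (x + e)))
        \<le> (\<Sum>x\<in>torus n. ((f x)\<^sup>2 + (f (wrap n (x + e)))\<^sup>2) / 2)"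
    proof (rule sum_mono)
      fix x
      show "f x * f (wrap n (x + e)) \<le> ((f x)\<^sup>2 + (f (wrap n (x + e)))\<^sup>2) / 2"
        using sum_squares_bound[of "f x" "f (wrap n (x + e))"] by simp
    qed
    also have "\<dots> = (\<Sum>x\<in>torus n. (f x)\<^sup>2)"
      using sum_torus_shift[of "\<lambda>x. (f x)\<^sup>2" n e]
      by (simp add: sum.distrib flip: sum_divide_distrib)
    finally show ?thesis .
  qed
  have key: "s1 \<le> s \<Longrightarrow> s2 \<le> s \<Longrightarrow> s3 \<le> s \<Longrightarrow> s4 \<le> s \<Longrightarrow> (s1 + s2 + s3 + s4) / 4 - s \<le> 0"
    for s1 s2 s3 s4 s :: real by simp
  have eq: "(\<Sum>x\<in>torus n. f x * (srw n f x - f x)) =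
     ((\<Sum>x\<in>torus n. f x * f (wrap n (x + (1,0)))) + (\<Sum>x\<in>torus n. f x * f (wrap n (x + (-1,0))))
     + (\<Sum>x\<in>torus n. f x * f (wrap n (x + (0,1)))) + (\<Sum>x\<in>torus n. f x * f (wrap n (x + (0,-1))))) / 4
     - (\<Sum>x\<in>torus n. (f x)\<^sup>2)"
    by (simp add: srw_def sum.distrib[symmetric] sum_divide_distrib[symmetric] ring_distribs
       power2_eq_square sum_subtractf)
  show ?thesis unfolding eq by (intro key one)
qed

section \<open>Fourier analysis on the torus and the Green kernel\<close>

lemma sum_cis_orthogonality:
  assumes "m > 0"
  shows "(\<Sum>j\<in>{0..<int m}. cis (2 * pi * of_int (j * x) / real m)) = (if int m dvd x then of_nat m else 0)"
proof -
  define z where "z = cis (2 * pi * of_int x / real m)"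
  have "(\<Sum>j\<in>{0..<int m}. cis (2 * pi * of_int (j * x) / real m))
      = (\<Sum>j\<in>int ` {0..<m}. cis (2 * pi * of_int (j * x) / real m))"
    by (simp add: image_int_atLeastLessThan)
  also have "\<dots> = (\<Sum>j\<in>{0..<m}. cis (2 * pi * of_int (int j * x) / real m))"
    by (subst sum.reindex) auto
  also have "\<dots> = (\<Sum>j<m. z ^ j)"
    by (intro sum.cong) (auto simp: z_def Complex.DeMoivre intro!: arg_cong[where f = cis])
  finally have eq: "(\<Sum>j\<in>{0..<int m}. cis (2 * pi * of_int (j * x) / real m)) = (\<Sum>j<m. z ^ j)" .
  have zm: "z ^ m = 1"
  proof -
    have "z ^ m = cis (2 * pi * of_int x)"
      using assms by (simp add: z_def Complex.DeMoivre)
    then show ?thesis by (simp only: cis_multiple_2pi Ints_of_int)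
  qed
  show ?thesis
  proof (cases "int m dvd x")
    case True
    then obtain q where "x = int m * q" by (auto elim: dvdE)
    then have "2 * pi * of_int x / real m = 2 * pi * of_int q" using assms by simp
    then have "z = 1" unfolding z_def by (simp only: cis_multiple_2pi Ints_of_int)
    then show ?thesis using eq True by simp
  next
    case False
    have "z \<noteq> 1"
    proof
      assume "z = 1"
      then have "cos (2 * pi * of_int x / real m) = 1" by (simp add: z_def complex_eq_iff)
      then obtain q :: int where "2 * pi * of_int x / real m = of_int q * 2 * pi"
        using cos_one_2pi_int by blast
      then have "real_of_int x = of_int (q * int m)" using assms by (simp add: field_simps)
      then have "x = q * int m" by linarith
      then show False using False by simp
    qed
    then have "(\<Sum>j<m. z ^ j) = 0" using zm by (simp add: geometric_sum)
    then show ?thesis using eq False by simp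
  qed
qed

definition phase :: "nat \<Rightarrow> int \<times> int \<Rightarrow> int \<times> int \<Rightarrow> real" where
  "phase n k x = 2 * pi * of_int (fst k * fst x + snd k * snd x) / 2 ^ n"

lemma phase_commute: "phase n k x = phase n x k"
  by (simp add: phase_def mult.commute)

lemma phase_add: "phase n k (x + y) = phase n k x + phase n k y"
  by (simp add: phase_def algebra_simps add_divide_distrib)

lemma phase_diff: "phase n k (x - y) = phase n k x - phase n k y"
  by (simp add: phase_def algebra_simps add_divide_distrib diff_divide_distrib)

lemma phase_uminus: "phase n k (- x) = - phase n k x"
  by (simp add: phase_def algebra_simps add_divide_distrib diff_divide_distrib)

lemma sum_cos_orthogonality:
  "(\<Sum>k\<in>torus n. cos (phase n k x)) = (if wrap n x = (0,0) then 4 ^ n else 0)"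
proof -
  have L: "(2::int) ^ n = int (2 ^ n)" "(2::real) ^ n = real (2 ^ n)" by auto
  have "(\<Sum>k\<in>torus n. cis (phase n k x)) =
    (\<Sum>i\<in>{0..<int (2^n)}. \<Sum>j\<in>{0..<int (2^n)}. cis (2 * pi * of_int (i * fst x) / real (2^n))
        * cis (2 * pi * of_int (j * snd x) / real (2^n)))"
    unfolding torus_def sum.cartesian_product L
    by (intro sum.cong refl)
       (auto simp: phase_def cis_mult algebra_simps add_divide_distrib)
  also have "\<dots> = (\<Sum>i\<in>{0..<int (2^n)}. cis (2 * pi * of_int (i * fst x) / real (2^n)))
       * (\<Sum>j\<in>{0..<int (2^n)}. cis (2 * pi * of_int (j * snd x) / real (2^n)))"
    by (rule sum_product[symmetric])
  also have "\<dots> = (if wrap n x = (0,0) then 4 ^ n else 0)"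
    by (subst (1 2) sum_cis_orthogonality)
       (auto simp: wrap_def simp flip: power_mult_distrib)
  finally have *: "(\<Sum>k\<in>torus n. cis (phase n k x)) = (if wrap n x = (0,0) then 4 ^ n else 0)" .
  have r: "Re (if wrap n x = (0,0) then 4 ^ n else 0) = (if wrap n x = (0,0) then 4 ^ n else 0)"
  proof -
    have "(4::complex) ^ n = complex_of_real (4 ^ n)" by simp
    then have "Re (4 ^ n) = 4 ^ n" by (metis Re_complex_of_real)
    then show ?thesis by simp
  qed
  have "(\<Sum>k\<in>torus n. cos (phase n k x)) = Re (\<Sum>k\<in>torus n. cis (phase n k x))"
    by simp
  also have "\<dots> = (if wrap n x = (0,0) then 4 ^ n else 0)"
    unfolding * by (rule r)
  finally show ?thesis .
qed

text \<open>The reciprocal of the eigenvalue of I - P at the frequency \<open>k\<close>: 1 - (cos 2a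
  + cos 2b)/2 = sin^2 a + sin^2 b, with a and b the half phases of a unit step. At the zero
  frequency division by zero gives 0.\<close>

definition green_coef :: "nat \<Rightarrow> int \<times> int \<Rightarrow> real" where
  "green_coef n k = 1 / ((sin (pi * of_int (fst k) / 2 ^ n))\<^sup>2 + (sin (pi * of_int (snd k) / 2 ^ n))\<^sup>2)"

text \<open>The inverse of \<open>I - P\<close> on mean-zero functions, for the simple random walk \<open>P\<close> on the torus, in Fourier form.\<close>

definition green :: "nat \<Rightarrow> int \<times> int \<Rightarrow> real" where
  "green n x = (\<Sum>k\<in>torus n - {(0,0)}. green_coef n k * cos (phase n k x)) / 4 ^ n"

lemma green_coef_nonneg: "green_coef n k \<ge> 0"
  by (simp add: green_coef_def)

lemma green_wrap: "green n (wrap n x) = green n x"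
proof -
  have "cos (phase n k (wrap n x)) = cos (phase n k x)" for k
  proof -
    define q where "q = fst k * (fst x div 2^n) + snd k * (snd x div 2^n)"
    have "fst k * (fst x mod 2^n) + snd k * (snd x mod 2^n) = fst k * fst x + snd k * snd x - 2^n * q"
      unfolding q_def minus_mult_div_eq_mod[symmetric] by (simp add: algebra_simps)
    then have "phase n k (wrap n x) = 2 * pi * of_int (fst k * fst x + snd k * snd x - 2^n * q) / 2^n"
      unfolding phase_def wrap_def fst_conv snd_conv by presburger
    also have "\<dots> = phase n k x - 2 * pi * of_int q"
      by (simp add: phase_def field_simps)
    finally show ?thesis
      using cos_int_2pin[of q] sin_int_2pin[of q] by (simp add: cos_diff mult_ac)
  qed
  then show ?thesis by (simp add: green_def)
qed

lemma green_uminus: "green n (- x) = green n x"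
  by (simp add: green_def phase_uminus)

text \<open>The Fourier coefficients are nonnegative, so the cosine sum is largest in absolute value
  where all cosines are 1.\<close>

lemma abs_green_le: "\<bar>green n x\<bar> \<le> green n (0,0)"
proof -
  have "\<bar>\<Sum>k\<in>torus n - {(0,0)}. green_coef n k * cos (phase n k x)\<bar>
      \<le> (\<Sum>k\<in>torus n - {(0,0)}. \<bar>green_coef n k * cos (phase n k x)\<bar>)" by (rule sum_abs)
  also have "\<dots> \<le> (\<Sum>k\<in>torus n - {(0,0)}. green_coef n k * cos (phase n k (0,0)))"
    by (rule sum_mono) (auto simp: abs_mult green_coef_nonneg phase_def intro: mult_left_le)
  finally show ?thesis by (simp add: green_def divide_right_mono abs_divide)
qed

lemma green_coef_denom_pos:
  assumes "k \<in> torus n - {(0,0)}"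
  shows "(sin (pi * of_int (fst k) / 2 ^ n))\<^sup>2 + (sin (pi * of_int (snd k) / 2 ^ n))\<^sup>2 > 0"
proof -
  have *: "sin (pi * of_int j / 2 ^ n) > 0" if "0 < j" "j < 2 ^ n" for j :: int
  proof (rule sin_gt_zero)
    show "0 < pi * of_int j / 2 ^ n" using that by simp
    have "real_of_int j < 2 ^ n" using that by (metis of_int_less_iff of_int_numeral of_int_power)
    then show "pi * of_int j / 2 ^ n < pi" by (simp add: field_simps)
  qed
  obtain i j where k: "k = (i, j)" by (cases k)
  from assms consider "0 < i" "i < 2 ^ n" | "0 < j" "j < 2 ^ n"
    unfolding k torus_def by fastforce
  then show ?thesis
  proof cases
    case 1
    from *[OF this] show ?thesis by (simp add: k add_pos_nonneg)
  next
    case 2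
    from *[OF this] show ?thesis by (simp add: k add_nonneg_pos)
  qed
qed

text \<open>The coefficients cancel the eigenvalues and leave the Fourier series of the point mass
  at the origin without its constant term; the missing term is \<open>1 / 4 ^ n\<close>.\<close>

lemma green_laplace:
  "green n x - (green n (x - (1,0)) + green n (x + (1,0)) + green n (x - (0,1)) + green n (x + (0,1))) / 4
     = (if wrap n x = (0,0) then 1 else 0) - 1 / 4 ^ n"
proof -
  have one: "green_coef n k * cos (phase n k x)
      - (green_coef n k * cos (phase n k (x - (1,0))) + green_coef n k * cos (phase n k (x + (1,0)))
        + green_coef n k * cos (phase n k (x - (0,1))) + green_coef n k * cos (phase n k (x + (0,1)))) / 4
      = cos (phase n k x)" if k: "k \<in> torus n - {(0,0)}" for k
  proof -
    define a b where "a = pi * of_int (fst k) / 2 ^ n" and "b = pi * of_int (snd k) / 2 ^ n"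
    have ph: "phase n k (1,0) = 2 * a" "phase n k (0,1) = 2 * b"
      by (auto simp: phase_def a_def b_def)
    have "cos (phase n k x) - (cos (phase n k (x - (1,0))) + cos (phase n k (x + (1,0)))
        + cos (phase n k (x - (0,1))) + cos (phase n k (x + (0,1)))) / 4
      = cos (phase n k x) * (1 - (cos (2 * a) + cos (2 * b)) / 2)"
      by (simp add: phase_add phase_diff ph cos_add cos_diff field_simps)
    also have "1 - (cos (2 * a) + cos (2 * b)) / 2 = (sin a)\<^sup>2 + (sin b)\<^sup>2"
      by (simp add: cos_double_sin add_divide_distrib diff_divide_distrib)
    finally have "green_coef n k * (cos (phase n k x) - (cos (phase n k (x - (1,0))) + cos (phase n k (x + (1,0)))
        + cos (phase n k (x - (0,1))) + cos (phase n k (x + (0,1)))) / 4)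
       = green_coef n k * ((sin a)\<^sup>2 + (sin b)\<^sup>2) * cos (phase n k x)" by simp
    also have "green_coef n k * ((sin a)\<^sup>2 + (sin b)\<^sup>2) = 1"
      using green_coef_denom_pos[OF k] unfolding green_coef_def a_def b_def
      by (metis less_irrefl nonzero_divide_eq_eq)
    finally show ?thesis by (simp add: algebra_simps)
  qed
  have "green n x - (green n (x - (1,0)) + green n (x + (1,0)) + green n (x - (0,1)) + green n (x + (0,1))) / 4
     = (\<Sum>k\<in>torus n - {(0,0)}. green_coef n k * cos (phase n k x)
      - (green_coef n k * cos (phase n k (x - (1,0))) + green_coef n k * cos (phase n k (x + (1,0)))
        + green_coef n k * cos (phase n k (x - (0,1))) + green_coef n k * cos (phase n k (x + (0,1)))) / 4) / 4 ^ n"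
    unfolding green_def sum_subtractf sum.distrib sum_divide_distrib[symmetric]
    by (simp add: field_simps)
  also have "\<dots> = (\<Sum>k\<in>torus n - {(0,0)}. cos (phase n k x)) / 4 ^ n"
    using one by simp
  also have "(\<Sum>k\<in>torus n - {(0,0)}. cos (phase n k x)) = (\<Sum>k\<in>torus n. cos (phase n k x)) - 1"
    by (subst sum_diff1) (auto simp: phase_def)
  finally show ?thesis
    unfolding sum_cos_orthogonality by (simp add: field_simps)
qed

text \<open>The kernel inverts I - P up to the mean. Applied to a column of the killed Green
  function it yields the identity \<open>G_eq\<close> of \<open>trap_green\<close>.\<close>

lemma green_kernel_apply:
  assumes "x \<in> torus n"
  shows "(\<Sum>z\<in>torus n. green n (x - z) * (f z - srw n f z)) = f x - (\<Sum>z\<in>torus n. f z) / 4 ^ n"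
proof -
  have per: "green n (x - wrap n z) = green n (x - z)" for z
    by (metis green_wrap wrap_wrap_diff)
  have eq0: "wrap n (x - z) = (0,0) \<longleftrightarrow> z = x" if "z \<in> torus n" for z
  proof
    assume "wrap n (x - z) = (0,0)"
    then have "wrap n (wrap n (x - z) + z) = wrap n (0 + z)" by (simp add: zero_prod_def)
    then show "z = x" using that assms by (simp add: wrap_add_wrap wrap_torus)
  qed (simp add: wrap_def)
  have "(\<Sum>z\<in>torus n. green n (x - z) * (f z - srw n f z)) =
     (\<Sum>z\<in>torus n. green n (x - z) * f z) -
     (\<Sum>z\<in>torus n. (green n (x - (z - (1,0))) + green n (x - (z + (1,0)))
        + green n (x - (z - (0,1))) + green n (x - (z + (0,1)))) / 4 * f z)"
    using sum_mult_srw[of "\<lambda>z. green n (x - z)" n f, OF per]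
    by (simp add: right_diff_distrib sum_subtractf)
  also have "\<dots> = (\<Sum>z\<in>torus n. (green n (x - z) - (green n (x - z - (1,0)) + green n (x - z + (1,0))
        + green n (x - z - (0,1)) + green n (x - z + (0,1))) / 4) * f z)"
    unfolding sum_subtractf[symmetric]
    by (intro sum.cong refl) (simp add: algebra_simps diff_diff_eq2)
  also have "\<dots> = (\<Sum>z\<in>torus n. ((if z = x then 1 else 0) - 1 / 4 ^ n) * f z)"
    unfolding green_laplace by (intro sum.cong refl) (simp add: eq0)
  also have "\<dots> = f x - (\<Sum>z\<in>torus n. f z) / 4 ^ n"
    using assms
    by (simp add: left_diff_distrib sum_subtractf sum_divide_distrib
        if_distrib[of "\<lambda>u. u * _"] cong: if_cong)
  finally show ?thesis .
qed

section \<open>Size of the Green kernel: logarithmic on the diagonal, bounded in mean square\<close>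

lemma sin_ge_half: "x / 2 \<le> sin x" if "0 \<le> x" "x \<le> pi / 2" for x :: real
proof -
  have "\<bar>sin x - (\<Sum>m<3. sin_coeff m * x ^ m)\<bar> \<le> inverse (fact 3) * \<bar>x\<bar> ^ 3"
    by (rule Maclaurin_sin_bound)
  moreover have "(\<Sum>m<3. sin_coeff m * x ^ m) = x"
    by (simp add: eval_nat_numeral sin_coeff_def)
  moreover have "fact 3 = (6::real)" by (simp add: eval_nat_numeral)
  moreover have "\<bar>x\<bar> ^ 3 = x * x\<^sup>2" using that by (simp add: power3_eq_cube power2_eq_square)
  ultimately have "\<bar>sin x - x\<bar> \<le> x * x\<^sup>2 / 6" by simp
  then have "x - x * x\<^sup>2 / 6 \<le> sin x" by linarith
  moreover have "x * x\<^sup>2 \<le> x * 3"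
  proof (rule mult_left_mono)
    have "pi \<le> 3.2" using pi_approx by simp
    then have "x\<^sup>2 \<le> 1.6\<^sup>2" using that by (intro power_mono) auto
    then show "x\<^sup>2 \<le> 3" by (simp add: power2_eq_square)
  qed (use that in auto)
  ultimately show ?thesis by simp
qed

lemma sum_torus_nat:
  "(\<Sum>k\<in>torus n. F k) = (\<Sum>i<2^n. \<Sum>j<2^n. F (int i, int j))"
proof -
  have "(\<Sum>k\<in>torus n. F k) = (\<Sum>i\<in>{0..<2^n}. \<Sum>j\<in>{0..<2^n}. F (i, j))"
    unfolding torus_def by (simp add: sum.cartesian_product)
  also have "{0..<(2::int)^n} = int ` {..<2^n}"
    using image_int_atLeastLessThan[of 0 "2^n"] by (simp add: atLeast0LessThan)
  finally show ?thesis by (simp add: sum.reindex)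
qed

text \<open>The frequencies i and 2^n - i have the same sine, so a sum over one period folds into a
  sum over the distance to 0, every positive distance counted at most twice.\<close>

lemma sum_min_reflect_le:
  fixes \<phi> :: "nat \<Rightarrow> real"
  assumes "\<And>j. \<phi> j \<ge> 0"
  shows "(\<Sum>j<m. \<phi> (min j (m - j))) \<le> \<phi> 0 + 2 * (\<Sum>j=1..m. \<phi> j)"
proof (cases m)
  case (Suc l)
  have "(\<Sum>j<m. \<phi> (min j (m - j))) = \<phi> 0 + (\<Sum>j=1..<m. \<phi> (min j (m - j)))"
    unfolding Suc lessThan_atLeast0 by (subst sum.atLeast_Suc_lessThan) auto
  also have "(\<Sum>j=1..<m. \<phi> (min j (m - j))) \<le> (\<Sum>j=1..<m. \<phi> j + \<phi> (m - j))"
    using assms by (intro sum_mono) (auto simp: min_def)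
  also have "\<dots> = (\<Sum>j=1..<m. \<phi> j) + (\<Sum>j=1..<m. \<phi> (m - j))"
    by (rule sum.distrib)
  also have "(\<Sum>j=1..<m. \<phi> (m - j)) = (\<Sum>j=1..<m. \<phi> j)"
    by (rule sum.reindex_bij_witness[where i = "\<lambda>j. m - j" and j = "\<lambda>j. m - j"]) auto
  also have "(\<Sum>j=1..<m. \<phi> j) \<le> (\<Sum>j=1..m. \<phi> j)"
    using assms by (intro sum_mono2) auto
  finally show ?thesis by simp
qed (simp add: assms)

lemma sum_inverse_squares_shift_le:
  assumes "a \<ge> 1"
  shows "(\<Sum>j=1..m. 1 / (real a + real j)\<^sup>2) \<le> 1 / a - 1 / (a + m)"
proof (induction m)
  case (Suc m)
  have "1 / (real a + real (Suc m))\<^sup>2 \<le> 1 / ((real a + m) * (real a + Suc m))"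
    using assms by (intro divide_left_mono) (auto simp: power2_eq_square)
  also have "\<dots> = 1 / (real a + m) - 1 / (real a + Suc m)"
    using assms by (simp add: field_simps)
  finally show ?case using Suc by simp
qed simp

lemma sum_inverse_squares_le: "(\<Sum>j=1..m. 1 / (real j)\<^sup>2) \<le> 2"
proof (cases m)
  case (Suc l)
  have "(\<Sum>j=1..m. 1 / (real j)\<^sup>2) = 1 + (\<Sum>j=1..l. 1 / (1 + real j)\<^sup>2)"
    unfolding Suc by (induction l) (auto simp: add_ac)
  also have "\<dots> \<le> 1 + 1"
    using sum_inverse_squares_shift_le[of 1 l] by (intro add_left_mono) (auto intro: order_trans)
  finally show ?thesis by simp
qed simp

text \<open>With d the distance of i to the nearest multiple of 2^n one has d \<le> 2^n / 2, and
  sin(\<pi> d / 2^n) \<ge> d / 2^n follows from \<open>sin_ge_half\<close> and \<pi> \<ge> 2. At i =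
  j = 0 both sides are 0 because of the division by zero.\<close>

lemma green_coef_le:
  assumes "i < 2 ^ n" "j < 2 ^ n"
  shows "green_coef n (int i, int j)
    \<le> 4 ^ n / ((real (min i (2 ^ n - i)))\<^sup>2 + (real (min j (2 ^ n - j)))\<^sup>2)"
proof -
  have sin_ge: "(real (min i (2 ^ n - i)) / 2 ^ n)\<^sup>2 \<le> (sin (pi * real i / 2 ^ n))\<^sup>2" if "i < 2 ^ n" for i
  proof -
    define d where "d = min i (2 ^ n - i)"
    have d: "real d \<le> 2 ^ n / 2"
    proof -
      have "2 * d \<le> 2 ^ n" using that by (auto simp: d_def min_def)
      then have "real (2 * d) \<le> real (2 ^ n)" by (rule of_nat_mono)
      then show ?thesis by simp
    qed
    have "sin (pi * real i / 2 ^ n) = sin (pi * real d / 2 ^ n)"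
    proof (cases "d = i")
      case False
      then have "d = 2 ^ n - i" by (auto simp: d_def min_def split: if_splits)
      then have "real d = 2 ^ n - real i" using that by (simp add: of_nat_diff)
      then have "pi * real d / 2 ^ n = pi - pi * real i / 2 ^ n"
        by (simp add: right_diff_distrib diff_divide_distrib)
      then show ?thesis by simp
    qed simp
    moreover have "pi * real d / 2 ^ n / 2 \<le> sin (pi * real d / 2 ^ n)"
      using d by (intro sin_ge_half) (auto simp: field_simps)
    moreover have "real d / 2 ^ n \<le> pi * real d / 2 ^ n / 2"
      using mult_right_mono[OF pi_ge_two, of "real d"] by (simp add: field_simps)
    ultimately have "real d / 2 ^ n \<le> sin (pi * real i / 2 ^ n)" by simp
    then show ?thesis unfolding d_def[symmetric] by (intro power_mono) auto
  qed
  define D where "D = (real (min i (2 ^ n - i)))\<^sup>2 + (real (min j (2 ^ n - j)))\<^sup>2"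
  have four: "(4::real) ^ n = (2 ^ n)\<^sup>2" by (simp add: power2_eq_square flip: power_mult_distrib)
  have le: "D / 4 ^ n \<le> (sin (pi * real i / 2 ^ n))\<^sup>2 + (sin (pi * real j / 2 ^ n))\<^sup>2"
    using sin_ge[OF assms(1)] sin_ge[OF assms(2)]
    by (simp add: D_def four power_divide add_divide_distrib)
  show ?thesis
  proof (cases "D = 0")
    case True
    then have "i = 0" "j = 0"
      using assms by (auto simp: D_def add_nonneg_eq_0_iff min_def split: if_splits)
    then show ?thesis by (simp add: green_coef_def)
  next
    case False
    moreover have "D \<ge> 0" by (simp add: D_def)
    ultimately have "D > 0" by linarith
    then have pos: "D / 4 ^ n > 0" by simp
    have "1 / ((sin (pi * real i / 2 ^ n))\<^sup>2 + (sin (pi * real j / 2 ^ n))\<^sup>2) \<le> 1 / (D / 4 ^ n)"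
      by (rule frac_le) (use le pos in auto)
    then show ?thesis by (simp add: green_coef_def D_def)
  qed
qed

lemma green_zero: "green n (0,0) = (\<Sum>i<2^n. \<Sum>j<2^n. green_coef n (int i, int j)) / 4 ^ n"
proof -
  have "green n (0,0) = (\<Sum>k\<in>torus n - {(0,0)}. green_coef n k) / 4 ^ n"
    by (simp add: green_def phase_def)
  also have "(\<Sum>k\<in>torus n - {(0,0)}. green_coef n k) = (\<Sum>k\<in>torus n. green_coef n k)"
    by (subst sum_diff1) (auto simp: green_coef_def)
  finally show ?thesis by (simp add: sum_torus_nat)
qed

text \<open>The double sum of 1/(i^2 + j^2) is harmonic: a row at distance a from the axis
  contributes at most 5/a, and the harmonic number of 2^n is at most 1 + n.\<close>

lemma green_zero_le:
  assumes "n \<ge> 1"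
  shows "green n (0,0) \<le> 24 * real n"
proof -
  define h where "h = (\<lambda>i::nat. min i (2 ^ n - i))"
  \<comment> \<open>For a > 0 the term j = 0 gives at most 1/a and each of the two halves at most
    2/a. For a = 0 the term j = 0 is 1/0 = 0, and each half is a sum of inverse squares, at most
    2.\<close>
  have inner: "(\<Sum>j<2^n. 1 / ((real a)\<^sup>2 + (real (h j))\<^sup>2)) \<le> (if a = 0 then 4 else 5 / real a)" for a
  proof -
    have "(\<Sum>j<2^n. 1 / ((real a)\<^sup>2 + (real (h j))\<^sup>2))
        \<le> 1 / ((real a)\<^sup>2 + (real 0)\<^sup>2) + 2 * (\<Sum>j=1..2^n. 1 / ((real a)\<^sup>2 + (real j)\<^sup>2))"
      unfolding h_def by (rule sum_min_reflect_le) auto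
    also have "\<dots> \<le> (if a = 0 then 4 else 5 / real a)"
    proof (cases "a = 0")
      case True
      then show ?thesis using sum_inverse_squares_le[of "2^n"] by simp
    next
      case False
      have "(\<Sum>j=1..2^n. 1 / ((real a)\<^sup>2 + (real j)\<^sup>2)) \<le> (\<Sum>j=1..2^n. 2 * (1 / (real a + real j)\<^sup>2))"
      proof (rule sum_mono)
        fix j
        have "(real a + real j)\<^sup>2 \<le> 2 * ((real a)\<^sup>2 + (real j)\<^sup>2)"
          using sum_squares_bound[of "real a" "real j"] by (simp add: power2_sum)
        then show "1 / ((real a)\<^sup>2 + (real j)\<^sup>2) \<le> 2 * (1 / (real a + real j)\<^sup>2)"
          using False by (simp add: field_simps add_pos_nonneg)
      qed
      also have "\<dots> \<le> 2 * (1 / a)"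
        unfolding sum_distrib_left[symmetric]
        using sum_inverse_squares_shift_le[of a "2^n"] False
        by (intro mult_left_mono) (auto intro: order_trans)
      finally have "(\<Sum>j=1..2^n. 1 / ((real a)\<^sup>2 + (real j)\<^sup>2)) \<le> 2 / a" by simp
      moreover have "1 / (real a)\<^sup>2 \<le> 1 / a"
        using False by (intro divide_left_mono) (auto simp: power2_eq_square)
      ultimately have "1 / (real a)\<^sup>2 + 2 * (\<Sum>j=1..2^n. 1 / ((real a)\<^sup>2 + (real j)\<^sup>2)) \<le> 1 / a + 2 * (2 / a)"
        by linarith
      then show ?thesis using False by simp
    qed
    finally show ?thesis .
  qed
  have "(\<Sum>i<2^n. \<Sum>j<2^n. green_coef n (int i, int j))
      \<le> (\<Sum>i<2^n. \<Sum>j<2^n. 4 ^ n * (1 / ((real (h i))\<^sup>2 + (real (h j))\<^sup>2)))"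
    using green_coef_le by (intro sum_mono) (simp add: h_def)
  also have "\<dots> = 4 ^ n * (\<Sum>i<2^n. \<Sum>j<2^n. 1 / ((real (h i))\<^sup>2 + (real (h j))\<^sup>2))"
    by (simp add: sum_distrib_left)
  also have "(\<Sum>i<2^n. \<Sum>j<2^n. 1 / ((real (h i))\<^sup>2 + (real (h j))\<^sup>2))
      \<le> (\<Sum>i<2^n. (\<lambda>a. if a = 0 then 4 else 5 / real a) (h i))"
    using inner by (intro sum_mono) simp
  also have "\<dots> \<le> (\<lambda>a. if a = 0 then 4 else 5 / real a) (0::nat)
      + 2 * (\<Sum>j=1..2^n. (\<lambda>a. if a = 0 then 4 else 5 / real a) j)"
    unfolding h_def by (rule sum_min_reflect_le) auto
  also have "(\<Sum>j=1..(2::nat)^n. (\<lambda>a. if a = 0 then 4 else 5 / real a) j) = 5 * harm (2 ^ n)"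
    by (simp add: harm_def sum_distrib_left field_simps)
  also have "(harm (2 ^ n) :: real) \<le> 1 + real n"
  proof -
    have "harm (2 ^ n) - ln (real (2 ^ n)) \<le> harm 1 - ln (real 1)"
      by (rule euler_mascheroni_sequence_decreasing) auto
    moreover have "real n * ln 2 \<le> real n * 1"
      using ln_2_less_1 by (intro mult_left_mono) auto
    ultimately show ?thesis by (simp add: ln_realpow harm_def)
  qed
  \<comment> \<open>Here 14 + 10 n is 4 + 2 * 5 (1 + n), the row a = 0 and the folded remaining
    rows; passing to 24 n uses n \<ge> 1.\<close>
  finally have "(\<Sum>i<2^n. \<Sum>j<2^n. green_coef n (int i, int j)) \<le> 4 ^ n * (14 + 10 * real n)" by simp
  also have "\<dots> \<le> 4 ^ n * (24 * real n)" using assms by (intro mult_left_mono) auto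
  finally show ?thesis unfolding green_zero by (simp add: divide_simps mult.commute)
qed

text \<open>Only the frequencies with 1 \<le> j \<le> i are kept. There |sin x| \<le> |x| bounds the
  denominator by 2 \<pi>^2 i^2 / 4^n, so the i terms of row i add up to a multiple of 1/i. The
  constant 64 comes from ln 2 \<ge> 1/2 and 2 \<pi>^2 \<le> 32.\<close>

lemma green_zero_ge: "real n / 64 \<le> green n (0,0)"
proof -
  have "1 / (2 * pi\<^sup>2) * harm (2^n - 1) = (\<Sum>i\<in>{1..2^n - 1}. \<Sum>j\<in>{1..i}. 1 / (2 * pi\<^sup>2 * (real i)\<^sup>2))"
    by (simp add: harm_def sum_distrib_left power2_eq_square field_simps)
  also have "\<dots> \<le> (\<Sum>i\<in>{1..2^n - 1}. \<Sum>j\<in>{1..i}. green_coef n (int i, int j) / 4 ^ n)"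
  proof (intro sum_mono)
    fix i j :: nat
    assume i: "i \<in> {1..2^n - 1}" and j: "j \<in> {1..i}"
    have four: "(4::real) ^ n = (2 ^ n)\<^sup>2" by (simp add: power2_eq_square flip: power_mult_distrib)
    define s where "s = (sin (pi * real i / 2 ^ n))\<^sup>2 + (sin (pi * real j / 2 ^ n))\<^sup>2"
    have sq: "(sin (pi * real l / 2 ^ n))\<^sup>2 \<le> pi\<^sup>2 * (real i)\<^sup>2 / 4 ^ n" if "l \<le> i" for l
    proof -
      have "\<bar>sin (pi * real l / 2 ^ n)\<bar> \<le> \<bar>pi * real l / 2 ^ n\<bar>" by (rule abs_sin_x_le_abs_x)
      also have "\<dots> \<le> pi * real i / 2 ^ n" using that by (simp add: divide_right_mono)
      finally have "\<bar>sin (pi * real l / 2 ^ n)\<bar>\<^sup>2 \<le> (pi * real i / 2 ^ n)\<^sup>2" by (intro power_mono) auto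
      then show ?thesis by (simp add: power_mult_distrib power_divide four)
    qed
    have s: "s \<le> 2 * pi\<^sup>2 * (real i)\<^sup>2 / 4 ^ n"
      using sq[of i] sq[of j] j by (simp add: s_def)
    have "i < 2 ^ n" using i by (auto simp: Suc_le_eq intro: le_less_trans)
    then have "(int i, int j) \<in> torus n - {(0,0)}"
      using i j by (auto simp: torus_def intro: le_less_trans)
    from green_coef_denom_pos[OF this] have "s > 0" by (simp add: s_def)
    then have "1 / (2 * pi\<^sup>2 * (real i)\<^sup>2 / 4 ^ n) \<le> 1 / s"
      using s i by (intro divide_left_mono) auto
    then have "1 / (2 * pi\<^sup>2 * (real i)\<^sup>2 / 4 ^ n) / 4 ^ n \<le> 1 / s / 4 ^ n"
      by (intro divide_right_mono) auto
    then show "1 / (2 * pi\<^sup>2 * (real i)\<^sup>2) \<le> green_coef n (int i, int j) / 4 ^ n"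
      by (simp add: green_coef_def s_def)
  qed
  also have "\<dots> \<le> (\<Sum>i\<in>{1..2^n - 1}. \<Sum>j<2^n. green_coef n (int i, int j) / 4 ^ n)"
    by (intro sum_mono sum_mono2) (auto simp: green_coef_nonneg Suc_le_eq intro: le_less_trans)
  also have "\<dots> \<le> (\<Sum>i<2^n. \<Sum>j<2^n. green_coef n (int i, int j) / 4 ^ n)"
    by (intro sum_mono2) (auto simp: green_coef_nonneg Suc_le_eq intro!: sum_nonneg intro: le_less_trans)
  also have "\<dots> = green n (0,0)"
    by (simp add: green_zero sum_divide_distrib)
  finally have 1: "1 / (2 * pi\<^sup>2) * harm (2^n - 1) \<le> green n (0,0)" .
  have "real n / 2 \<le> real n * ln 2"
    using mult_left_mono[OF ln2_ge_two_thirds, of "real n"] by simp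
  also have "\<dots> = ln (real (2 ^ n - 1) + 1)" by (simp add: ln_realpow of_nat_diff)
  also have "\<dots> \<le> harm (2 ^ n - 1)" by (rule ln_le_harm)
  finally have 2: "real n / 2 \<le> harm (2 ^ n - 1)" .
  have 3: "1 / 32 \<le> 1 / (2 * pi\<^sup>2)"
  proof -
    have "pi\<^sup>2 \<le> 4\<^sup>2" using pi_less_4 by (intro power_mono) auto
    then show ?thesis by (intro divide_left_mono) auto
  qed
  have "1 / 32 * (real n / 2) \<le> 1 / (2 * pi\<^sup>2) * harm (2^n - 1)"
    by (intro mult_mono 2 3) auto
  then show ?thesis using 1 by simp
qed

text \<open>After squaring, the sum over frequencies converges. Bounding 1/(a+b)^2 by a product
  splits the double sum into two single sums of size at most 5, hence 50 = 2 * 5 * 5.\<close>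

lemma sum_green_coef_sq_le: "(\<Sum>k\<in>torus n. (green_coef n k)\<^sup>2) \<le> 50 * 16 ^ n"
proof -
  define h where "h = (\<lambda>i::nat. min i (2 ^ n - i))"
  have one: "(\<Sum>j<2^n. 1 / (1 + (real (h j))\<^sup>2)) \<le> 5"
  proof -
    have "(\<Sum>j<2^n. 1 / (1 + (real (h j))\<^sup>2)) \<le> 1 / (1 + (real 0)\<^sup>2) + 2 * (\<Sum>j=1..2^n. 1 / (1 + (real j)\<^sup>2))"
      unfolding h_def by (rule sum_min_reflect_le) auto
    also have "(\<Sum>j=1..2^n. 1 / (1 + (real j)\<^sup>2)) \<le> (\<Sum>j=1..2^n. 1 / (real j)\<^sup>2)"
      by (intro sum_mono divide_left_mono) (auto intro!: mult_pos_pos add_pos_nonneg)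
    also have "\<dots> \<le> 2" by (rule sum_inverse_squares_le)
    finally show ?thesis by simp
  qed
  have coef: "(green_coef n (int i, int j))\<^sup>2 \<le> 2 * 16 ^ n * (1 / (1 + (real (h i))\<^sup>2) * (1 / (1 + (real (h j))\<^sup>2)))"
    if "i < 2 ^ n" "j < 2 ^ n" for i j
  proof -
    define a b where "a = (real (h i))\<^sup>2" and "b = (real (h j))\<^sup>2"
    have "(real m)\<^sup>2 = 0 \<or> (real m)\<^sup>2 \<ge> 1" for m
      by (cases "m = 0") (auto simp: one_le_power)
    then have ab: "a = 0 \<or> a \<ge> 1" "b = 0 \<or> b \<ge> 1" unfolding a_def b_def by blast+
    have "(green_coef n (int i, int j))\<^sup>2 \<le> (4 ^ n / (a + b))\<^sup>2"
      using green_coef_le[OF that] green_coef_nonneg by (intro power_mono) (auto simp: a_def b_def h_def)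
    also have "\<dots> = 16 ^ n * (1 / (a + b)\<^sup>2)"
      by (simp add: power_divide power2_eq_square flip: power_mult_distrib)
    \<comment> \<open>This uses that a and b are squares of integers, hence 0 or at least 1; at a =
      b = 0 the left side is 1/0 = 0.\<close>
    also have "1 / (a + b)\<^sup>2 \<le> 2 / ((1 + a) * (1 + b))"
    proof (cases "a = 0 \<and> b = 0")
      case False
      have "(1 + a) * (1 + b) \<le> 2 * (a + b)\<^sup>2"
      proof -
        consider "a = 0" "b \<ge> 1" | "a \<ge> 1" "b = 0" | "a \<ge> 1" "b \<ge> 1" using ab False by auto
        then show ?thesis
        proof cases
          case 1
          then have "1 * b \<le> b * b" by (intro mult_right_mono) auto
          then have "1 + b \<le> 2 * (b * b)" using 1 by linarith
          then show ?thesis using 1 by (simp add: power2_eq_square)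
        next
          case 2
          then have "1 * a \<le> a * a" by (intro mult_right_mono) auto
          then have "1 + a \<le> 2 * (a * a)" using 2 by linarith
          then show ?thesis using 2 by (simp add: power2_eq_square)
        next
          case 3
          have "(1 + a) * (1 + b) \<le> (a + a) * (b + b)" using 3 by (intro mult_mono) auto
          also have "\<dots> = 4 * (a * b)" by simp
          also have "\<dots> \<le> 2 * (a + b)\<^sup>2"
            using 3 by (simp add: power2_sum)
          finally show ?thesis .
        qed
      qed
      moreover have "(a + b)\<^sup>2 > 0" using False ab by (auto simp: power2_eq_square)
      moreover have "(1 + a) * (1 + b) > 0" using ab by auto
      ultimately show ?thesis by (simp add: field_simps)
    qed (auto simp: a_def b_def)
    finally have "(green_coef n (int i, int j))\<^sup>2 \<le> 16 ^ n * (2 / ((1 + a) * (1 + b)))"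
      by (simp add: mult_left_mono)
    then show ?thesis by (simp add: a_def b_def mult.commute[of 2])
  qed
  have "(\<Sum>k\<in>torus n. (green_coef n k)\<^sup>2) = (\<Sum>i<2^n. \<Sum>j<2^n. (green_coef n (int i, int j))\<^sup>2)"
    by (rule sum_torus_nat)
  also have "\<dots> \<le> (\<Sum>i<2^n. \<Sum>j<2^n. 2 * 16 ^ n * (1 / (1 + (real (h i))\<^sup>2) * (1 / (1 + (real (h j))\<^sup>2))))"
    using coef by (intro sum_mono) auto
  also have "\<dots> = 2 * 16 ^ n * ((\<Sum>i<2^n. 1 / (1 + (real (h i))\<^sup>2)) * (\<Sum>j<2^n. 1 / (1 + (real (h j))\<^sup>2)))"
    unfolding sum_product by (simp only: sum_distrib_left)
  also have "\<dots> \<le> 2 * 16 ^ n * (5 * 5)"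
    by (intro mult_left_mono mult_mono one) (auto intro!: sum_nonneg)
  finally show ?thesis by simp
qed

lemma card_torus_congruent_le:
  "(\<Sum>l\<in>torus n. if wrap n (k + l) = (0,0) then 1 else (0::real)) \<le> 1"
  "(\<Sum>l\<in>torus n. if wrap n (k - l) = (0,0) then 1 else (0::real)) \<le> 1"
proof -
  have "(\<Sum>l\<in>torus n. (\<lambda>u. if u = (0,0) then 1 else (0::real)) (wrap n (l + k))) =
        (\<Sum>l\<in>torus n. if l = (0,0) then 1 else 0)"
    by (rule sum_torus_shift)
  then show "(\<Sum>l\<in>torus n. if wrap n (k + l) = (0,0) then 1 else (0::real)) \<le> 1"
    by (simp add: add.commute)
  have "(\<Sum>l\<in>torus n. (\<lambda>u. if u = (0,0) then 1 else (0::real)) (wrap n (k - l))) =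
        (\<Sum>l\<in>torus n. if l = (0,0) then 1 else 0)"
    by (rule sum_torus_reflect)
  then show "(\<Sum>l\<in>torus n. if wrap n (k - l) = (0,0) then 1 else (0::real)) \<le> 1"
    by simp
qed

text \<open>Parseval with cosines in place of characters: frequencies k and l interact when l is
  congruent to k or to -k. Each k has at most one partner of either kind, so replacing products of
  coefficients by squares loses only that count.\<close>

lemma sum_green_sq_le: "(\<Sum>x\<in>torus n. (green n x)\<^sup>2) \<le> 50 * 4 ^ n"
proof -
  define c where "c = (\<lambda>k. if k = (0,0) then 0 else green_coef n k)"
  have c0: "c k \<ge> 0" for k by (simp add: c_def green_coef_nonneg)
  define N :: real where "N = 4 ^ n"
  have N: "N > 0" by (simp add: N_def)
  have g: "green n x = (\<Sum>k\<in>torus n. c k * cos (phase n k x)) / N" for x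
  proof -
    have "(\<Sum>k\<in>torus n - {(0,0)}. green_coef n k * cos (phase n k x)) = (\<Sum>k\<in>torus n. c k * cos (phase n k x))"
      by (rule sum.mono_neutral_cong_left) (auto simp: c_def)
    then show ?thesis by (simp add: green_def N_def)
  qed
  define I where "I = (\<lambda>k l. (if wrap n (k - l) = (0,0) then 1 else (0::real)) + (if wrap n (k + l) = (0,0) then 1 else 0))"
  have I0: "I k l \<ge> 0" for k l by (simp add: I_def)
  have orth: "(\<Sum>x\<in>torus n. cos (phase n k x) * cos (phase n l x)) = N / 2 * I k l" for k l
  proof -
    have "(\<Sum>x\<in>torus n. cos (phase n k x) * cos (phase n l x)) =
      (\<Sum>x\<in>torus n. (cos (phase n x (k - l)) + cos (phase n x (k + l))) / 2)"
      by (intro sum.cong refl) (simp add: cos_times_cos phase_diff phase_add phase_commute)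
    also have "\<dots> = ((\<Sum>x\<in>torus n. cos (phase n x (k - l))) + (\<Sum>x\<in>torus n. cos (phase n x (k + l)))) / 2"
      by (simp add: sum.distrib flip: sum_divide_distrib)
    finally show ?thesis
      unfolding sum_cos_orthogonality by (auto simp: I_def N_def)
  qed
  have "(\<Sum>x\<in>torus n. (green n x)\<^sup>2) =
     (\<Sum>x\<in>torus n. (\<Sum>k\<in>torus n. \<Sum>l\<in>torus n. (c k * cos (phase n k x)) * (c l * cos (phase n l x)))) / N\<^sup>2"
    unfolding g power_divide sum_divide_distrib[symmetric] by (simp add: power2_eq_square sum_product)
  also have "(\<Sum>x\<in>torus n. (\<Sum>k\<in>torus n. \<Sum>l\<in>torus n. (c k * cos (phase n k x)) * (c l * cos (phase n l x)))) =
     (\<Sum>k\<in>torus n. \<Sum>x\<in>torus n. \<Sum>l\<in>torus n. (c k * cos (phase n k x)) * (c l * cos (phase n l x)))"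
    by (rule sum.swap)
  also have "\<dots> = (\<Sum>k\<in>torus n. \<Sum>l\<in>torus n. \<Sum>x\<in>torus n. (c k * cos (phase n k x)) * (c l * cos (phase n l x)))"
    by (intro sum.cong refl sum.swap)
  also have "\<dots> = (\<Sum>k\<in>torus n. \<Sum>l\<in>torus n. c k * c l * (N / 2 * I k l))"
    unfolding orth[symmetric] sum_distrib_left by (simp add: algebra_simps)
  also have "\<dots> \<le> (\<Sum>k\<in>torus n. \<Sum>l\<in>torus n. ((c k)\<^sup>2 + (c l)\<^sup>2) / 2 * (N / 2 * I k l))"
  proof (intro sum_mono mult_right_mono)
    fix k l show "c k * c l \<le> ((c k)\<^sup>2 + (c l)\<^sup>2) / 2"
      using sum_squares_bound[of "c k" "c l"] by simp
  qed (use N I0 in auto)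
  also have "\<dots> = N / 4 * ((\<Sum>k\<in>torus n. (c k)\<^sup>2 * (\<Sum>l\<in>torus n. I k l))
      + (\<Sum>k\<in>torus n. \<Sum>l\<in>torus n. (c l)\<^sup>2 * I k l))"
    unfolding sum_distrib_left sum.distrib[symmetric] by (simp add: algebra_simps add_divide_distrib)
  also have "(\<Sum>k\<in>torus n. \<Sum>l\<in>torus n. (c l)\<^sup>2 * I k l) = (\<Sum>l\<in>torus n. (c l)\<^sup>2 * (\<Sum>k\<in>torus n. I k l))"
    by (subst sum.swap) (simp add: sum_distrib_left)
  also have "N / 4 * ((\<Sum>k\<in>torus n. (c k)\<^sup>2 * (\<Sum>l\<in>torus n. I k l)) + (\<Sum>l\<in>torus n. (c l)\<^sup>2 * (\<Sum>k\<in>torus n. I k l)))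
     \<le> N / 4 * ((\<Sum>k\<in>torus n. (c k)\<^sup>2 * 2) + (\<Sum>l\<in>torus n. (c l)\<^sup>2 * 2))"
  proof -
    have 1: "(\<Sum>l\<in>torus n. I k l) \<le> 2" for k
      using card_torus_congruent_le[of n k] by (simp add: I_def sum.distrib)
    have "I k l = I l k" for k l
    proof -
      have "wrap n (k - l) = (0,0) \<longleftrightarrow> wrap n (l - k) = (0,0)"
        by (auto simp: wrap_def mod_0_imp_dvd dvd_diff_commute intro!: dvd_imp_mod_0)
      then show ?thesis by (simp add: I_def add.commute)
    qed
    then have 2: "(\<Sum>k\<in>torus n. I k l) \<le> 2" for l using 1[of l] by simp
    show ?thesis using N by (intro mult_left_mono add_mono sum_mono 1 2) auto
  qed
  also have "\<dots> = N * (\<Sum>k\<in>torus n. (c k)\<^sup>2)"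
    by (simp add: sum_distrib_left[symmetric] sum_distrib_right[symmetric])
  also have "(\<Sum>k\<in>torus n. (c k)\<^sup>2) \<le> (\<Sum>k\<in>torus n. (green_coef n k)\<^sup>2)"
    by (intro sum_mono) (auto simp: c_def)
  also have "\<dots> \<le> 50 * 16 ^ n" by (rule sum_green_coef_sq_le)
  finally have "(\<Sum>x\<in>torus n. (green n x)\<^sup>2) \<le> N * (50 * 16 ^ n) / N\<^sup>2"
    using N by (simp add: divide_right_mono mult_left_mono)
  also have "\<dots> = 50 * 4 ^ n"
  proof -
    have "(16::real) ^ n = N\<^sup>2" by (simp add: N_def power2_eq_square flip: power_mult_distrib)
    then show ?thesis using N by (simp add: N_def)
  qed
  finally show ?thesis .
qed

subsection \<open>Mean-field approximation of the killed Green function\<close>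

text \<open>\<open>G\<close> is the Green function of the walk killed at rate \<open>V z = a * v z / g\<close>, so that
  \<open>w y z = V z * G z y\<close> is the law of the place of death; \<open>A\<close> is the zero-mean Green kernel.
  The identity \<open>G_eq\<close> determines \<open>G\<close> up to the interaction of sites \<open>x \<noteq> z\<close> with
  \<open>\<bar>A x z\<bar> > b\<close>, whose total weight is measured by \<open>S\<close>.\<close>

locale trap_green =
  fixes X :: "'a set" and A G :: "'a \<Rightarrow> 'a \<Rightarrow> real" and m v :: "'a \<Rightarrow> real" and a g b :: real
  assumes fin: "finite X"
    and g_pos: "g > 0" and a1: "a \<ge> 1" and b0: "b \<ge> 0"
    and A_diag: "\<And>x. A x x = g"
    and A_le: "\<And>x z. \<bar>A x z\<bar> \<le> g"
    and A_sym: "\<And>x z. A x z = A z x"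
    and v_pos: "\<And>x. x \<in> X \<Longrightarrow> v x > 0"
    and G_nonneg: "\<And>x y. x \<in> X \<Longrightarrow> y \<in> X \<Longrightarrow> G x y \<ge> 0"
    and m_nonneg: "\<And>y. y \<in> X \<Longrightarrow> m y \<ge> 0"
    and G_eq: "\<And>x y. x \<in> X \<Longrightarrow> y \<in> X \<Longrightarrow>
       G x y = m y + A x y - (\<Sum>z\<in>X. A x z * (a * v z / g * G z y))"
    and death: "\<And>y. y \<in> X \<Longrightarrow> (\<Sum>z\<in>X. a * v z / g * G z y) = 1"
    and kappa1: "(\<Sum>x\<in>X. a * v x / (1 + a * v x)) \<ge> 1"
begin

definition w :: "'a \<Rightarrow> 'a \<Rightarrow> real" where "w y z = a * v z / g * G z y"
text \<open>The factor that appears when \<open>G_eq\<close> is solved for its diagonal term, see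
  \<open>w_eq\<close>; \<open>g * k x\<close> is av/(1+av).\<close>

definition k :: "'a \<Rightarrow> real" where "k x = a * v x / (1 + a * v x) / g"
definition K :: real where "K = (\<Sum>x\<in>X. k x)"
text \<open>The depth truncated at order one, free of a. It dominates both
  \<open>g * k x / a\<close> and \<open>w y x / (10 * a)\<close>, so that near pairs can be measured
  by the single number \<open>S\<close>.\<close>

definition \<psi> :: "'a \<Rightarrow> real" where "\<psi> x = v x / (1 + v x)"
definition near :: "'a \<Rightarrow> 'a set" where "near x = {z\<in>X. z \<noteq> x \<and> \<bar>A x z\<bar> > b}"
definition S :: real where "S = (\<Sum>x\<in>X. \<Sum>z\<in>near x. \<psi> x * \<psi> z)"
text \<open>The term 2bK collects far pairs, once weighted by \<open>w\<close> and once in the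
  column of y. The term with \<open>a\<^sup>2\<close> comes from all near pairs, the last one from
  the near partners of y.\<close>

definition err :: "'a \<Rightarrow> real" where "err y = 2 * b * K + 10 * a\<^sup>2 * S + a * S / \<psi> y"

lemma av_pos: "x \<in> X \<Longrightarrow> a * v x > 0"
  using v_pos a1 by (intro mult_pos_pos) auto

lemma w_nonneg: "y \<in> X \<Longrightarrow> z \<in> X \<Longrightarrow> w y z \<ge> 0"
  using G_nonneg v_pos[of z] a1 g_pos by (auto simp: w_def)

lemma sum_w: "y \<in> X \<Longrightarrow> (\<Sum>z\<in>X. w y z) = 1"
  using death by (simp add: w_def)

lemma w_le_1: "y \<in> X \<Longrightarrow> z \<in> X \<Longrightarrow> w y z \<le> 1"
  using member_le_sum[of z X "w y"] w_nonneg sum_w fin by auto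

lemma k_pos: "x \<in> X \<Longrightarrow> k x > 0"
  using av_pos[of x] g_pos by (simp add: k_def)

lemma psi_pos: "x \<in> X \<Longrightarrow> \<psi> x > 0"
  using v_pos[of x] by (simp add: \<psi>_def)

lemma gK: "g * K = (\<Sum>x\<in>X. a * v x / (1 + a * v x))"
  using g_pos by (simp add: K_def k_def sum_distrib_left)

lemma gK_ge_1: "g * K \<ge> 1"
  using kappa1 by (simp add: gK)

lemma K_pos: "K > 0"
proof -
  have "0 < g * K" using gK_ge_1 by linarith
  then show ?thesis using g_pos by (simp add: zero_less_mult_iff)
qed

lemma gk_le: "x \<in> X \<Longrightarrow> g * k x \<le> a * \<psi> x"
proof -
  assume x: "x \<in> X"
  have "v x \<le> a * v x" using v_pos[OF x] a1 by simp
  then have "a * v x / (1 + a * v x) \<le> a * v x / (1 + v x)"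
    using v_pos[OF x] a1 av_pos[OF x] by (intro frac_le) auto
  then show ?thesis using g_pos by (simp add: k_def \<psi>_def)
qed

lemma near_subset: "near x \<subseteq> X" by (auto simp: near_def)

lemma near_sym: "x \<in> X \<Longrightarrow> z \<in> X \<Longrightarrow> z \<in> near x \<longleftrightarrow> x \<in> near z"
  by (auto simp: near_def A_sym)

lemma sum_near_psi_nonneg: "(\<Sum>z\<in>near x. \<psi> z) \<ge> 0"
  using psi_pos near_subset by (intro sum_nonneg) (auto intro: less_imp_le)

lemma S_nonneg: "S \<ge> 0"
  unfolding S_def using psi_pos near_subset
  by (intro sum_nonneg mult_nonneg_nonneg) (auto intro: less_imp_le)

lemma sum_near_psi_le: "y \<in> X \<Longrightarrow> (\<Sum>z\<in>near y. \<psi> z) \<le> S / \<psi> y"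
proof -
  assume y: "y \<in> X"
  have "(\<Sum>z\<in>near y. \<psi> y * \<psi> z) \<le> S"
    unfolding S_def using y fin psi_pos near_subset
    by (intro member_le_sum) (auto intro!: sum_nonneg mult_nonneg_nonneg intro: less_imp_le)
  then show ?thesis using psi_pos[OF y] by (simp add: field_simps sum_distrib_left)
qed

lemma G_eq': 
  assumes "x \<in> X" "y \<in> X"
  shows "(1 + a * v x) * G x y = m y + A x y - (\<Sum>z\<in>X - {x}. A x z * w y z)"
proof -
  have "(\<Sum>z\<in>X. A x z * w y z) = A x x * w y x + (\<Sum>z\<in>X - {x}. A x z * w y z)"
    using assms(1) fin by (simp add: sum.remove)
  moreover have "A x x * w y x = a * v x * G x y"
    using g_pos by (simp add: A_diag w_def)
  moreover have "G x y = m y + A x y - (\<Sum>z\<in>X. A x z * w y z)"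
    using G_eq[OF assms] by (simp add: w_def)
  ultimately show ?thesis by (simp add: distrib_right)
qed

lemma w_eq:
  assumes "x \<in> X" "y \<in> X"
  shows "w y x = k x * (m y + A x y - (\<Sum>z\<in>X - {x}. A x z * w y z))"
proof -
  have "1 + a * v x > 0" using av_pos[OF assms(1)] by simp
  then have "w y x = k x * ((1 + a * v x) * G x y)"
    by (simp add: w_def k_def)
  then show ?thesis unfolding G_eq'[OF assms] .
qed

text \<open>That \<open>w y\<close> has total mass 1 is the equation determining the mean
  \<open>m y\<close>.\<close>

lemma mK_eq:
  assumes "y \<in> X"
  shows "K * m y = 1 - (\<Sum>x\<in>X. k x * A x y) + (\<Sum>x\<in>X. \<Sum>z\<in>X - {x}. k x * A x z * w y z)"
proof -
  have "1 = (\<Sum>x\<in>X. k x * (m y + A x y - (\<Sum>z\<in>X - {x}. A x z * w y z)))"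
    using sum_w[OF assms] w_eq[OF _ assms] by simp
  also have "\<dots> = K * m y + (\<Sum>x\<in>X. k x * A x y) - (\<Sum>x\<in>X. \<Sum>z\<in>X - {x}. k x * A x z * w y z)"
    by (simp add: K_def algebra_simps sum.distrib sum_subtractf sum_distrib_left sum_distrib_right)
  finally show ?thesis by simp
qed

lemma abs_sum_A_w_le:
  assumes "y \<in> X" "Y \<subseteq> X"
  shows "\<bar>\<Sum>z\<in>Y. A x z * w y z\<bar> \<le> g"
proof -
  have "\<bar>\<Sum>z\<in>Y. A x z * w y z\<bar> \<le> (\<Sum>z\<in>Y. \<bar>A x z * w y z\<bar>)" by (rule sum_abs)
  also have "\<dots> \<le> (\<Sum>z\<in>Y. g * w y z)"
    using A_le w_nonneg[OF assms(1)] assms(2)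
    by (intro sum_mono) (simp add: abs_mult mult_right_mono subset_iff)
  also have "\<dots> \<le> (\<Sum>z\<in>X. g * w y z)"
    using w_nonneg[OF assms(1)] assms(2) fin g_pos by (intro sum_mono2) auto
  also have "\<dots> = g" using sum_w[OF assms(1)] by (simp flip: sum_distrib_left)
  finally show ?thesis .
qed

text \<open>An a priori bound from |A| \<le> g alone, with 1 absorbed into gK. It starts the chain
  of crude bounds on m, then G, then w, that later makes the near interactions small.\<close>

lemma m_le:
  assumes "y \<in> X"
  shows "m y \<le> 3 * g"
proof -
  have "- (\<Sum>x\<in>X. k x * A x y) \<le> (\<Sum>x\<in>X. k x * g)"
    unfolding sum_negf[symmetric]
  proof (rule sum_mono)
    fix x assume x: "x \<in> X"
    have "- A x y \<le> g" using A_le[of x y] by linarith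
    then have "k x * (- A x y) \<le> k x * g" using k_pos[OF x] by (intro mult_left_mono) auto
    then show "- (k x * A x y) \<le> k x * g" by simp
  qed
  moreover have "(\<Sum>x\<in>X. \<Sum>z\<in>X - {x}. k x * A x z * w y z) \<le> (\<Sum>x\<in>X. k x * g)"
  proof (rule sum_mono)
    fix x assume x: "x \<in> X"
    have "(\<Sum>z\<in>X - {x}. A x z * w y z) \<le> g"
      using abs_sum_A_w_le[OF assms, of "X - {x}" x] by auto
    then have "k x * (\<Sum>z\<in>X - {x}. A x z * w y z) \<le> k x * g"
      using k_pos[OF x] by (intro mult_left_mono) auto
    then show "(\<Sum>z\<in>X - {x}. k x * A x z * w y z) \<le> k x * g"
      by (simp add: sum_distrib_left mult.assoc)
  qed
  ultimately have "K * m y \<le> 1 + 2 * (K * g)"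
    unfolding mK_eq[OF assms] by (simp add: K_def sum_distrib_right)
  also have "\<dots> \<le> K * (3 * g)" using gK_ge_1 by (simp add: mult.commute)
  finally show ?thesis using K_pos by simp
qed

lemma G_le:
  assumes "x \<in> X" "y \<in> X"
  shows "G x y \<le> 5 * g"
proof -
  have "G x y = m y + A x y - (\<Sum>z\<in>X. A x z * w y z)"
    using G_eq[OF assms] by (simp add: w_def)
  moreover have "- (\<Sum>z\<in>X. A x z * w y z) \<le> g"
    using abs_sum_A_w_le[OF assms(2), of X x] by simp
  ultimately show ?thesis using m_le[OF assms(2)] A_le[of x y] by linarith
qed

text \<open>Shallow sites use G \<le> 5g and v \<le> 2\<psi>, deep ones the trivial w \<le> 1
  together with \<psi> \<ge> 1/2.\<close>

lemma w_le_psi: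
  assumes "z \<in> X" "y \<in> X"
  shows "w y z \<le> 10 * a * \<psi> z"
proof (cases "v z \<le> 1")
  case True
  have "w y z \<le> a * v z / g * (5 * g)"
    unfolding w_def using G_le[OF assms] v_pos[OF assms(1)] a1 g_pos
    by (intro mult_left_mono) auto
  also have "\<dots> = 5 * a * v z" using g_pos by simp
  also have "v z \<le> 2 * \<psi> z"
    using True v_pos[OF assms(1)] by (simp add: \<psi>_def field_simps)
  then have "5 * a * v z \<le> 5 * a * (2 * \<psi> z)" using a1 by (intro mult_left_mono) auto
  finally show ?thesis by simp
next
  case False
  have "1 / 2 \<le> \<psi> z" using False by (simp add: \<psi>_def field_simps)
  then have "10 * a * (1 / 2) \<le> 10 * a * \<psi> z" using a1 by (intro mult_left_mono) auto
  then show ?thesis using w_le_1[OF assms(2,1)] a1 by linarith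
qed

text \<open>Far sites contribute at most b because \<open>w y\<close> has mass 1; near sites cost
  the full g, but their mass is controlled by \<open>w_le_psi\<close>.\<close>

lemma abs_sum_interaction_le:
  assumes "y \<in> X" "x \<in> X"
  shows "\<bar>\<Sum>z\<in>X - {x}. A x z * w y z\<bar> \<le> b + g * (10 * a * (\<Sum>z\<in>near x. \<psi> z))"
proof -
  have "\<bar>\<Sum>z\<in>X - {x}. A x z * w y z\<bar> \<le> (\<Sum>z\<in>X - {x}. \<bar>A x z * w y z\<bar>)" by (rule sum_abs)
  also have "\<dots> \<le> (\<Sum>z\<in>X - {x}. b * w y z + (if z \<in> near x then g * w y z else 0))"
  proof (rule sum_mono)
    fix z assume z: "z \<in> X - {x}"
    then have w0: "w y z \<ge> 0" using w_nonneg assms by auto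
    show "\<bar>A x z * w y z\<bar> \<le> b * w y z + (if z \<in> near x then g * w y z else 0)"
    proof (cases "z \<in> near x")
      case True
      have "\<bar>A x z\<bar> * w y z \<le> g * w y z" using A_le w0 by (intro mult_right_mono) auto
      moreover have "0 \<le> b * w y z" using w0 b0 by simp
      ultimately show ?thesis using True w0 by (simp add: abs_mult)
    next
      case False
      then have "\<bar>A x z\<bar> \<le> b" using z by (auto simp: near_def)
      then have "\<bar>A x z\<bar> * w y z \<le> b * w y z" using w0 by (intro mult_right_mono) auto
      then show ?thesis using False w0 by (simp add: abs_mult)
    qed
  qed
  also have "\<dots> = b * (\<Sum>z\<in>X - {x}. w y z) + (\<Sum>z\<in>X - {x}. if z \<in> near x then g * w y z else 0)"
    by (simp add: sum.distrib sum_distrib_left)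
  also have "(\<Sum>z\<in>X - {x}. if z \<in> near x then g * w y z else 0) = (\<Sum>z\<in>near x. g * w y z)"
    using fin by (subst sum.inter_restrict[symmetric]) (auto simp: near_def intro!: sum.cong)
  also have "(\<Sum>z\<in>near x. g * w y z) \<le> (\<Sum>z\<in>near x. g * (10 * a * \<psi> z))"
    using w_le_psi[OF _ assms(1)] near_subset g_pos by (intro sum_mono mult_left_mono) auto
  also have "(\<Sum>z\<in>near x. g * (10 * a * \<psi> z)) = g * (10 * a * (\<Sum>z\<in>near x. \<psi> z))"
    by (simp add: sum_distrib_left)
  also have "b * (\<Sum>z\<in>X - {x}. w y z) \<le> b * 1"
  proof -
    have "(\<Sum>z\<in>X - {x}. w y z) \<le> (\<Sum>z\<in>X. w y z)"
      using w_nonneg assms fin by (intro sum_mono2) auto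
    then show ?thesis using sum_w[OF assms(1)] b0 by (intro mult_left_mono) auto
  qed
  finally show ?thesis by simp
qed

text \<open>The diagonal term x = y of the column sum in \<open>mK_eq\<close> turns 1 into 1 - g
  k(y) = 1/(1+av); every off-diagonal term is an error.\<close>

lemma mK_approx:
  assumes y: "y \<in> X"
  shows "\<bar>K * m y - 1 / (1 + a * v y)\<bar> \<le> err y"
proof -
  have I: "\<bar>\<Sum>x\<in>X. \<Sum>z\<in>X - {x}. k x * A x z * w y z\<bar> \<le> b * K + 10 * a\<^sup>2 * S"
  proof -
    have "\<bar>\<Sum>x\<in>X. \<Sum>z\<in>X - {x}. k x * A x z * w y z\<bar>
        \<le> (\<Sum>x\<in>X. \<bar>\<Sum>z\<in>X - {x}. k x * A x z * w y z\<bar>)" by (rule sum_abs)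
    also have "\<dots> \<le> (\<Sum>x\<in>X. k x * b + 10 * a\<^sup>2 * (\<Sum>z\<in>near x. \<psi> x * \<psi> z))"
    proof (rule sum_mono)
      fix x assume x: "x \<in> X"
      have "(\<Sum>z\<in>X - {x}. k x * A x z * w y z) = k x * (\<Sum>z\<in>X - {x}. A x z * w y z)"
        by (simp add: sum_distrib_left mult.assoc)
      then have "\<bar>\<Sum>z\<in>X - {x}. k x * A x z * w y z\<bar> = k x * \<bar>\<Sum>z\<in>X - {x}. A x z * w y z\<bar>"
        using k_pos[OF x] by (simp add: abs_mult)
      also have "\<dots> \<le> k x * (b + g * (10 * a * (\<Sum>z\<in>near x. \<psi> z)))"
        using k_pos[OF x] abs_sum_interaction_le[OF y x] by (intro mult_left_mono) auto
      also have "\<dots> = k x * b + (g * k x) * (10 * a * (\<Sum>z\<in>near x. \<psi> z))"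
        by (simp add: algebra_simps)
      also have "(g * k x) * (10 * a * (\<Sum>z\<in>near x. \<psi> z)) \<le> (a * \<psi> x) * (10 * a * (\<Sum>z\<in>near x. \<psi> z))"
        using gk_le[OF x] sum_near_psi_nonneg a1 by (intro mult_right_mono) auto
      also have "(a * \<psi> x) * (10 * a * (\<Sum>z\<in>near x. \<psi> z)) = 10 * a\<^sup>2 * (\<Sum>z\<in>near x. \<psi> x * \<psi> z)"
        by (simp add: power2_eq_square sum_distrib_left algebra_simps)
      finally show "\<bar>\<Sum>z\<in>X - {x}. k x * A x z * w y z\<bar> \<le> k x * b + 10 * a\<^sup>2 * (\<Sum>z\<in>near x. \<psi> x * \<psi> z)"
        by simp
    qed
    also have "\<dots> = b * K + 10 * a\<^sup>2 * S"
      by (simp add: sum.distrib K_def S_def sum_distrib_left sum_distrib_right mult.commute)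
    finally show ?thesis .
  qed
  have J: "\<bar>\<Sum>x\<in>X - {y}. k x * A x y\<bar> \<le> b * K + a * S / \<psi> y"
  proof -
    have "\<bar>\<Sum>x\<in>X - {y}. k x * A x y\<bar> \<le> (\<Sum>x\<in>X - {y}. \<bar>k x * A x y\<bar>)" by (rule sum_abs)
    also have "\<dots> \<le> (\<Sum>x\<in>X - {y}. k x * b + (if x \<in> near y then a * \<psi> x else 0))"
    proof (rule sum_mono)
      fix x assume x: "x \<in> X - {y}"
      then have k0: "k x > 0" using k_pos by auto
      show "\<bar>k x * A x y\<bar> \<le> k x * b + (if x \<in> near y then a * \<psi> x else 0)"
      proof (cases "x \<in> near y")
        case True
        have "k x * \<bar>A x y\<bar> \<le> k x * g" using A_le k0 by (intro mult_left_mono) auto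
        also have "\<dots> \<le> a * \<psi> x" using gk_le x by (simp add: mult.commute)
        finally show ?thesis using True k0 b0 by (simp add: abs_mult add_increasing)
      next
        case False
        then have "\<bar>A x y\<bar> \<le> b" using x y near_sym by (auto simp: near_def A_sym)
        then have "k x * \<bar>A x y\<bar> \<le> k x * b" using k0 by (intro mult_left_mono) auto
        then show ?thesis using False k0 by (simp add: abs_mult)
      qed
    qed
    also have "\<dots> = (\<Sum>x\<in>X - {y}. k x) * b + (\<Sum>x\<in>X - {y}. if x \<in> near y then a * \<psi> x else 0)"
      by (simp add: sum.distrib sum_distrib_right)
    also have "(\<Sum>x\<in>X - {y}. if x \<in> near y then a * \<psi> x else 0) = (\<Sum>x\<in>near y. a * \<psi> x)"
      using fin by (subst sum.inter_restrict[symmetric]) (auto simp: near_def intro!: sum.cong)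
    also have "(\<Sum>x\<in>near y. a * \<psi> x) \<le> a * (S / \<psi> y)"
      unfolding sum_distrib_left[symmetric] using sum_near_psi_le[OF y] a1 by (intro mult_left_mono) auto
    also have "(\<Sum>x\<in>X - {y}. k x) * b \<le> K * b"
      unfolding K_def using k_pos fin b0 by (intro mult_right_mono sum_mono2) (auto intro: less_imp_le)
    finally show ?thesis by (simp add: mult.commute)
  qed
  have "(\<Sum>x\<in>X. k x * A x y) = k y * g + (\<Sum>x\<in>X - {y}. k x * A x y)"
    using fin y by (simp add: sum.remove A_diag)
  moreover have "1 - k y * g = 1 / (1 + a * v y)"
  proof -
    have "k y * g = a * v y / (1 + a * v y)" using g_pos by (simp add: k_def)
    moreover have "1 - a * v y / (1 + a * v y) = 1 / (1 + a * v y)"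
      using av_pos[OF y] by (simp add: divide_simps)
    ultimately show ?thesis by simp
  qed
  ultimately have "K * m y - 1 / (1 + a * v y) =
      (\<Sum>x\<in>X. \<Sum>z\<in>X - {x}. k x * A x z * w y z) - (\<Sum>x\<in>X - {y}. k x * A x y)"
    using mK_eq[OF y] by linarith
  then show ?thesis using I J unfolding err_def by linarith
qed

text \<open>In \<open>G_eq'\<close> the entry A(y,y) = g dominates: the mean \<open>m y\<close> is
  of order 1/K, and 1/(gK) is small once many traps are relevant.\<close>

lemma G_diag_approx:
  assumes y: "y \<in> X"
  shows "\<bar>(1 + a * v y) * G y y / g - 1\<bar> \<le> (1 + err y) / (g * K) + b / g + 10 * a * (S / \<psi> y)"
proof -
  have "m y \<le> (1 + err y) / K"
  proof -
    have "1 / (1 + a * v y) \<le> 1" using av_pos[OF y] by simp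
    then have "K * m y \<le> 1 + err y" using mK_approx[OF y] by linarith
    then show ?thesis using K_pos by (simp add: field_simps)
  qed
  moreover have "\<bar>\<Sum>z\<in>X - {y}. A y z * w y z\<bar> \<le> b + g * (10 * a * (S / \<psi> y))"
  proof -
    have "g * (10 * a * (\<Sum>z\<in>near y. \<psi> z)) \<le> g * (10 * a * (S / \<psi> y))"
      using sum_near_psi_le[OF y] g_pos a1 by (intro mult_left_mono) auto
    then show ?thesis using abs_sum_interaction_le[OF y y] by linarith
  qed
  ultimately have "\<bar>(1 + a * v y) * G y y - g\<bar> \<le> (1 + err y) / K + (b + g * (10 * a * (S / \<psi> y)))"
    using G_eq'[OF y y] m_nonneg[OF y] by (simp add: A_diag)
  then have "\<bar>(1 + a * v y) * G y y - g\<bar> / g \<le> ((1 + err y) / K + (b + g * (10 * a * (S / \<psi> y)))) / g"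
    using g_pos by (intro divide_right_mono) auto
  moreover have "\<bar>(1 + a * v y) * G y y / g - 1\<bar> = \<bar>(1 + a * v y) * G y y - g\<bar> / g"
  proof -
    have "(1 + a * v y) * G y y / g - 1 = ((1 + a * v y) * G y y - g) / g"
      using g_pos by (simp add: diff_divide_distrib)
    then show ?thesis using g_pos by simp
  qed
  moreover have "((1 + err y) / K + (b + g * (10 * a * (S / \<psi> y)))) / g
      = (1 + err y) / (g * K) + b / g + 10 * a * (S / \<psi> y)"
    using g_pos by (simp add: add_divide_distrib mult.commute)
  ultimately show ?thesis by simp
qed

text \<open>For a far pair only the mean \<open>m y\<close> survives in \<open>G_eq'\<close>. The
  near sites of x stay an explicit sum, because x will be the starting point, whose \<psi> tends to
  0, so that a bound by S/\<psi>(x) would be too weak.\<close>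

lemma G_offdiag_approx:
  assumes x: "x \<in> X" and y: "y \<in> X" and far: "\<bar>A x y\<bar> \<le> b"
  shows "\<bar>K * ((1 + a * v x) * G x y) - 1 / (1 + a * v y)\<bar>
    \<le> err y + 2 * b * K + 10 * a * (g * K * (\<Sum>z\<in>near x. \<psi> z))"
proof -
  define R where "R = A x y - (\<Sum>z\<in>X - {x}. A x z * w y z)"
  have "\<bar>R\<bar> \<le> 2 * b + g * (10 * a * (\<Sum>z\<in>near x. \<psi> z))"
    unfolding R_def using far abs_sum_interaction_le[OF y x] by linarith
  then have "K * \<bar>R\<bar> \<le> K * (2 * b + g * (10 * a * (\<Sum>z\<in>near x. \<psi> z)))"
    using K_pos by (intro mult_left_mono) auto
  moreover have "K * ((1 + a * v x) * G x y) = K * m y + K * R"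
    unfolding G_eq'[OF x y] R_def by (simp add: algebra_simps)
  moreover have "\<bar>K * R\<bar> = K * \<bar>R\<bar>" using K_pos by (simp add: abs_mult)
  ultimately have "\<bar>K * ((1 + a * v x) * G x y) - 1 / (1 + a * v y)\<bar>
     \<le> err y + K * (2 * b + g * (10 * a * (\<Sum>z\<in>near x. \<psi> z)))"
    using mK_approx[OF y] by linarith
  then show ?thesis by (simp add: algebra_simps)
qed

end

subsection \<open>A quantitative Tauberian lemma\<close>

lemma set_integrable_mult_bounded:
  fixes f r :: "real \<Rightarrow> real"
  assumes f: "set_integrable lborel A f" and r: "r \<in> borel_measurable borel"
    and A: "A \<in> sets borel" and bd: "\<And>s. s \<in> A \<Longrightarrow> \<bar>r s\<bar> \<le> C"
  shows "set_integrable lborel A (\<lambda>s. f s * r s)"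
proof -
  have "integrable lborel (\<lambda>s. C * (indicator A s *\<^sub>R f s))"
    using f by (simp add: set_integrable_def)
  then show ?thesis
    unfolding set_integrable_def
  proof (rule Bochner_Integration.integrable_bound)
    have "(\<lambda>s. indicator A s *\<^sub>R f s) \<in> borel_measurable lborel"
      using f by (auto simp: set_integrable_def dest: borel_measurable_integrable)
    then have "(\<lambda>s. (indicator A s *\<^sub>R f s) * r s) \<in> borel_measurable lborel"
      using r by measurable
    then show "(\<lambda>s. indicator A s *\<^sub>R (f s * r s)) \<in> borel_measurable lborel"
      by (simp add: mult.assoc)
    show "AE s in lborel. norm (indicator A s *\<^sub>R (f s * r s)) \<le> norm (C * (indicator A s *\<^sub>R f s))"
    proof (intro AE_I2)
      fix s
      show "norm (indicator A s *\<^sub>R (f s * r s)) \<le> norm (C * (indicator A s *\<^sub>R f s))"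
      proof (cases "s \<in> A")
        case True
        have "\<bar>r s\<bar> \<le> \<bar>C\<bar>" using bd[OF True] by linarith
        then have "\<bar>f s\<bar> * \<bar>r s\<bar> \<le> \<bar>f s\<bar> * \<bar>C\<bar>" by (intro mult_left_mono) auto
        then show ?thesis using True by (simp add: abs_mult mult.commute)
      qed simp
    qed
  qed
qed

text \<open>Replace \<open>q\<close> by a polynomial p (Weierstrass): the integral of d exp(-s)
  p(exp(-s)) is a combination of the transforms at 1, ..., n + 1. The constants \<open>K\<close> and
  \<open>\<eta>\<close> depend on \<open>q\<close>, \<open>\<epsilon>\<close> and \<open>B\<close>,
  but not on \<open>d\<close>.\<close>

lemma laplace_determines_kernel:
  fixes q :: "real \<Rightarrow> real"
  assumes q: "continuous_on {0..1} q" and e: "\<epsilon> > 0" and B: "B \<ge> 0"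
  obtains K :: nat and \<eta> :: real where "\<eta> > 0"
    "\<And>d. set_integrable lborel {0..} (\<lambda>s. d s * exp (- s)) \<Longrightarrow>
       (LBINT s:{0..}. \<bar>d s\<bar> * exp (- s)) \<le> B \<Longrightarrow>
       (\<lambda>s. d s * exp (- s) * q (exp (- s))) \<in> borel_measurable borel \<Longrightarrow>
       (\<And>a::nat. 1 \<le> a \<Longrightarrow> a \<le> K \<Longrightarrow> \<bar>LBINT s:{0..}. d s * exp (- (a * s))\<bar> \<le> \<eta>) \<Longrightarrow>
       \<bar>LBINT s:{0..}. d s * exp (- s) * q (exp (- s))\<bar> \<le> \<epsilon>"
proof -
  \<comment> \<open>One half of \<open>\<epsilon>\<close> pays for replacing \<open>q\<close> by
    \<open>p\<close>, the other half, through \<open>\<eta>\<close>, for the transforms.\<close>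
  define e1 where "e1 = \<epsilon> / (2 * (B + 1))"
  have e1: "e1 > 0" using e B by (simp add: e1_def)
  obtain p where p: "real_polynomial_function p" "\<And>x. x \<in> {0..1} \<Longrightarrow> \<bar>q x - p x\<bar> < e1"
    using Stone_Weierstrass_real_polynomial_function[OF _ q e1] by blast
  then obtain c n where pc: "p = (\<lambda>x. \<Sum>i\<le>n. c i * x ^ i)"
    unfolding real_polynomial_function_iff_sum by blast
  define c1 where "c1 = (\<Sum>i\<le>n. \<bar>c i\<bar>)"
  define \<eta> where "\<eta> = \<epsilon> / (2 * (c1 + 1))"
  have c0: "c1 \<ge> 0" unfolding c1_def by (rule sum_nonneg) simp
  have eta: "\<eta> > 0" using e c0 by (simp add: \<eta>_def)
  show ?thesis
  proof (rule that[of \<eta> "n + 1", OF eta])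
    fix d :: "real \<Rightarrow> real"
    assume int: "set_integrable lborel {0..} (\<lambda>s. d s * exp (- s))"
      and bd: "(LBINT s:{0..}. \<bar>d s\<bar> * exp (- s)) \<le> B"
      and meas: "(\<lambda>s. d s * exp (- s) * q (exp (- s))) \<in> borel_measurable borel"
      and lap: "\<And>a::nat. 1 \<le> a \<Longrightarrow> a \<le> n + 1 \<Longrightarrow> \<bar>LBINT s:{0..}. d s * exp (- (a * s))\<bar> \<le> \<eta>"
    have ei: "set_integrable lborel {0..} (\<lambda>s. d s * exp (- s) * exp (- s) ^ i)" for i
    proof (rule set_integrable_mult_bounded[OF int, where C = 1])
      fix s :: real assume "s \<in> {0..}"
      then show "\<bar>exp (- s) ^ i\<bar> \<le> 1" by (simp add: power_le_one)
    qed auto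
    have ii: "set_integrable lborel {0..} (\<lambda>s. c i * (d s * exp (- s) * exp (- s) ^ i))" for i
      using ei by simp
    have pint: "set_integrable lborel {0..} (\<lambda>s. d s * exp (- s) * p (exp (- s)))"
      and peq: "(LBINT s:{0..}. d s * exp (- s) * p (exp (- s)))
          = (\<Sum>i\<le>n. c i * (LBINT s:{0..}. d s * exp (- (real (i + 1) * s))))"
    proof -
      have eq: "d s * exp (- s) * p (exp (- s)) = (\<Sum>i\<le>n. c i * (d s * exp (- s) * exp (- s) ^ i))" for s
        by (simp add: pc sum_distrib_left mult_ac)
      show "set_integrable lborel {0..} (\<lambda>s. d s * exp (- s) * p (exp (- s)))"
        unfolding eq set_integrable_def scaleR_sum_right
        using ii[unfolded set_integrable_def] by (intro Bochner_Integration.integrable_sum) auto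
      have ex: "exp (- s) * exp (- s) ^ i = exp (- (real (i + 1) * s))" for i s
        by (simp add: exp_of_nat_mult[symmetric] exp_add[symmetric] algebra_simps)
      have "(LBINT s:{0..}. d s * exp (- s) * p (exp (- s)))
          = (\<Sum>i\<le>n. LBINT s:{0..}. c i * (d s * exp (- s) * exp (- s) ^ i))"
        unfolding eq set_lebesgue_integral_def scaleR_sum_right
        using ii[unfolded set_integrable_def] by (intro Bochner_Integration.integral_sum) auto
      then show "(LBINT s:{0..}. d s * exp (- s) * p (exp (- s)))
          = (\<Sum>i\<le>n. c i * (LBINT s:{0..}. d s * exp (- (real (i + 1) * s))))"
        by (simp only: set_integral_mult_right mult.assoc ex)
    qed
    have "\<bar>LBINT s:{0..}. d s * exp (- s) * p (exp (- s))\<bar> \<le> (\<Sum>i\<le>n. \<bar>c i * (LBINT s:{0..}. d s * exp (- (real (i + 1) * s)))\<bar>)"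
      unfolding peq by (rule sum_abs)
    also have "\<dots> \<le> (\<Sum>i\<le>n. \<bar>c i\<bar> * \<eta>)"
    proof (rule sum_mono)
      fix i assume "i \<in> {..n}"
      then have "\<bar>LBINT s:{0..}. d s * exp (- (real (i + 1) * s))\<bar> \<le> \<eta>" by (intro lap) auto
      then show "\<bar>c i * (LBINT s:{0..}. d s * exp (- (real (i + 1) * s)))\<bar> \<le> \<bar>c i\<bar> * \<eta>"
        unfolding abs_mult by (intro mult_left_mono) auto
    qed
    also have "\<dots> = c1 * \<eta>" by (simp add: c1_def sum_distrib_right)
    also have "\<dots> \<le> \<epsilon> / 2"
      using c0 e by (simp add: \<eta>_def field_simps)
    finally have P: "\<bar>LBINT s:{0..}. d s * exp (- s) * p (exp (- s))\<bar> \<le> \<epsilon> / 2" .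
    have abs_int: "set_integrable lborel {0..} (\<lambda>s. \<bar>d s\<bar> * exp (- s))"
      using set_integrable_abs[OF int] by (simp add: abs_mult)
    have qint: "set_integrable lborel {0..} (\<lambda>s. d s * exp (- s) * q (exp (- s)))"
    proof -
      obtain C where C: "\<And>x. x \<in> {0..1} \<Longrightarrow> \<bar>q x\<bar> \<le> C"
        using compact_imp_bounded[OF compact_continuous_image[OF q]] unfolding bounded_iff
        by (metis compact_Icc imageI real_norm_def)
      have "integrable lborel (\<lambda>s. C * (indicator {0..} s *\<^sub>R (\<bar>d s\<bar> * exp (- s))))"
        using abs_int by (simp add: set_integrable_def)
      then show ?thesis
        unfolding set_integrable_def
      proof (rule Bochner_Integration.integrable_bound)
        show "(\<lambda>s. indicator {0..} s *\<^sub>R (d s * exp (- s) * q (exp (- s)))) \<in> borel_measurable lborel"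
          using meas by measurable
        show "AE s in lborel. norm (indicator {0..} s *\<^sub>R (d s * exp (- s) * q (exp (- s))))
            \<le> norm (C * (indicator {0..} s *\<^sub>R (\<bar>d s\<bar> * exp (- s))))"
        proof (intro AE_I2)
          fix s :: real
          show "norm (indicator {0..} s *\<^sub>R (d s * exp (- s) * q (exp (- s))))
            \<le> norm (C * (indicator {0..} s *\<^sub>R (\<bar>d s\<bar> * exp (- s))))"
          proof (cases "s \<ge> 0")
            case True
            have "\<bar>q (exp (- s))\<bar> \<le> \<bar>C\<bar>" using C[of "exp (- s)"] True by auto
            then have "(\<bar>d s\<bar> * exp (- s)) * \<bar>q (exp (- s))\<bar> \<le> (\<bar>d s\<bar> * exp (- s)) * \<bar>C\<bar>"
              by (intro mult_left_mono) auto
            then show ?thesis using True by (simp add: abs_mult mult_ac)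
          qed simp
        qed
      qed
    qed
    have "\<bar>(LBINT s:{0..}. d s * exp (- s) * q (exp (- s))) - (LBINT s:{0..}. d s * exp (- s) * p (exp (- s)))\<bar>
       = \<bar>LBINT s:{0..}. d s * exp (- s) * q (exp (- s)) - d s * exp (- s) * p (exp (- s))\<bar>"
      using qint pint by (simp add: set_integral_diff)
    also have "\<dots> \<le> (LBINT s:{0..}. \<bar>d s * exp (- s) * q (exp (- s)) - d s * exp (- s) * p (exp (- s))\<bar>)"
      using set_integral_norm_bound[OF set_integral_diff(1)[OF qint pint]] by simp
    also have "\<dots> \<le> (LBINT s:{0..}. e1 * (\<bar>d s\<bar> * exp (- s)))"
    proof (rule set_integral_mono)
      show "set_integrable lborel {0..} (\<lambda>s. \<bar>d s * exp (- s) * q (exp (- s)) - d s * exp (- s) * p (exp (- s))\<bar>)"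
        by (intro set_integrable_abs set_integral_diff qint pint)
      show "set_integrable lborel {0..} (\<lambda>s. e1 * (\<bar>d s\<bar> * exp (- s)))" using abs_int by simp
      fix s :: real assume "s \<in> {0..}"
      then have "\<bar>q (exp (- s)) - p (exp (- s))\<bar> \<le> e1" using p(2)[of "exp (- s)"] by auto
      then have "(\<bar>d s\<bar> * exp (- s)) * \<bar>q (exp (- s)) - p (exp (- s))\<bar> \<le> (\<bar>d s\<bar> * exp (- s)) * e1"
        by (intro mult_left_mono) auto
      then show "\<bar>d s * exp (- s) * q (exp (- s)) - d s * exp (- s) * p (exp (- s))\<bar> \<le> e1 * (\<bar>d s\<bar> * exp (- s))"
        by (simp add: abs_mult mult_ac flip: right_diff_distrib)
    qed
    also have "\<dots> = e1 * (LBINT s:{0..}. \<bar>d s\<bar> * exp (- s))" by simp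
    also have "\<dots> \<le> e1 * B" using bd e1 by (intro mult_left_mono) auto
    also have "\<dots> \<le> \<epsilon> / 2" using e B by (simp add: e1_def field_simps)
    finally show "\<bar>LBINT s:{0..}. d s * exp (- s) * q (exp (- s))\<bar> \<le> \<epsilon>" using P by linarith
  qed
qed

text \<open>Averages of \<open>f\<close> over \<open>{t..t+\<rho>}\<close> and \<open>{t-\<rho>..t}\<close> against a bump that is a function of
  \<open>exp (-s)\<close> are determined by the Laplace transform at integer points (Weierstrass); the
  one-sided regularity of \<open>f\<close> turns them into bounds at \<open>t\<close>.\<close>

lemma laplace_tauberian:
  fixes t \<rho> \<epsilon> B :: real
  assumes \<rho>: "0 < \<rho>" "\<rho> < t" and e: "\<epsilon> > 0" and B: "B \<ge> 0"
  obtains K :: nat and \<eta> :: real where "\<eta> > 0"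
    "\<And>f h. f \<in> borel_measurable borel \<Longrightarrow> h \<in> borel_measurable borel \<Longrightarrow>
       (\<And>s. s \<ge> 0 \<Longrightarrow> f s \<ge> 0) \<Longrightarrow> (\<And>s. s \<ge> 0 \<Longrightarrow> h s \<ge> 0) \<Longrightarrow>
       set_integrable lborel {0..} (\<lambda>s. f s * exp (- s)) \<Longrightarrow>
       set_integrable lborel {0..} (\<lambda>s. h s * exp (- s)) \<Longrightarrow>
       (LBINT s:{0..}. f s * exp (- s)) \<le> B \<Longrightarrow> (LBINT s:{0..}. h s * exp (- s)) \<le> B \<Longrightarrow>
       (\<And>s. t - \<rho> \<le> s \<Longrightarrow> s \<le> t \<Longrightarrow> f s - \<epsilon> \<le> f t) \<Longrightarrow>
       (\<And>s. t \<le> s \<Longrightarrow> s \<le> t + \<rho> \<Longrightarrow> f t - \<epsilon> \<le> f s) \<Longrightarrow>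
       (\<And>s. t - \<rho> \<le> s \<Longrightarrow> s \<le> t + \<rho> \<Longrightarrow> \<bar>h s - h t\<bar> \<le> \<epsilon>) \<Longrightarrow>
       (\<And>a::nat. 1 \<le> a \<Longrightarrow> a \<le> K \<Longrightarrow>
          \<bar>(LBINT s:{0..}. f s * exp (- (a * s))) - (LBINT s:{0..}. h s * exp (- (a * s)))\<bar> \<le> \<eta>) \<Longrightarrow>
       \<bar>f t - h t\<bar> \<le> 3 * \<epsilon>"
proof -
  \<comment> \<open>As a function of x = exp(-s) this is continuous and positive exactly for c < s <
    d, so \<open>ker\<close> is a bump supported in \<open>{c..d}\<close>.\<close>
  define q where "q = (\<lambda>c d x::real. max 0 ((x - exp (- d)) * (exp (- c) - x)))"
  define ker where "ker = (\<lambda>c d s::real. exp (- s) * q c d (exp (- s)))"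
  have q_cont: "continuous_on A (q c d)" for c d A
    unfolding q_def by (intro continuous_intros)
  have ker_meas [measurable]: "ker c d \<in> borel_measurable borel" for c d
    unfolding ker_def q_def by measurable
  have ker_nonneg: "ker c d s \<ge> 0" for c d s by (simp add: ker_def q_def)
  have ker_supp: "ker c d s = 0" if "s \<notin> {c..d}" "c < d" for c d s
  proof -
    from that(1) consider "s < c" | "s > d" by force
    then have "(exp (- s) - exp (- d)) * (exp (- c) - exp (- s)) \<le> 0"
      by cases (use that(2) in \<open>auto simp: mult_le_0_iff\<close>)
    then show ?thesis by (simp add: ker_def q_def)
  qed
  have ker_pos: "ker c d s > 0" if "c < s" "s < d" for c d s
    using that by (auto simp: ker_def q_def less_max_iff_disj)
  have ker_le: "ker c d s \<le> 1" if "0 \<le> c" "c < d" for c d s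
  proof (cases "s \<in> {c..d}")
    case True
    have "(exp (- s) - exp (- d)) * (exp (- c) - exp (- s)) \<le> 1 * 1"
      using True that by (intro mult_mono) (auto intro: order_trans[of _ "exp (- s)"] order_trans[of _ "exp (- c)"])
    then have "q c d (exp (- s)) \<le> 1" by (simp add: q_def)
    moreover have "q c d (exp (- s)) \<ge> 0" by (simp add: q_def)
    ultimately have "exp (- s) * q c d (exp (- s)) \<le> 1 * 1"
      using True that by (intro mult_mono) auto
    then show ?thesis by (simp add: ker_def)
  qed (use ker_supp that in auto)
  define mass where "mass = (\<lambda>c d. LBINT s:{0..}. ker c d s)"
  have ker_int: "set_integrable lborel {0..} (ker c d)" if "0 \<le> c" "c < d" for c d
  proof -
    have "integrable lborel (indicat_real {c..d})"
      by (rule integrable_real_indicator) (auto simp: emeasure_lborel_Icc_eq)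
    then have "integrable lborel (\<lambda>s. indicator {c..d} s *\<^sub>R (1::real))"
      by simp
    then show ?thesis unfolding set_integrable_def
    proof (rule Bochner_Integration.integrable_bound)
      show "AE s in lborel. norm (indicator {0..} s *\<^sub>R ker c d s) \<le> norm (indicator {c..d} s *\<^sub>R (1::real))"
        using ker_supp[OF _ that(2)] ker_le[OF that] ker_nonneg
        by (intro AE_I2) (auto simp: indicator_def)
    qed measurable
  qed
  have mass_pos: "mass c d > 0" if "0 \<le> c" "c < d" for c d
  proof -
    have "mass c d \<ge> 0" unfolding mass_def set_lebesgue_integral_def
      using ker_nonneg by (intro Bochner_Integration.integral_nonneg) auto
    moreover have "mass c d \<noteq> 0"
    proof
      assume "mass c d = 0"
      then have "AE s in lborel. indicator {0..} s *\<^sub>R ker c d s = 0"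
        unfolding mass_def set_lebesgue_integral_def
        using integral_nonneg_eq_0_iff_AE[OF ker_int[OF that, unfolded set_integrable_def]] ker_nonneg by simp
      then have "AE s in lborel. s \<notin> {c<..<d}"
        by eventually_elim (use ker_pos[of c _ d] that in \<open>force simp: indicator_def\<close>)
      then have "emeasure lborel {c<..<d} = 0"
        by (subst (asm) AE_iff_measurable[where N = "{c<..<d}"]) auto
      then show False using that by simp
    qed
    ultimately show ?thesis by linarith
  qed
  \<comment> \<open>The number B bounds f and h separately, hence 2B bounds the integral of |f - h|
    exp(-s).\<close>
  have B2: "2 * B \<ge> 0" using B by simp
  have p1: "0 < \<epsilon> * mass t (t + \<rho>)" and p2: "0 < \<epsilon> * mass (t - \<rho>) t"
    using mass_pos[of t "t + \<rho>"] mass_pos[of "t - \<rho>" t] \<rho> e by auto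
  obtain K1 :: nat and \<eta>1 :: real where eta1: "\<eta>1 > 0"
    and k1: "\<And>d. set_integrable lborel {0..} (\<lambda>s. d s * exp (- s)) \<Longrightarrow>
       (LBINT s:{0..}. \<bar>d s\<bar> * exp (- s)) \<le> 2 * B \<Longrightarrow>
       (\<lambda>s. d s * exp (- s) * q t (t + \<rho>) (exp (- s))) \<in> borel_measurable borel \<Longrightarrow>
       (\<And>a::nat. 1 \<le> a \<Longrightarrow> a \<le> K1 \<Longrightarrow> \<bar>LBINT s:{0..}. d s * exp (- (a * s))\<bar> \<le> \<eta>1) \<Longrightarrow>
       \<bar>LBINT s:{0..}. d s * exp (- s) * q t (t + \<rho>) (exp (- s))\<bar> \<le> \<epsilon> * mass t (t + \<rho>)"
  proof (rule laplace_determines_kernel[OF q_cont[of _ t "t + \<rho>"] p1 B2], goal_cases)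
    case (1 K \<eta>)
    show ?case by (rule 1(1)[OF 1(2)]) (rule 1(3))
  qed
  obtain K2 :: nat and \<eta>2 :: real where eta2: "\<eta>2 > 0"
    and k2: "\<And>d. set_integrable lborel {0..} (\<lambda>s. d s * exp (- s)) \<Longrightarrow>
       (LBINT s:{0..}. \<bar>d s\<bar> * exp (- s)) \<le> 2 * B \<Longrightarrow>
       (\<lambda>s. d s * exp (- s) * q (t - \<rho>) t (exp (- s))) \<in> borel_measurable borel \<Longrightarrow>
       (\<And>a::nat. 1 \<le> a \<Longrightarrow> a \<le> K2 \<Longrightarrow> \<bar>LBINT s:{0..}. d s * exp (- (a * s))\<bar> \<le> \<eta>2) \<Longrightarrow>
       \<bar>LBINT s:{0..}. d s * exp (- s) * q (t - \<rho>) t (exp (- s))\<bar> \<le> \<epsilon> * mass (t - \<rho>) t"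
  proof (rule laplace_determines_kernel[OF q_cont[of _ "t - \<rho>" t] p2 B2], goal_cases)
    case (1 K \<eta>)
    show ?case by (rule 1(1)[OF 1(2)]) (rule 1(3))
  qed
  show ?thesis
  proof (rule that[of "min \<eta>1 \<eta>2" "max K1 K2"])
    show "min \<eta>1 \<eta>2 > 0" using eta1 eta2 by simp
    fix f h :: "real \<Rightarrow> real"
    assume m [measurable]: "f \<in> borel_measurable borel" "h \<in> borel_measurable borel"
      and f0: "\<And>s. s \<ge> 0 \<Longrightarrow> f s \<ge> 0" and h0: "\<And>s. s \<ge> 0 \<Longrightarrow> h s \<ge> 0"
      and fi: "set_integrable lborel {0..} (\<lambda>s. f s * exp (- s))"
      and hi: "set_integrable lborel {0..} (\<lambda>s. h s * exp (- s))"
      and fB: "(LBINT s:{0..}. f s * exp (- s)) \<le> B" and hB: "(LBINT s:{0..}. h s * exp (- s)) \<le> B"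
      and f1: "\<And>s. t - \<rho> \<le> s \<Longrightarrow> s \<le> t \<Longrightarrow> f s - \<epsilon> \<le> f t"
      and f2: "\<And>s. t \<le> s \<Longrightarrow> s \<le> t + \<rho> \<Longrightarrow> f t - \<epsilon> \<le> f s"
      and hc: "\<And>s. t - \<rho> \<le> s \<Longrightarrow> s \<le> t + \<rho> \<Longrightarrow> \<bar>h s - h t\<bar> \<le> \<epsilon>"
      and lap: "\<And>a::nat. 1 \<le> a \<Longrightarrow> a \<le> max K1 K2 \<Longrightarrow>
          \<bar>(LBINT s:{0..}. f s * exp (- (a * s))) - (LBINT s:{0..}. h s * exp (- (a * s)))\<bar> \<le> min \<eta>1 \<eta>2"
    define d where "d = (\<lambda>s. f s - h s)"
    have di: "set_integrable lborel {0..} (\<lambda>s. d s * exp (- s))"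
      unfolding d_def left_diff_distrib by (intro set_integral_diff fi hi)
    have dB: "(LBINT s:{0..}. \<bar>d s\<bar> * exp (- s)) \<le> 2 * B"
    proof -
      have "(LBINT s:{0..}. \<bar>d s\<bar> * exp (- s)) \<le> (LBINT s:{0..}. f s * exp (- s) + h s * exp (- s))"
      proof (rule set_integral_mono)
        show "set_integrable lborel {0..} (\<lambda>s. \<bar>d s\<bar> * exp (- s))"
          using set_integrable_abs[OF di] by (simp add: abs_mult)
        show "set_integrable lborel {0..} (\<lambda>s. f s * exp (- s) + h s * exp (- s))"
          by (intro set_integral_add fi hi)
        fix s :: real assume "s \<in> {0..}"
        then have "\<bar>d s\<bar> \<le> f s + h s" using f0[of s] h0[of s] by (auto simp: d_def)
        then have "\<bar>d s\<bar> * exp (- s) \<le> (f s + h s) * exp (- s)" by (intro mult_right_mono) auto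
        then show "\<bar>d s\<bar> * exp (- s) \<le> f s * exp (- s) + h s * exp (- s)" by (simp add: distrib_right)
      qed
      also have "\<dots> = (LBINT s:{0..}. f s * exp (- s)) + (LBINT s:{0..}. h s * exp (- s))"
        by (intro set_integral_add fi hi)
      finally show ?thesis using fB hB by simp
    qed
    have exi: "set_integrable lborel {0..} (\<lambda>s. u s * exp (- (real a * s)))"
      if "set_integrable lborel {0..} (\<lambda>s. u s * exp (- s))" "1 \<le> a" for u :: "real \<Rightarrow> real" and a :: nat
    proof -
      have "set_integrable lborel {0..} (\<lambda>s. (u s * exp (- s)) * exp (- (real (a - 1) * s)))"
        by (rule set_integrable_mult_bounded[OF that(1), where C = 1]) auto
      moreover have "(u s * exp (- s)) * exp (- (real (a - 1) * s)) = u s * exp (- (real a * s))" for s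
        using that(2) by (simp add: of_nat_diff mult.assoc algebra_simps flip: exp_add)
      ultimately show ?thesis by (simp only:)
    qed
    have dlap: "\<bar>LBINT s:{0..}. d s * exp (- (a * s))\<bar> \<le> min \<eta>1 \<eta>2" if "1 \<le> a" "a \<le> max K1 K2" for a :: nat
      using lap[OF that] exi[OF fi that(1)] exi[OF hi that(1)]
      by (simp add: d_def left_diff_distrib set_integral_diff)
    have kint: "set_integrable lborel {0..} (\<lambda>s. u s * ker c d s)"
      if "set_integrable lborel {0..} (\<lambda>s. u s * exp (- s))" "0 \<le> c" "c < d" for u :: "real \<Rightarrow> real" and c d
    proof -
      have "set_integrable lborel {0..} (\<lambda>s. (u s * exp (- s)) * q c d (exp (- s)))"
      proof (rule set_integrable_mult_bounded[OF that(1), where C = 1])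
        show "(\<lambda>s. q c d (exp (- s))) \<in> borel_measurable borel" unfolding q_def by measurable
        fix s :: real assume s: "s \<in> {0..}"
        have "(exp (- s) - exp (- d)) * (exp (- c) - exp (- s)) \<le> 1"
        proof (cases "s \<in> {c..d}")
          case True
          have "(exp (- s) - exp (- d)) * (exp (- c) - exp (- s)) \<le> 1 * 1"
            using True that by (intro mult_mono) (auto intro: order_trans[of _ "exp (- s)"] order_trans[of _ "exp (- c)"])
          then show ?thesis by simp
        next
          case False
          then have "(exp (- s) - exp (- d)) * (exp (- c) - exp (- s)) \<le> 0"
            using that(3) by (auto simp: mult_le_0_iff not_le)
          then show ?thesis by simp
        qed
        then show "\<bar>q c d (exp (- s))\<bar> \<le> 1" by (simp add: q_def)
      qed auto
      then show ?thesis by (simp add: ker_def mult.assoc)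
    qed
    have main: "\<bar>(LBINT s:{0..}. f s * ker c e s) - (LBINT s:{0..}. h s * ker c e s)\<bar> \<le> \<epsilon> * mass c e"
      if ce: "(c, e) = (t, t + \<rho>) \<or> (c, e) = (t - \<rho>, t)" for c e
    proof -
      have ce': "0 \<le> c" "c < e" using ce \<rho> by auto
      have qm [measurable]: "q c e \<in> borel_measurable borel" unfolding q_def by measurable
      have "\<bar>LBINT s:{0..}. d s * exp (- s) * q c e (exp (- s))\<bar> \<le> \<epsilon> * mass c e"
        using ce
      proof
        assume "(c, e) = (t, t + \<rho>)"
        then have ceq: "c = t" "e = t + \<rho>" by auto
        show ?thesis unfolding ceq
          by (rule k1[OF di dB]) (use dlap qm[unfolded ceq] in \<open>auto simp: d_def intro: order_trans\<close>)
      next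
        assume "(c, e) = (t - \<rho>, t)"
        then have ceq: "c = t - \<rho>" "e = t" by auto
        show ?thesis unfolding ceq
          by (rule k2[OF di dB]) (use dlap qm[unfolded ceq] in \<open>auto simp: d_def intro: order_trans\<close>)
      qed
      moreover have "(LBINT s:{0..}. d s * exp (- s) * q c e (exp (- s)))
          = (LBINT s:{0..}. f s * ker c e s) - (LBINT s:{0..}. h s * ker c e s)"
      proof -
        have "d s * exp (- s) * q c e (exp (- s)) = f s * ker c e s - h s * ker c e s" for s
          by (simp add: d_def ker_def algebra_simps)
        then show ?thesis using kint[OF fi ce'] kint[OF hi ce'] by (simp add: set_integral_diff)
      qed
      ultimately show ?thesis by simp
    qed
    have lower: "r * mass c e \<le> (LBINT s:{0..}. u s * ker c e s)"
      if "set_integrable lborel {0..} (\<lambda>s. u s * exp (- s))" "0 \<le> c" "c < e" "\<And>s. c \<le> s \<Longrightarrow> s \<le> e \<Longrightarrow> r \<le> u s"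
      for u :: "real \<Rightarrow> real" and r c e
    proof -
      have "r * mass c e = (LBINT s:{0..}. r * ker c e s)" by (simp add: mass_def)
      also have "\<dots> \<le> (LBINT s:{0..}. u s * ker c e s)"
      proof (rule set_integral_mono)
        fix s :: real
        show "r * ker c e s \<le> u s * ker c e s"
          using that(4)[of s] ker_nonneg[of c e s] ker_supp[OF _ that(3), of s]
          by (cases "s \<in> {c..e}") (auto intro: mult_right_mono)
      qed (use kint[OF that(1-3)] ker_int[OF that(2,3)] in auto)
      finally show ?thesis .
    qed
    have upper: "(LBINT s:{0..}. u s * ker c e s) \<le> r * mass c e"
      if "set_integrable lborel {0..} (\<lambda>s. u s * exp (- s))" "0 \<le> c" "c < e" "\<And>s. c \<le> s \<Longrightarrow> s \<le> e \<Longrightarrow> u s \<le> r"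
      for u :: "real \<Rightarrow> real" and r c e
    proof -
      have "(LBINT s:{0..}. u s * ker c e s) \<le> (LBINT s:{0..}. r * ker c e s)"
      proof (rule set_integral_mono)
        fix s :: real
        show "u s * ker c e s \<le> r * ker c e s"
          using that(4)[of s] ker_nonneg[of c e s] ker_supp[OF _ that(3), of s]
          by (cases "s \<in> {c..e}") (auto intro: mult_right_mono)
      qed (use kint[OF that(1-3)] ker_int[OF that(2,3)] in auto)
      also have "\<dots> = r * mass c e" by (simp add: mass_def)
      finally show ?thesis .
    qed
    \<comment> \<open>The upper bound uses the bump to the right of t, where f is at least f(t) -
      \<epsilon>. The three \<epsilon> are the regularity of f, the distance of the weighted
      averages and the oscillation of h.\<close>
    have "(f t - \<epsilon>) * mass t (t + \<rho>) \<le> (LBINT s:{0..}. f s * ker t (t + \<rho>) s)"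
      using \<rho> f2 by (intro lower fi) auto
    also have "\<dots> \<le> (LBINT s:{0..}. h s * ker t (t + \<rho>) s) + \<epsilon> * mass t (t + \<rho>)"
      using main[of t "t + \<rho>"] by auto
    also have "(LBINT s:{0..}. h s * ker t (t + \<rho>) s) \<le> (h t + \<epsilon>) * mass t (t + \<rho>)"
      using \<rho> hc by (intro upper hi) (auto simp: abs_le_iff algebra_simps)
    finally have "(f t - \<epsilon>) * mass t (t + \<rho>) \<le> (h t + 2 * \<epsilon>) * mass t (t + \<rho>)"
      by (simp add: algebra_simps)
    then have up: "f t - \<epsilon> \<le> h t + 2 * \<epsilon>" using mass_pos[of t "t + \<rho>"] \<rho> by auto
    have "(h t - \<epsilon>) * mass (t - \<rho>) t \<le> (LBINT s:{0..}. h s * ker (t - \<rho>) t s)"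
      using \<rho> hc by (intro lower hi) (auto simp: abs_le_iff algebra_simps)
    also have "\<dots> \<le> (LBINT s:{0..}. f s * ker (t - \<rho>) t s) + \<epsilon> * mass (t - \<rho>) t"
      using main[of "t - \<rho>" t] by auto
    also have "(LBINT s:{0..}. f s * ker (t - \<rho>) t s) \<le> (f t + \<epsilon>) * mass (t - \<rho>) t"
      using \<rho> f1 by (intro upper fi) (auto simp: algebra_simps)
    finally have "(h t - \<epsilon>) * mass (t - \<rho>) t \<le> (f t + 2 * \<epsilon>) * mass (t - \<rho>) t"
      by (simp add: algebra_simps)
    then have "h t - \<epsilon> \<le> f t + 2 * \<epsilon>" using mass_pos[of "t - \<rho>" t] \<rho> by auto
    then show "\<bar>f t - h t\<bar> \<le> 3 * \<epsilon>" using up by linarith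
  qed
qed

subsection \<open>Concentration and laws of large numbers\<close>

text \<open>For negative x compare with 1/(1 - x + x^2/2): the product of that denominator with 1 +
  x + x^2 is at least 1.\<close>

lemma exp_le_quadratic:
  fixes x :: real
  assumes "\<bar>x\<bar> \<le> 1"
  shows "exp x \<le> 1 + x + x\<^sup>2"
proof (cases "x \<ge> 0")
  case True
  then show ?thesis using exp_bound[of x] assms by simp
next
  case False
  have "1 + (- x) + (- x)\<^sup>2 / 2 \<le> exp (- x)" using exp_lower_Taylor_quadratic[of "- x"] False by simp
  moreover have "1 + (- x) + (- x)\<^sup>2 / 2 > 0" using False by (intro add_pos_nonneg) auto
  ultimately have "exp x \<le> 1 / (1 + (- x) + (- x)\<^sup>2 / 2)"
    by (simp add: exp_minus field_simps)
  also have "\<dots> \<le> 1 + x + x\<^sup>2"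
  proof -
    have "(1 + x + x\<^sup>2) * (1 + (- x) + (- x)\<^sup>2 / 2) = 1 + x\<^sup>2 / 2 * (1 - x + x\<^sup>2)"
      by (simp add: power2_eq_square field_simps)
    moreover have "x\<^sup>2 / 2 * (1 - x + x\<^sup>2) \<ge> 0" using False by (intro mult_nonneg_nonneg) auto
    ultimately show ?thesis
      using \<open>1 + (- x) + (- x)\<^sup>2 / 2 > 0\<close> by (simp add: pos_divide_le_eq)
  qed
  finally show ?thesis .
qed

context prob_space
begin

text \<open>From 0 \<le> Y \<le> 1 one gets Y^2 \<le> Y, so the quadratic term of the exponential is
  again bounded through the mean and no variance enters.\<close>

lemma exp_moment_le:
  fixes Y :: "'i \<Rightarrow> 'a \<Rightarrow> real"
  assumes I: "finite I" and ind: "indep_vars (\<lambda>_. borel) Y I"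
    and Y: "\<And>i \<omega>. i \<in> I \<Longrightarrow> \<omega> \<in> space M \<Longrightarrow> 0 \<le> Y i \<omega> \<and> Y i \<omega> \<le> 1"
    and s: "\<bar>s\<bar> \<le> 1"
  shows "integrable M (\<lambda>\<omega>. exp (s * (\<Sum>i\<in>I. Y i \<omega>)))"
    and "expectation (\<lambda>\<omega>. exp (s * (\<Sum>i\<in>I. Y i \<omega>))) \<le> exp ((s + s\<^sup>2) * (\<Sum>i\<in>I. expectation (Y i)))"
proof -
  have rv: "Y i \<in> borel_measurable M" if "i \<in> I" for i
    using ind that by (auto simp: indep_vars_def)
  have Yint: "integrable M (Y i)" if "i \<in> I" for i
    using rv[OF that] Y[OF that] by (intro integrable_const_bound[where B = 1]) auto
  have eint: "integrable M (\<lambda>\<omega>. exp (s * Y i \<omega>))" if "i \<in> I" for i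
  proof (rule integrable_const_bound[where B = "exp 1"])
    show "(\<lambda>\<omega>. exp (s * Y i \<omega>)) \<in> borel_measurable M" using rv[OF that] by measurable
    show "AE \<omega> in M. norm (exp (s * Y i \<omega>)) \<le> exp 1"
    proof (rule AE_I2)
      fix \<omega> assume "\<omega> \<in> space M"
      then have "\<bar>s * Y i \<omega>\<bar> \<le> 1 * 1" unfolding abs_mult using Y[OF that] s by (intro mult_mono) auto
      then show "norm (exp (s * Y i \<omega>)) \<le> exp 1" by auto
    qed
  qed
  have ind': "indep_vars (\<lambda>_. borel) (\<lambda>i \<omega>. exp (s * Y i \<omega>)) I"
    by (rule indep_vars_compose2[OF ind]) auto
  have eq: "exp (s * (\<Sum>i\<in>I. Y i \<omega>)) = (\<Prod>i\<in>I. exp (s * Y i \<omega>))" for \<omega>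
    using I by (simp add: sum_distrib_left exp_sum)
  show "integrable M (\<lambda>\<omega>. exp (s * (\<Sum>i\<in>I. Y i \<omega>)))"
    unfolding eq by (rule indep_vars_integrable[OF I ind' eint])
  have "expectation (\<lambda>\<omega>. exp (s * (\<Sum>i\<in>I. Y i \<omega>))) = (\<Prod>i\<in>I. expectation (\<lambda>\<omega>. exp (s * Y i \<omega>)))"
    unfolding eq by (rule indep_vars_lebesgue_integral[OF I ind' eint])
  also have "\<dots> \<le> (\<Prod>i\<in>I. exp ((s + s\<^sup>2) * expectation (Y i)))"
  proof (rule prod_mono)
    fix i assume i: "i \<in> I"
    have "expectation (\<lambda>\<omega>. exp (s * Y i \<omega>)) \<le> expectation (\<lambda>\<omega>. 1 + (s + s\<^sup>2) * Y i \<omega>)"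
    proof (rule integral_mono[OF eint[OF i]])
      show "integrable M (\<lambda>\<omega>. 1 + (s + s\<^sup>2) * Y i \<omega>)" using Yint[OF i] by simp
      fix \<omega> assume w: "\<omega> \<in> space M"
      then have "\<bar>s * Y i \<omega>\<bar> \<le> 1 * 1" unfolding abs_mult using Y[OF i] s by (intro mult_mono) auto
      then have "exp (s * Y i \<omega>) \<le> 1 + s * Y i \<omega> + (s * Y i \<omega>)\<^sup>2"
        by (intro exp_le_quadratic) auto
      also have "(s * Y i \<omega>)\<^sup>2 \<le> s\<^sup>2 * Y i \<omega>"
      proof -
        have "(Y i \<omega>)\<^sup>2 \<le> Y i \<omega>" using Y[OF i w] by (simp add: power2_eq_square mult_left_le)
        then show ?thesis by (simp add: power_mult_distrib mult_left_mono)
      qed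
      finally show "exp (s * Y i \<omega>) \<le> 1 + (s + s\<^sup>2) * Y i \<omega>" by (simp add: algebra_simps)
    qed
    also have "\<dots> = 1 + (s + s\<^sup>2) * expectation (Y i)" using Yint[OF i] by (simp add: prob_space)
    also have "\<dots> \<le> exp ((s + s\<^sup>2) * expectation (Y i))" by (rule exp_ge_add_one_self)
    finally show "0 \<le> expectation (\<lambda>\<omega>. exp (s * Y i \<omega>)) \<and>
       expectation (\<lambda>\<omega>. exp (s * Y i \<omega>)) \<le> exp ((s + s\<^sup>2) * expectation (Y i))"
      by (auto intro: Bochner_Integration.integral_nonneg)
  qed
  also have "\<dots> = exp ((s + s\<^sup>2) * (\<Sum>i\<in>I. expectation (Y i)))"
    using I by (simp add: sum_distrib_left exp_sum)
  finally show "expectation (\<lambda>\<omega>. exp (s * (\<Sum>i\<in>I. Y i \<omega>))) \<le> exp ((s + s\<^sup>2) * (\<Sum>i\<in>I. expectation (Y i)))" .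
qed

lemma chernoff_bound:
  fixes Y :: "'i \<Rightarrow> 'a \<Rightarrow> real"
  assumes I: "finite I" and ind: "indep_vars (\<lambda>_. borel) Y I"
    and Y: "\<And>i \<omega>. i \<in> I \<Longrightarrow> \<omega> \<in> space M \<Longrightarrow> 0 \<le> Y i \<omega> \<and> Y i \<omega> \<le> 1"
    and C: "C > 0" "\<epsilon> > 0" "m \<ge> 0" "(\<Sum>i\<in>I. expectation (Y i)) \<le> C * m"
  shows "prob {\<omega>\<in>space M. \<bar>(\<Sum>i\<in>I. Y i \<omega>) - (\<Sum>i\<in>I. expectation (Y i))\<bar> \<ge> \<epsilon> * m}
     \<le> 2 * exp (- (min 1 (\<epsilon> / (2 * C)) * \<epsilon> / 2 * m))"
proof -
  define \<mu> where "\<mu> = (\<Sum>i\<in>I. expectation (Y i))"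
  \<comment> \<open>Chosen such that the second-order term s^2 C m is at most half of the gain s
    \<epsilon> m, while s stays in the range of \<open>exp_moment_le\<close>.\<close>
  define s where "s = min 1 (\<epsilon> / (2 * C))"
  have s: "0 < s" "s \<le> 1" "s * C \<le> \<epsilon> / 2"
  proof -
    show "0 < s" "s \<le> 1" using C by (auto simp: s_def)
    have "s * C \<le> \<epsilon> / (2 * C) * C" using C by (intro mult_right_mono) (auto simp: s_def)
    then show "s * C \<le> \<epsilon> / 2" using C by simp
  qed
  have rv [measurable]: "Y i \<in> borel_measurable M" if "i \<in> I" for i
    using ind that by (auto simp: indep_vars_def)
  have sm [measurable]: "(\<lambda>\<omega>. \<Sum>i\<in>I. Y i \<omega>) \<in> borel_measurable M"
    by (intro borel_measurable_sum rv)
  have main: "prob {\<omega>\<in>space M. exp (r * (\<Sum>i\<in>I. Y i \<omega>)) \<ge> exp (r * \<mu> + s * (\<epsilon> * m))}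
      \<le> exp (- (s * \<epsilon> / 2 * m))" if r: "r = s \<or> r = - s" for r
  proof -
    have "\<bar>r\<bar> \<le> 1" using r s by auto
    note em = exp_moment_le[OF I ind Y this]
    have "prob {\<omega>\<in>space M. exp (r * (\<Sum>i\<in>I. Y i \<omega>)) \<ge> exp (r * \<mu> + s * (\<epsilon> * m))}
       \<le> expectation (\<lambda>\<omega>. exp (r * (\<Sum>i\<in>I. Y i \<omega>))) / exp (r * \<mu> + s * (\<epsilon> * m))"
      by (rule integral_Markov_inequality_measure[OF em(1), of "{}"]) auto
    also have "\<dots> \<le> exp ((r + r\<^sup>2) * \<mu>) / exp (r * \<mu> + s * (\<epsilon> * m))"
      unfolding \<mu>_def by (intro divide_right_mono em(2)) auto
    also have "\<dots> = exp (r\<^sup>2 * \<mu> - s * (\<epsilon> * m))"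
      by (simp add: exp_diff[symmetric] algebra_simps)
    also have "\<dots> \<le> exp (- (s * \<epsilon> / 2 * m))"
    proof -
      have "r\<^sup>2 * \<mu> \<le> r\<^sup>2 * (C * m)" using C(4) unfolding \<mu>_def by (intro mult_left_mono) auto
      also have "\<dots> = s * m * (s * C)" using r by (auto simp: power2_eq_square)
      also have "\<dots> \<le> s * m * (\<epsilon> / 2)" using s C by (intro mult_left_mono) auto
      finally show ?thesis by (simp add: algebra_simps)
    qed
    finally show ?thesis .
  qed
  have "{\<omega>\<in>space M. \<bar>(\<Sum>i\<in>I. Y i \<omega>) - \<mu>\<bar> \<ge> \<epsilon> * m} \<subseteq>
      {\<omega>\<in>space M. exp (s * (\<Sum>i\<in>I. Y i \<omega>)) \<ge> exp (s * \<mu> + s * (\<epsilon> * m))}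
      \<union> {\<omega>\<in>space M. exp (- s * (\<Sum>i\<in>I. Y i \<omega>)) \<ge> exp (- s * \<mu> + s * (\<epsilon> * m))}"
  proof
    fix \<omega> assume "\<omega> \<in> {\<omega>\<in>space M. \<bar>(\<Sum>i\<in>I. Y i \<omega>) - \<mu>\<bar> \<ge> \<epsilon> * m}"
    then have w: "\<omega> \<in> space M" and "\<bar>(\<Sum>i\<in>I. Y i \<omega>) - \<mu>\<bar> \<ge> \<epsilon> * m" by auto
    moreover define y where "y = (\<Sum>i\<in>I. Y i \<omega>)"
    ultimately consider "y \<ge> \<mu> + \<epsilon> * m" | "y \<le> \<mu> - \<epsilon> * m" by linarith
    then have "s * \<mu> + s * (\<epsilon> * m) \<le> s * y \<or> - s * \<mu> + s * (\<epsilon> * m) \<le> - s * y"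
    proof cases
      case 1
      then have "s * (\<mu> + \<epsilon> * m) \<le> s * y" using s by (intro mult_left_mono) auto
      then show ?thesis by (simp add: algebra_simps)
    next
      case 2
      then have "s * y \<le> s * (\<mu> - \<epsilon> * m)" using s by (intro mult_left_mono) auto
      then show ?thesis by (simp add: algebra_simps)
    qed
    then show "\<omega> \<in> {\<omega>\<in>space M. exp (s * (\<Sum>i\<in>I. Y i \<omega>)) \<ge> exp (s * \<mu> + s * (\<epsilon> * m))}
      \<union> {\<omega>\<in>space M. exp (- s * (\<Sum>i\<in>I. Y i \<omega>)) \<ge> exp (- s * \<mu> + s * (\<epsilon> * m))}"
      using w by (auto simp: y_def)
  qed
  then have "prob {\<omega>\<in>space M. \<bar>(\<Sum>i\<in>I. Y i \<omega>) - \<mu>\<bar> \<ge> \<epsilon> * m} \<le>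
     prob ({\<omega>\<in>space M. exp (s * (\<Sum>i\<in>I. Y i \<omega>)) \<ge> exp (s * \<mu> + s * (\<epsilon> * m))}
      \<union> {\<omega>\<in>space M. exp (- s * (\<Sum>i\<in>I. Y i \<omega>)) \<ge> exp (- s * \<mu> + s * (\<epsilon> * m))})"
    by (intro finite_measure_mono) auto
  also have "\<dots> \<le> prob {\<omega>\<in>space M. exp (s * (\<Sum>i\<in>I. Y i \<omega>)) \<ge> exp (s * \<mu> + s * (\<epsilon> * m))}
      + prob {\<omega>\<in>space M. exp (- s * (\<Sum>i\<in>I. Y i \<omega>)) \<ge> exp (- s * \<mu> + s * (\<epsilon> * m))}"
    by (intro measure_Un_le) auto
  also have "\<dots> \<le> 2 * exp (- (s * \<epsilon> / 2 * m))"
    using main[of s] main[of "- s"] by simp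
  finally show ?thesis by (simp add: s_def \<mu>_def)
qed

text \<open>The series of the X n has finite mean, hence is finite almost surely, and its terms tend
  to 0.\<close>

lemma AE_tendsto_0_summable:
  fixes X :: "nat \<Rightarrow> 'a \<Rightarrow> real"
  assumes int: "\<And>n. integrable M (X n)" and nn: "\<And>n \<omega>. \<omega> \<in> space M \<Longrightarrow> X n \<omega> \<ge> 0"
    and sm: "summable (\<lambda>n. expectation (X n))"
  shows "AE \<omega> in M. (\<lambda>n. X n \<omega>) \<longlonglongrightarrow> 0"
proof -
  have [measurable]: "X n \<in> borel_measurable M" for n using int by auto
  have "(\<integral>\<^sup>+\<omega>. (\<Sum>n. ennreal (X n \<omega>)) \<partial>M) = (\<Sum>n. \<integral>\<^sup>+\<omega>. ennreal (X n \<omega>) \<partial>M)"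
    by (rule nn_integral_suminf) auto
  also have "\<dots> = (\<Sum>n. ennreal (expectation (X n)))"
    using int nn by (intro arg_cong[where f = suminf] ext nn_integral_eq_integral) auto
  also have "\<dots> = ennreal (\<Sum>n. expectation (X n))"
    using nn sm by (intro suminf_ennreal_eq summable_sums) (auto intro: Bochner_Integration.integral_nonneg)
  finally have "(\<integral>\<^sup>+\<omega>. (\<Sum>n. ennreal (X n \<omega>)) \<partial>M) \<noteq> \<infinity>" by simp
  then have "AE \<omega> in M. (\<Sum>n. ennreal (X n \<omega>)) \<noteq> \<infinity>"
    by (intro nn_integral_PInf_AE) auto
  then show ?thesis
    using AE_space
  proof eventually_elim
    case (elim \<omega>)
    then have "summable (\<lambda>n. X n \<omega>)"
      using nn by (intro summable_suminf_not_top) auto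
    then show ?case by (rule summable_LIMSEQ_zero)
  qed
qed

end

section \<open>Means of functions of a regularly varying variable\<close>

lemma nn_integral_powr_Icc:
  assumes "\<alpha> > 0" "c \<ge> 0"
  shows "(\<integral>\<^sup>+z. ennreal (indicator {0..c} z * (\<alpha> * z powr (\<alpha> - 1))) \<partial>lborel) = ennreal (c powr \<alpha>)"
proof -
  have "((\<lambda>z. \<alpha> * z powr (\<alpha> - 1)) has_integral (\<alpha> * (c powr (\<alpha> - 1 + 1) / (\<alpha> - 1 + 1)))) {0..c}"
    using assms by (intro has_integral_mult_right has_integral_powr_from_0) auto
  then have "((\<lambda>z. \<alpha> * z powr (\<alpha> - 1)) has_integral (c powr \<alpha>)) {0..c}"
    using assms by simp
  from nn_integral_has_integral_lebesgue[OF _ this] show ?thesis using assms by simp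
qed

text \<open>Scaling limit of the mean: write \<open>\<Phi>\<close> as the distribution function of a Stieltjes measure,
  so that \<open>\<integral>\<Phi>(t/U) D(dt)\<close> becomes an integral of the tail of \<open>D\<close>.  The limit measure has tail
  \<open>w\<^bsup>-\<alpha>\<^esup>\<close>; it is written as the image of \<open>\<alpha> z\<^bsup>\<alpha>-1\<^esup> dz\<close> under \<open>z \<mapsto> 1/z\<close>.\<close>

lemma regularly_varying_mean_tendsto:
  fixes D :: "real measure" and \<Phi> :: "real \<Rightarrow> real"
  assumes D: "prob_space D" and [measurable_cong]: "sets D = sets borel"
    and \<alpha>: "0 < \<alpha>"
    and tail: "((\<lambda>u. u powr \<alpha> * measure D {u..}) \<longlongrightarrow> 1) at_top"
    and mono: "\<And>x y. x \<le> y \<Longrightarrow> \<Phi> x \<le> \<Phi> y"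
    and rc: "\<And>a. continuous (at_right a) \<Phi>"
    and \<Phi>0: "\<And>x. x \<le> 0 \<Longrightarrow> \<Phi> x = 0" and \<Phi>1: "\<And>x. \<Phi> x \<le> 1"
    and L: "(\<integral>\<^sup>+z. ennreal (indicator {0..} z * (\<Phi> (1 / z) * (\<alpha> * z powr (\<alpha> - 1)))) \<partial>lborel) = ennreal L" "L \<ge> 0"
    and Upos: "\<And>n. U n > 0" and U: "filterlim U at_top sequentially"
  shows "(\<lambda>n. U n powr \<alpha> * (\<integral>t. \<Phi> (t / U n) \<partial>D)) \<longlonglongrightarrow> L"
proof -
  interpret D: prob_space D by fact
  have spD [simp]: "space D = UNIV" using sets_eq_imp_space_eq[OF assms(2)] by simp
  define \<nu> where "\<nu> = interval_measure \<Phi>"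
  interpret \<nu>: sigma_finite_measure \<nu>
    unfolding \<nu>_def by (rule sigma_finite_interval_measure[OF mono rc])
  have sets_\<nu> [measurable_cong]: "sets \<nu> = sets borel" by (simp add: \<nu>_def)
  have \<Phi>_nonneg: "\<Phi> x \<ge> 0" for x
    using mono[of 0 x] \<Phi>0[of x] \<Phi>0[of 0] by (cases "x \<le> 0") auto
  have [measurable]: "\<Phi> \<in> borel_measurable borel"
    by (intro borel_measurable_mono monoI mono)
  have \<Phi>\<nu>: "ennreal (\<Phi> x) = (\<integral>\<^sup>+w. indicator {0<..x} w \<partial>\<nu>)" for x
  proof -
    have "(\<integral>\<^sup>+w. indicator {0<..x} w \<partial>\<nu>) = emeasure \<nu> {0<..x}"
      by (rule nn_integral_indicator) (simp add: \<nu>_def)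
    also have "\<dots> = ennreal (\<Phi> x)"
      unfolding \<nu>_def using \<Phi>0 by (subst emeasure_interval_measure_Ioc_eq[OF mono rc]) auto
    finally show ?thesis ..
  qed
  define H where "H = (\<lambda>u. measure D {u..})"
  have H1: "H u \<le> 1" and H0: "H u \<ge> 0" for u by (auto simp: H_def)
  have Hmono: "H u' \<le> H u" if "u \<le> u'" for u u'
    unfolding H_def using that by (intro D.finite_measure_mono) auto
  have [measurable]: "H \<in> borel_measurable borel"
  proof -
    have "mono (\<lambda>u. - H u)" using Hmono by (auto simp: mono_def)
    then have "(\<lambda>u. - (- H u)) \<in> borel_measurable borel"
      by (intro borel_measurable_uminus borel_measurable_mono)
    then show ?thesis by simp
  qed
  \<comment> \<open>A tail bound valid for all u > 0, which yields the dominating function C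
    w^(-\<alpha>). Beyond u0 the tail limit 1 allows the constant 2; below u0 the bound H \<le> 1 is
    enough.\<close>
  obtain C where C: "C > 0" "\<And>u. u > 0 \<Longrightarrow> u powr \<alpha> * H u \<le> C"
  proof -
    have "eventually (\<lambda>u. u powr \<alpha> * H u < 2) at_top"
      using order_tendstoD(2)[OF tail, of 2] by (simp add: H_def)
    then obtain u0 where u0: "\<And>u. u \<ge> u0 \<Longrightarrow> u powr \<alpha> * H u < 2"
      by (auto simp: eventually_at_top_linorder)
    show ?thesis
    proof (rule that[of "max 2 (\<bar>u0\<bar> powr \<alpha>)"])
      fix u :: real assume u: "u > 0"
      show "u powr \<alpha> * H u \<le> max 2 (\<bar>u0\<bar> powr \<alpha>)"
      proof (cases "u \<ge> u0")
        case True
        then show ?thesis using u0[OF True] by simp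
      next
        case False
        have "u powr \<alpha> * H u \<le> \<bar>u0\<bar> powr \<alpha> * 1"
          using False u \<alpha> H1 H0 by (intro mult_mono powr_mono2) auto
        then show ?thesis by simp
      qed
    qed simp
  qed
  \<comment> \<open>The hypothesis on \<open>L\<close> read through Fubini: the inner integral over
    0 \<le> z \<le> 1/w equals w^(-\<alpha>). Finiteness of \<open>L\<close> thereby also makes the
    dominating function integrable.\<close>
  have lim_val: "(\<integral>\<^sup>+w. ennreal (indicator {0<..} w * w powr (- \<alpha>)) \<partial>\<nu>) = ennreal L"
  proof -
    have "ennreal L = (\<integral>\<^sup>+z. (\<integral>\<^sup>+w. ennreal (indicator {0..} z * (indicator {0<..1 / z} w * (\<alpha> * z powr (\<alpha> - 1)))) \<partial>\<nu>) \<partial>lborel)"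
      unfolding L(1)[symmetric]
    proof (rule nn_integral_cong)
      fix z :: real
      have "ennreal (indicator {0..} z * (\<Phi> (1 / z) * (\<alpha> * z powr (\<alpha> - 1)))) =
         ennreal (indicator {0..} z * (\<alpha> * z powr (\<alpha> - 1))) * ennreal (\<Phi> (1 / z))"
        using \<alpha> \<Phi>_nonneg by (simp add: ennreal_mult[symmetric] mult_ac)
      also have "\<dots> = (\<integral>\<^sup>+w. ennreal (indicator {0..} z * (\<alpha> * z powr (\<alpha> - 1))) * indicator {0<..1 / z} w \<partial>\<nu>)"
        unfolding \<Phi>\<nu> by (rule nn_integral_cmult[symmetric]) measurable
      also have "\<dots> = (\<integral>\<^sup>+w. ennreal (indicator {0..} z * (indicator {0<..1 / z} w * (\<alpha> * z powr (\<alpha> - 1)))) \<partial>\<nu>)"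
        by (intro nn_integral_cong) (auto simp: indicator_def)
      finally show "ennreal (indicator {0..} z * (\<Phi> (1 / z) * (\<alpha> * z powr (\<alpha> - 1)))) =
         (\<integral>\<^sup>+w. ennreal (indicator {0..} z * (indicator {0<..1 / z} w * (\<alpha> * z powr (\<alpha> - 1)))) \<partial>\<nu>)" .
    qed
    also have "\<dots> = (\<integral>\<^sup>+w. (\<integral>\<^sup>+z. ennreal (indicator {0..} z * (indicator {0<..1 / z} w * (\<alpha> * z powr (\<alpha> - 1)))) \<partial>lborel) \<partial>\<nu>)"
    proof -
      interpret P: pair_sigma_finite lborel \<nu> ..
      have eq: "indicator {0<..1 / z} w = (if 0 < w \<and> w \<le> 1 / z then 1 else (0::real))" for z w
        by (auto simp: indicator_def)
      show ?thesis
        unfolding eq by (rule P.Fubini'[symmetric]) measurable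
    qed
    also have "\<dots> = (\<integral>\<^sup>+w. ennreal (indicator {0<..} w * w powr (- \<alpha>)) \<partial>\<nu>)"
    proof (rule nn_integral_cong)
      fix w :: real
      show "(\<integral>\<^sup>+z. ennreal (indicator {0..} z * (indicator {0<..1 / z} w * (\<alpha> * z powr (\<alpha> - 1)))) \<partial>lborel)
          = ennreal (indicator {0<..} w * w powr (- \<alpha>))"
      proof (cases "w > 0")
        case True
        have "(\<integral>\<^sup>+z. ennreal (indicator {0..} z * (indicator {0<..1 / z} w * (\<alpha> * z powr (\<alpha> - 1)))) \<partial>lborel)
            = (\<integral>\<^sup>+z. ennreal (indicator {0..1 / w} z * (\<alpha> * z powr (\<alpha> - 1))) \<partial>lborel)"
        proof (rule nn_integral_cong)
          fix z :: real
          have "z \<ge> 0 \<and> w \<le> 1 / z \<longleftrightarrow> z \<ge> 0 \<and> z \<le> 1 / w" if "z \<noteq> 0"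
            using True that by (auto simp: field_simps)
          then show "ennreal (indicator {0..} z * (indicator {0<..1 / z} w * (\<alpha> * z powr (\<alpha> - 1)))) =
             ennreal (indicator {0..1 / w} z * (\<alpha> * z powr (\<alpha> - 1)))"
            using True by (cases "z = 0") (auto simp: indicator_def)
        qed
        also have "\<dots> = ennreal ((1 / w) powr \<alpha>)"
          using True \<alpha> by (intro nn_integral_powr_Icc) auto
        finally show ?thesis using True by (simp add: powr_divide powr_minus_divide)
      next
        case False
        then have "indicator {0<..1 / z} w = (0::real)" for z by (auto simp: indicator_def)
        then show ?thesis using False by simp
      qed
    qed
    finally show ?thesis ..
  qed
  have val: "ennreal (U n powr \<alpha> * (\<integral>t. \<Phi> (t / U n) \<partial>D)) =
      (\<integral>\<^sup>+w. ennreal (indicator {0<..} w * (U n powr \<alpha> * H (w * U n))) \<partial>\<nu>)" for n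
  proof -
    note Un = Upos[of n]
    have int: "integrable D (\<lambda>t. \<Phi> (t / U n))"
      using \<Phi>_nonneg \<Phi>1 by (intro D.integrable_const_bound[where B = 1]) auto
    have "ennreal (\<integral>t. \<Phi> (t / U n) \<partial>D) = (\<integral>\<^sup>+t. ennreal (\<Phi> (t / U n)) \<partial>D)"
      using int \<Phi>_nonneg by (intro nn_integral_eq_integral[symmetric]) auto
    also have "\<dots> = (\<integral>\<^sup>+t. (\<integral>\<^sup>+w. indicator {0<..t / U n} w \<partial>\<nu>) \<partial>D)"
      unfolding \<Phi>\<nu> ..
    also have "\<dots> = (\<integral>\<^sup>+w. (\<integral>\<^sup>+t. indicator {0<..t / U n} w \<partial>D) \<partial>\<nu>)"
    proof -
      interpret P: pair_sigma_finite D \<nu> ..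
      have eq: "indicator {0<..t / U n} w = (if 0 < w \<and> w \<le> t / U n then 1 else (0::ennreal))" for t w
        by (auto simp: indicator_def)
      show ?thesis
        unfolding eq by (rule P.Fubini'[symmetric]) measurable
    qed
    also have "\<dots> = (\<integral>\<^sup>+w. ennreal (indicator {0<..} w * H (w * U n)) \<partial>\<nu>)"
    proof (rule nn_integral_cong)
      fix w :: real
      have "(\<integral>\<^sup>+t. indicator {0<..t / U n} w \<partial>D) = (\<integral>\<^sup>+t. indicator {0<..} w * indicator {w * U n..} t \<partial>D)"
        using Un by (intro nn_integral_cong) (auto simp: indicator_def field_simps)
      also have "\<dots> = indicator {0<..} w * emeasure D {w * U n..}"
        by (subst nn_integral_cmult) (auto simp: assms(2))
      also have "\<dots> = ennreal (indicator {0<..} w * H (w * U n))"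
        by (simp add: H_def D.emeasure_eq_measure indicator_def)
      finally show "(\<integral>\<^sup>+t. indicator {0<..t / U n} w \<partial>D) = ennreal (indicator {0<..} w * H (w * U n))" .
    qed
    finally have "ennreal (U n powr \<alpha>) * ennreal (\<integral>t. \<Phi> (t / U n) \<partial>D)
        = ennreal (U n powr \<alpha>) * (\<integral>\<^sup>+w. ennreal (indicator {0<..} w * H (w * U n)) \<partial>\<nu>)" by simp
    also have "\<dots> = (\<integral>\<^sup>+w. ennreal (U n powr \<alpha>) * ennreal (indicator {0<..} w * H (w * U n)) \<partial>\<nu>)"
      by (rule nn_integral_cmult[symmetric]) measurable
    also have "\<dots> = (\<integral>\<^sup>+w. ennreal (indicator {0<..} w * (U n powr \<alpha> * H (w * U n))) \<partial>\<nu>)"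
      by (intro nn_integral_cong) (simp add: ennreal_mult'[symmetric] mult_ac)
    finally show ?thesis by (simp add: ennreal_mult')
  qed
  have "(\<lambda>n. \<integral>\<^sup>+w. ennreal (indicator {0<..} w * (U n powr \<alpha> * H (w * U n))) \<partial>\<nu>)
     \<longlonglongrightarrow> (\<integral>\<^sup>+w. ennreal (indicator {0<..} w * w powr (- \<alpha>)) \<partial>\<nu>)"
  proof (rule nn_integral_dominated_convergence[where w = "\<lambda>w. ennreal (C * (indicator {0<..} w * w powr (- \<alpha>)))"])
    fix n
    show "AE w in \<nu>. ennreal (indicator {0<..} w * (U n powr \<alpha> * H (w * U n)))
        \<le> ennreal (C * (indicator {0<..} w * w powr (- \<alpha>)))"
    proof (rule AE_I2, rule ennreal_leI)
      fix w
      show "indicator {0<..} w * (U n powr \<alpha> * H (w * U n)) \<le> C * (indicator {0<..} w * w powr (- \<alpha>))"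
      proof (cases "w > 0")
        case True
        have "(w * U n) powr \<alpha> * H (w * U n) \<le> C" using True Upos by (intro C(2)) auto
        then show ?thesis using True Upos[of n]
          by (simp add: powr_mult powr_minus field_simps)
      qed simp
    qed
  next
    show "(\<integral>\<^sup>+w. ennreal (C * (indicator {0<..} w * w powr (- \<alpha>))) \<partial>\<nu>) < \<infinity>"
    proof -
      have "(\<integral>\<^sup>+w. ennreal (C * (indicator {0<..} w * w powr (- \<alpha>))) \<partial>\<nu>) =
         (\<integral>\<^sup>+w. ennreal C * ennreal (indicator {0<..} w * w powr (- \<alpha>)) \<partial>\<nu>)"
        using C by (intro nn_integral_cong) (simp add: ennreal_mult')
      also have "\<dots> = ennreal C * ennreal L"
        unfolding lim_val[symmetric] by (rule nn_integral_cmult) measurable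
      finally show ?thesis by (simp add: ennreal_mult_less_top)
    qed
  next
    show "AE w in \<nu>. (\<lambda>n. ennreal (indicator {0<..} w * (U n powr \<alpha> * H (w * U n))))
        \<longlonglongrightarrow> ennreal (indicator {0<..} w * w powr (- \<alpha>))"
    proof (rule AE_I2, rule tendsto_ennrealI)
      fix w :: real
      show "(\<lambda>n. indicator {0<..} w * (U n powr \<alpha> * H (w * U n))) \<longlonglongrightarrow> indicator {0<..} w * w powr (- \<alpha>)"
      proof (cases "w > 0")
        case True
        have "filterlim (\<lambda>n. w * U n) at_top sequentially"
          using True U by (intro filterlim_tendsto_pos_mult_at_top[OF tendsto_const])
        from filterlim_compose[OF tail this]
        have "(\<lambda>n. w powr (- \<alpha>) * ((w * U n) powr \<alpha> * H (w * U n))) \<longlonglongrightarrow> w powr (- \<alpha>) * 1"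
          unfolding H_def by (intro tendsto_intros)
        moreover have "w powr (- \<alpha>) * ((w * U n) powr \<alpha> * H (w * U n)) = U n powr \<alpha> * H (w * U n)" for n
          using Upos[of n] True by (simp add: powr_mult powr_minus)
        ultimately show ?thesis using True by simp
      qed simp
    qed
  qed measurable
  then have "(\<lambda>n. \<integral>\<^sup>+w. ennreal (indicator {0<..} w * (U n powr \<alpha> * H (w * U n))) \<partial>\<nu>) \<longlonglongrightarrow> ennreal L"
    by (simp only: lim_val)
  then have "(\<lambda>n. ennreal (U n powr \<alpha> * (\<integral>t. \<Phi> (t / U n) \<partial>D))) \<longlonglongrightarrow> ennreal L"
    by (simp only: val)
  moreover have "(\<integral>t. \<Phi> (t / U n) \<partial>D) \<ge> 0" for n
    using \<Phi>_nonneg by (intro Bochner_Integration.integral_nonneg) auto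
  ultimately show ?thesis
    using L(2) by (subst (asm) tendsto_ennreal_iff) (auto intro!: always_eventually)
qed

lemma summable_exp_neg_powr:
  fixes c \<gamma> :: real
  assumes "c > 0" "\<gamma> > 0"
  shows "summable (\<lambda>n. exp (- (c * real n powr \<gamma>)))"
proof (rule summable_comparison_test_ev)
  show "summable (\<lambda>n. real n powr (- 2))" by (simp add: summable_real_powr_iff)
  have "((\<lambda>n. ln (real n) / real n powr \<gamma>) \<longlongrightarrow> 0) sequentially"
    by (rule lim_ln_over_power) (fact assms(2))
  then have "eventually (\<lambda>n. ln (real n) / real n powr \<gamma> < c / 2) sequentially"
    using assms by (intro order_tendstoD(2)) auto
  then show "eventually (\<lambda>n. norm (exp (- (c * real n powr \<gamma>))) \<le> real n powr (- 2)) sequentially"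
    using eventually_gt_at_top[of 0]
  proof eventually_elim
    case (elim n)
    then have "2 * ln (real n) \<le> c * real n powr \<gamma>" by (simp add: field_simps)
    then have "exp (- (c * real n powr \<gamma>)) \<le> exp (- 2 * ln (real n))" by simp
    also have "\<dots> = real n powr (- 2)" using elim by (simp add: powr_def)
    finally show ?case by simp
  qed
qed

section \<open>The random environment: scales, laws of large numbers, near pairs\<close>

locale trap_environment = prob_space M
  for M :: "'w measure" +
  fixes \<tau> :: "'w \<Rightarrow> int \<times> int \<Rightarrow> real" and \<alpha> \<gamma> :: real
  assumes \<alpha>: "0 < \<alpha>" "\<alpha> < 1" and \<gamma>: "0 < \<gamma>" "\<gamma> < 1/6"
    and \<tau>_measurable [measurable]: "\<And>x. (\<lambda>\<omega>. \<tau> \<omega> x) \<in> borel_measurable M"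
    and \<tau>_indep: "indep_vars (\<lambda>_. borel) (\<lambda>x \<omega>. \<tau> \<omega> x) UNIV"
    and \<tau>_distr: "\<And>x. distr M borel (\<lambda>\<omega>. \<tau> \<omega> x) = distr M borel (\<lambda>\<omega>. \<tau> \<omega> (0,0))"
    and \<tau>_pos: "\<And>x. \<forall>\<omega>\<in>space M. \<tau> \<omega> x > 0"
    and \<tau>_tail: "((\<lambda>u. u powr \<alpha> * measure M {\<omega>\<in>space M. \<tau> \<omega> (0,0) \<ge> u}) \<longlongrightarrow> 1) at_top"
begin

definition g :: "nat \<Rightarrow> real" where "g n = green n (0,0)"
definition T :: "nat \<Rightarrow> real" where "T n = t_w \<alpha> \<gamma> n"
text \<open>The depth scale: \<tau>/U = g\<tau>/T is the rescaled depth v. At n = 0 the torus is a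
  point and g = 0; the value 1 there keeps \<open>U\<close> positive.\<close>

definition U :: "nat \<Rightarrow> real" where "U n = (if n = 0 then 1 else T n / g n)"

text \<open>The expected number of traps of depth at least \<open>U n\<close>, up to a factor tending to 1.\<close>

definition Mn :: "nat \<Rightarrow> real" where "Mn n = 4 ^ n * U n powr (- \<alpha>)"
definition b :: "nat \<Rightarrow> real" where "b n = real n powr (3/4)"
definition nearset :: "nat \<Rightarrow> int \<times> int \<Rightarrow> (int \<times> int) set" where
  "nearset n x = {z\<in>torus n. z \<noteq> x \<and> \<bar>green n (x - z)\<bar> > b n}"

lemma g_bounds: "n \<ge> 1 \<Longrightarrow> real n / 64 \<le> g n \<and> g n \<le> 24 * real n"
  unfolding g_def using green_zero_le green_zero_ge by blast

lemma g_pos: "n \<ge> 1 \<Longrightarrow> g n > 0"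
  using g_bounds[of n] by (auto intro: less_le_trans[of 0 "real n / 64"])

lemma T_pos: "n \<ge> 1 \<Longrightarrow> T n > 0"
  by (simp add: T_def t_w_def)

lemma U_pos: "U n > 0"
  using T_pos[of n] g_pos[of n] by (auto simp: U_def)

lemma Mn_pos: "Mn n > 0"
  using U_pos[of n] by (simp add: Mn_def)

text \<open>The powers of 2 in \<open>t_w\<close> cancel 4^n; since g is of order n, what remains is
  of order n^\<gamma>.\<close>

lemma Mn_eq: 
  assumes "n \<ge> 1"
  shows "Mn n = g n powr \<alpha> * real n powr (\<gamma> - \<alpha>)"
proof -
  have "T n powr \<alpha> = 4 ^ n * real n powr (\<alpha> - \<gamma>)"
  proof -
    have "T n powr \<alpha> = (2 powr (2 * real n / \<alpha>)) powr \<alpha> * (real n powr (1 - \<gamma> / \<alpha>)) powr \<alpha>"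
      by (simp add: T_def t_w_def powr_mult)
    also have "(2 powr (2 * real n / \<alpha>)) powr \<alpha> = 2 powr (2 * real n)"
      using \<alpha> by (simp add: powr_powr)
    also have "\<dots> = (2::real) ^ (2 * n)"
      by (metis of_nat_mult of_nat_numeral powr_realpow zero_less_numeral)
    also have "\<dots> = 4 ^ n" by (simp add: power_mult)
    also have "(real n powr (1 - \<gamma> / \<alpha>)) powr \<alpha> = real n powr (\<alpha> - \<gamma>)"
      using \<alpha> by (simp add: powr_powr left_diff_distrib)
    finally show ?thesis .
  qed
  moreover have "U n powr (- \<alpha>) = g n powr \<alpha> / T n powr \<alpha>"
    using assms g_pos[OF assms] T_pos[OF assms] by (simp add: U_def powr_minus_divide powr_divide)
  ultimately have "Mn n = g n powr \<alpha> / real n powr (\<alpha> - \<gamma>)" by (simp add: Mn_def)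
  also have "\<dots> = g n powr \<alpha> * real n powr (- (\<alpha> - \<gamma>))"
    by (simp only: powr_minus_divide times_divide_eq_right mult_1_right)
  finally show ?thesis by simp
qed

lemma Mn_bounds:
  assumes "n \<ge> 1"
  shows "(1/64) powr \<alpha> * real n powr \<gamma> \<le> Mn n" "Mn n \<le> 24 powr \<alpha> * real n powr \<gamma>"
proof -
  have pw: "(c * real n) powr \<alpha> * real n powr (\<gamma> - \<alpha>) = c powr \<alpha> * real n powr \<gamma>" if "c \<ge> 0" for c
    using that by (simp add: powr_mult mult.assoc flip: powr_add)
  have "((1/64) * real n) powr \<alpha> \<le> g n powr \<alpha>" "g n powr \<alpha> \<le> (24 * real n) powr \<alpha>"
    using g_bounds[OF assms] g_pos[OF assms] \<alpha> by (auto intro!: powr_mono2)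
  then have "((1/64) * real n) powr \<alpha> * real n powr (\<gamma> - \<alpha>) \<le> Mn n"
    "Mn n \<le> (24 * real n) powr \<alpha> * real n powr (\<gamma> - \<alpha>)"
    unfolding Mn_eq[OF assms] by (auto intro: mult_right_mono)
  moreover have "((1/64) * real n) powr \<alpha> * real n powr (\<gamma> - \<alpha>) = (1/64) powr \<alpha> * real n powr \<gamma>"
    by (rule pw) simp
  moreover have "(24 * real n) powr \<alpha> * real n powr (\<gamma> - \<alpha>) = 24 powr \<alpha> * real n powr \<gamma>"
    by (rule pw) simp
  ultimately show "(1/64) powr \<alpha> * real n powr \<gamma> \<le> Mn n" "Mn n \<le> 24 powr \<alpha> * real n powr \<gamma>"
    by linarith+
qed

text \<open>It is enough that T \<ge> 2^n n. Here T is n times the power 1/\<alpha> of 4^n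
  n^(-\<gamma>), which is at least 2^n because n^\<gamma> \<le> 2^n, and 1/\<alpha> \<ge> 1.
  Dividing by g \<le> 24n leaves 2^n / 24.\<close>

lemma U_at_top: "filterlim U at_top sequentially"
proof (rule filterlim_at_top_mono)
  show "filterlim (\<lambda>n. (1 / 24) * real n) at_top sequentially"
    by (rule filterlim_tendsto_pos_mult_at_top[OF tendsto_const _ filterlim_real_sequentially]) simp
  show "eventually (\<lambda>n. (1 / 24) * real n \<le> U n) sequentially"
    using eventually_ge_at_top[of 1]
  proof eventually_elim
    case (elim n)
    have "real n powr \<gamma> \<le> real n powr 1" using elim \<gamma> by (intro powr_mono) auto
    also have n2: "real n powr 1 \<le> 2 ^ n" using elim of_nat_less_two_power[of n, where 'a = real] by simp
    finally have "real n powr \<gamma> \<le> 2 ^ n" .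
    then have "2 ^ n * real n powr \<gamma> \<le> 2 ^ n * 2 ^ n" by (intro mult_left_mono) auto
    also have "\<dots> = (4::real) ^ n" by (simp flip: power_mult_distrib)
    finally have "2 ^ n \<le> 4 ^ n * real n powr (- \<gamma>)"
      using elim by (simp add: powr_minus_divide field_simps)
    then have "(2 ^ n) powr (1 / \<alpha>) \<le> (4 ^ n * real n powr (- \<gamma>)) powr (1 / \<alpha>)"
      using \<alpha> by (intro powr_mono2) auto
    moreover have "(2::real) ^ n \<le> (2 ^ n) powr (1 / \<alpha>)"
    proof -
      have "((2::real) ^ n) powr 1 \<le> (2 ^ n) powr (1 / \<alpha>)" using \<alpha> by (intro powr_mono) auto
      then show ?thesis by simp
    qed
    moreover have "(4 ^ n * real n powr (- \<gamma>)) powr (1 / \<alpha>) * real n = T n"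
    proof -
      have "(4 ^ n * real n powr (- \<gamma>)) powr (1 / \<alpha>) = 2 powr (2 * real n / \<alpha>) * real n powr (- \<gamma> / \<alpha>)"
      proof -
        have "(4::real) ^ n = 2 powr (2 * real n)"
        proof -
          have "(2::real) powr (2 * real n) = 2 ^ (2 * n)"
            by (metis of_nat_mult of_nat_numeral powr_realpow zero_less_numeral)
          then show ?thesis by (simp add: power_mult)
        qed
        then show ?thesis by (simp add: powr_mult powr_powr)
      qed
      moreover have "real n powr (- \<gamma> / \<alpha>) * real n = real n powr (1 - \<gamma> / \<alpha>)"
        using elim by (simp add: powr_diff powr_minus_divide)
      ultimately show ?thesis by (simp add: T_def t_w_def mult.assoc)
    qed
    ultimately have "2 ^ n * real n \<le> T n"
      by (metis mult_right_mono of_nat_0_le_iff order_trans)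
    then have "2 ^ n * real n / (24 * real n) \<le> T n / g n"
      using g_bounds[of n] g_pos[of n] T_pos[of n] elim by (intro frac_le) auto
    then have "(1 / 24) * 2 ^ n \<le> U n" using elim by (simp add: U_def)
    moreover have "real n \<le> 2 ^ n" using n2 elim by simp
    ultimately show ?case by linarith
  qed
qed

lemma summable_exp_Mn: "c > 0 \<Longrightarrow> summable (\<lambda>n. exp (- (c * Mn n)))"
proof (rule summable_comparison_test_ev)
  assume c: "c > 0"
  show "summable (\<lambda>n. exp (- ((c * (1/64) powr \<alpha>) * real n powr \<gamma>)))"
    using c \<gamma> by (intro summable_exp_neg_powr) auto
  show "eventually (\<lambda>n. norm (exp (- (c * Mn n))) \<le> exp (- ((c * (1/64) powr \<alpha>) * real n powr \<gamma>))) sequentially"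
    using eventually_ge_at_top[of 1]
    by eventually_elim (use c Mn_bounds(1) in \<open>simp add: mult.assoc\<close>)
qed

definition D :: "real measure" where "D = distr M borel (\<lambda>\<omega>. \<tau> \<omega> (0,0))"

lemma expectation_comp:
  fixes f :: "real \<Rightarrow> real"
  assumes [measurable]: "f \<in> borel_measurable borel"
  shows "expectation (\<lambda>\<omega>. f (\<tau> \<omega> x)) = (\<integral>t. f t \<partial>D)"
proof -
  have "(\<integral>t. f t \<partial>distr M borel (\<lambda>\<omega>. \<tau> \<omega> x)) = expectation (\<lambda>\<omega>. f (\<tau> \<omega> x))"
    by (subst integral_distr) auto
  then show ?thesis unfolding D_def \<tau>_distr[of x] ..
qed

text \<open>Admissible test functions of the rescaled depth \<open>\<tau>/U\<close>, with \<open>L\<close> the limit of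
  the rescaled mean.\<close>

definition test_fun :: "(real \<Rightarrow> real) \<Rightarrow> real \<Rightarrow> bool" where
  "test_fun \<Phi> L \<longleftrightarrow> (\<forall>x y. x \<le> y \<longrightarrow> \<Phi> x \<le> \<Phi> y) \<and> (\<forall>a. continuous (at_right a) \<Phi>) \<and>
    (\<forall>x\<le>0. \<Phi> x = 0) \<and> (\<forall>x. \<Phi> x \<le> 1) \<and> L \<ge> 0 \<and>
    (\<integral>\<^sup>+z. ennreal (indicator {0..} z * (\<Phi> (1 / z) * (\<alpha> * z powr (\<alpha> - 1)))) \<partial>lborel) = ennreal L"

lemma test_fun_nonneg: "test_fun \<Phi> L \<Longrightarrow> \<Phi> x \<ge> 0"
  unfolding test_fun_def by (metis linear)

lemma test_fun_measurable: "test_fun \<Phi> L \<Longrightarrow> \<Phi> \<in> borel_measurable borel"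
  unfolding test_fun_def by (intro borel_measurable_mono monoI) auto

lemma mean_tendsto:
  assumes "test_fun \<Phi> L"
  shows "(\<lambda>n. U n powr \<alpha> * (\<integral>t. \<Phi> (t / U n) \<partial>D)) \<longlonglongrightarrow> L"
proof (rule regularly_varying_mean_tendsto)
  show "prob_space D" unfolding D_def by (rule prob_space_distr) measurable
  show "sets D = sets borel" by (simp add: D_def)
  have "measure D {u..} = measure M {\<omega>\<in>space M. \<tau> \<omega> (0,0) \<ge> u}" for u
    unfolding D_def by (subst measure_distr) (auto intro!: arg_cong[where f = prob])
  then show "((\<lambda>u. u powr \<alpha> * measure D {u..}) \<longlongrightarrow> 1) at_top" using \<tau>_tail by simp
qed (use assms \<alpha> U_pos U_at_top in \<open>auto simp: test_fun_def\<close>)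

lemma mean_bounded:
  assumes "test_fun \<Phi> L"
  obtains C where "C > 0" "\<And>n. (\<integral>t. \<Phi> (t / U n) \<partial>D) \<le> C * Mn n / 4 ^ n"
proof -
  have "Bseq (\<lambda>n. U n powr \<alpha> * (\<integral>t. \<Phi> (t / U n) \<partial>D))"
    using mean_tendsto[OF assms] by (intro convergent_imp_Bseq convergentI)
  then obtain C where C: "C > 0" "\<And>n. \<bar>U n powr \<alpha> * (\<integral>t. \<Phi> (t / U n) \<partial>D)\<bar> \<le> C"
    unfolding Bseq_def by auto
  have "(\<integral>t. \<Phi> (t / U n) \<partial>D) \<le> C * Mn n / 4 ^ n" for n
  proof -
    have "U n powr \<alpha> * (\<integral>t. \<Phi> (t / U n) \<partial>D) \<le> C" using C(2)[of n] by linarith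
    moreover have "Mn n / 4 ^ n = 1 / U n powr \<alpha>" by (simp add: Mn_def powr_minus_divide)
    moreover have "U n powr \<alpha> > 0" using U_pos[of n] by simp
    ultimately show ?thesis
      by (metis (no_types, lifting) mult.commute mult_1_right pos_le_divide_eq times_divide_eq_right)
  qed
  then show ?thesis using that C(1) by blast
qed

text \<open>\<open>Mn n\<close> grows like n^\<gamma>, so the deviation probabilities exp(-c Mn)
  from \<open>chernoff_bound\<close> are summable, and Borel-Cantelli applies to each \<epsilon> =
  1/(j+1).\<close>

lemma lln:
  assumes tf: "test_fun \<Phi> L"
  shows "AE \<omega> in M. (\<lambda>n. (\<Sum>x\<in>torus n. \<Phi> (\<tau> \<omega> x / U n)) / Mn n) \<longlonglongrightarrow> L"
proof -
  note [measurable] = test_fun_measurable[OF tf]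
  obtain C where C: "C > 0" "\<And>n. (\<integral>t. \<Phi> (t / U n) \<partial>D) \<le> C * Mn n / 4 ^ n"
    by (rule mean_bounded[OF tf]) auto
  have E: "expectation (\<lambda>\<omega>. \<Phi> (\<tau> \<omega> x / U n)) = (\<integral>t. \<Phi> (t / U n) \<partial>D)" for x n
    by (rule expectation_comp[where f = "\<lambda>t. \<Phi> (t / U n)"]) measurable
  define \<mu> where "\<mu> = (\<lambda>n. \<Sum>x\<in>torus n. expectation (\<lambda>\<omega>. \<Phi> (\<tau> \<omega> x / U n)))"
  have \<mu>_eq: "\<mu> n = 4 ^ n * (\<integral>t. \<Phi> (t / U n) \<partial>D)" for n
    unfolding \<mu>_def E by (simp add: card_torus)
  have \<mu>_le: "\<mu> n \<le> C * Mn n" for n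
    using C(2)[of n] by (simp add: \<mu>_eq field_simps)
  have \<mu>_lim: "(\<lambda>n. \<mu> n / Mn n) \<longlonglongrightarrow> L"
  proof -
    have "\<mu> n / Mn n = U n powr \<alpha> * (\<integral>t. \<Phi> (t / U n) \<partial>D)" for n
      using U_pos[of n] by (simp add: \<mu>_eq Mn_def powr_minus_divide)
    then show ?thesis using mean_tendsto[OF tf] by simp
  qed
  define Bad where "Bad = (\<lambda>\<epsilon> n. {\<omega>\<in>space M. \<bar>(\<Sum>x\<in>torus n. \<Phi> (\<tau> \<omega> x / U n)) - \<mu> n\<bar> \<ge> \<epsilon> * Mn n})"
  have "AE \<omega> in M. eventually (\<lambda>n. \<omega> \<in> space M - Bad \<epsilon> n) sequentially" if e: "\<epsilon> > 0" for \<epsilon>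
  proof (rule borel_cantelli_AE1)
    show "Bad \<epsilon> n \<in> sets M" for n unfolding Bad_def by measurable
    show "emeasure M (Bad \<epsilon> n) < \<infinity>" for n by (simp add: less_top[symmetric])
    define c where "c = min 1 (\<epsilon> / (2 * C)) * \<epsilon> / 2"
    have c: "c > 0" using e C by (simp add: c_def)
    have "prob (Bad \<epsilon> n) \<le> 2 * exp (- (c * Mn n))" for n
      unfolding Bad_def \<mu>_def c_def
    proof (rule chernoff_bound)
      show "indep_vars (\<lambda>_. borel) (\<lambda>x \<omega>. \<Phi> (\<tau> \<omega> x / U n)) (torus n)"
        by (rule indep_vars_compose2[OF indep_vars_subset[OF \<tau>_indep]]) auto
      show "(\<Sum>x\<in>torus n. expectation (\<lambda>\<omega>. \<Phi> (\<tau> \<omega> x / U n))) \<le> C * Mn n"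
        using \<mu>_le[of n] by (simp add: \<mu>_def)
    qed (use C e Mn_pos[of n] tf test_fun_nonneg[OF tf] in \<open>auto simp: test_fun_def\<close>)
    then show "summable (\<lambda>n. prob (Bad \<epsilon> n))"
      by (intro summable_comparison_test'[OF summable_mult[OF summable_exp_Mn[OF c], of 2], of 0]) auto
  qed
  then have "AE \<omega> in M. \<forall>j. eventually (\<lambda>n. \<omega> \<in> space M - Bad (1 / real (Suc j)) n) sequentially"
    by (subst AE_all_countable) auto
  then show ?thesis
  proof eventually_elim
    case (elim \<omega>)
    have "(\<lambda>n. (\<Sum>x\<in>torus n. \<Phi> (\<tau> \<omega> x / U n)) / Mn n - \<mu> n / Mn n) \<longlonglongrightarrow> 0"
    proof (rule tendstoI)
      fix e :: real assume "e > 0"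
      then obtain j where j: "1 / real (Suc j) < e" using nat_approx_posE by blast
      from elim[rule_format, of j]
      show "eventually (\<lambda>n. dist ((\<Sum>x\<in>torus n. \<Phi> (\<tau> \<omega> x / U n)) / Mn n - \<mu> n / Mn n) 0 < e) sequentially"
      proof eventually_elim
        case (elim n)
        define s where "s = (\<Sum>x\<in>torus n. \<Phi> (\<tau> \<omega> x / U n))"
        have "\<bar>s - \<mu> n\<bar> < 1 / real (Suc j) * Mn n" using elim by (auto simp: Bad_def s_def)
        also have "\<dots> \<le> e * Mn n" using j Mn_pos[of n] by (intro mult_right_mono) auto
        finally have "\<bar>s - \<mu> n\<bar> / Mn n < e" using Mn_pos[of n] by (simp add: pos_divide_less_eq)
        moreover have "s / Mn n - \<mu> n / Mn n = (s - \<mu> n) / Mn n" by (simp add: diff_divide_distrib)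
        ultimately show ?case using Mn_pos[of n] by (simp add: s_def)
      qed
    qed
    from tendsto_add[OF this \<mu>_lim] show ?case by simp
  qed
qed

text \<open>Chebyshev for the counting measure: each near site contributes at least b^2 = n^(3/2) to
  the sum of the squared kernel.\<close>

lemma card_nearset_le:
  assumes "n \<ge> 1" "x \<in> torus n"
  shows "real (card (nearset n x)) \<le> 50 * 4 ^ n * real n powr (- 3 / 2)"
proof -
  have bsq: "(b n)\<^sup>2 = real n powr (3 / 2)"
    by (simp add: b_def power2_eq_square flip: powr_add)
  have "real (card (nearset n x)) * (b n)\<^sup>2 = (\<Sum>z\<in>nearset n x. (b n)\<^sup>2)" by simp
  also have "\<dots> \<le> (\<Sum>z\<in>nearset n x. (green n (x - z))\<^sup>2)"
  proof (rule sum_mono)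
    fix z assume "z \<in> nearset n x"
    then have "b n \<le> \<bar>green n (x - z)\<bar>" by (auto simp: nearset_def)
    then have "(b n)\<^sup>2 \<le> \<bar>green n (x - z)\<bar>\<^sup>2" by (intro power_mono) (auto simp: b_def)
    then show "(b n)\<^sup>2 \<le> (green n (x - z))\<^sup>2" by simp
  qed
  also have "\<dots> \<le> (\<Sum>z\<in>torus n. (green n (x - z))\<^sup>2)"
    by (intro sum_mono2) (auto simp: nearset_def)
  also have "\<dots> = (\<Sum>z\<in>torus n. (green n (wrap n (x - z)))\<^sup>2)" by (simp add: green_wrap)
  also have "\<dots> = (\<Sum>z\<in>torus n. (green n z)\<^sup>2)" by (rule sum_torus_reflect[where f = "\<lambda>z. (green n z)\<^sup>2"])
  also have "\<dots> \<le> 50 * 4 ^ n" by (rule sum_green_sq_le)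
  finally have "real (card (nearset n x)) * real n powr (3 / 2) \<le> 50 * 4 ^ n" by (simp add: bsq)
  then show ?thesis using assms by (simp add: powr_minus_divide field_simps)
qed

text \<open>The squared trap number n^(2\<gamma>) against the fraction n^(-3/2) of near sites: the
  resulting exponent is below -1.\<close>

lemma summable_Mn_sq: "summable (\<lambda>n. C * (Mn n)\<^sup>2 * real n powr (- 3 / 2))"
proof (rule summable_comparison_test_ev)
  show "summable (\<lambda>n. (\<bar>C\<bar> * (24 powr \<alpha>)\<^sup>2) * real n powr (2 * \<gamma> - 3 / 2))"
    using \<gamma> by (intro summable_mult) (simp add: summable_real_powr_iff)
  show "eventually (\<lambda>n. norm (C * (Mn n)\<^sup>2 * real n powr (- 3 / 2)) \<le> (\<bar>C\<bar> * (24 powr \<alpha>)\<^sup>2) * real n powr (2 * \<gamma> - 3 / 2)) sequentially"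
    using eventually_ge_at_top[of 1]
  proof eventually_elim
    case (elim n)
    have "(Mn n)\<^sup>2 \<le> (24 powr \<alpha> * real n powr \<gamma>)\<^sup>2"
      using Mn_bounds(2)[OF elim] Mn_pos[of n] by (intro power_mono) auto
    also have "\<dots> = (24 powr \<alpha>)\<^sup>2 * real n powr (2 * \<gamma>)"
      by (simp only: power_mult_distrib power2_eq_square[of "real n powr \<gamma>"] powr_add[symmetric] mult_2)
    finally have "\<bar>C\<bar> * (Mn n)\<^sup>2 * real n powr (- 3 / 2) \<le> \<bar>C\<bar> * ((24 powr \<alpha>)\<^sup>2 * real n powr (2 * \<gamma>)) * real n powr (- 3 / 2)"
      by (intro mult_right_mono mult_left_mono) auto
    also have "\<dots> = (\<bar>C\<bar> * (24 powr \<alpha>)\<^sup>2) * real n powr (2 * \<gamma> - 3 / 2)"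
      by (simp add: mult.assoc flip: powr_add)
    finally show ?case by (simp add: abs_mult)
  qed
qed

text \<open>Independence gives the mean e^2 for two distinct sites, and 4^n e is of order
  \<open>Mn n\<close>. In the second claim the extra factor \<open>Mn n\<close> is the order of gK,
  which multiplies the near sites of the starting point in \<open>G_offdiag_approx\<close>.\<close>

lemma near_pairs_tendsto_0:
  assumes tf: "test_fun \<Psi> L"
  shows "AE \<omega> in M. (\<lambda>n. \<Sum>x\<in>torus n. \<Sum>z\<in>nearset n x. \<Psi> (\<tau> \<omega> x / U n) * \<Psi> (\<tau> \<omega> z / U n)) \<longlonglongrightarrow> 0"
    and "AE \<omega> in M. (\<lambda>n. Mn n * (\<Sum>z\<in>nearset n (0,0). \<Psi> (\<tau> \<omega> z / U n))) \<longlonglongrightarrow> 0"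
proof -
  note [measurable] = test_fun_measurable[OF tf]
  obtain C where C: "C > 0" "\<And>n. (\<integral>t. \<Psi> (t / U n) \<partial>D) \<le> C * Mn n / 4 ^ n"
    by (rule mean_bounded[OF tf]) auto
  define e where "e = (\<lambda>n. \<integral>t. \<Psi> (t / U n) \<partial>D)"
  have e0: "e n \<ge> 0" for n unfolding e_def using test_fun_nonneg[OF tf] by simp
  have e_le: "e n \<le> C * Mn n / 4 ^ n" for n using C by (simp add: e_def)
  have E: "expectation (\<lambda>\<omega>. \<Psi> (\<tau> \<omega> x / U n)) = e n" for x n
    unfolding e_def by (rule expectation_comp[where f = "\<lambda>t. \<Psi> (t / U n)"]) measurable
  have \<Psi>1: "\<Psi> x \<le> 1" and \<Psi>0: "\<Psi> x \<ge> 0" for x using tf test_fun_nonneg[OF tf] by (auto simp: test_fun_def)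
  have int: "integrable M (\<lambda>\<omega>. \<Psi> (\<tau> \<omega> x / U n))" for x n
    using \<Psi>1 \<Psi>0 by (intro integrable_const_bound[where B = 1]) auto
  have pair: "integrable M (\<lambda>\<omega>. \<Psi> (\<tau> \<omega> x / U n) * \<Psi> (\<tau> \<omega> z / U n))"
    "expectation (\<lambda>\<omega>. \<Psi> (\<tau> \<omega> x / U n) * \<Psi> (\<tau> \<omega> z / U n)) = e n * e n" if "x \<noteq> z" for x z n
  proof -
    have ind: "indep_vars (\<lambda>_. borel) (\<lambda>x \<omega>. \<Psi> (\<tau> \<omega> x / U n)) {x, z}"
      by (rule indep_vars_compose2[OF indep_vars_subset[OF \<tau>_indep]]) auto
    have eq: "\<Psi> (\<tau> \<omega> x / U n) * \<Psi> (\<tau> \<omega> z / U n) = (\<Prod>i\<in>{x, z}. \<Psi> (\<tau> \<omega> i / U n))" for \<omega>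
      using that by simp
    show "integrable M (\<lambda>\<omega>. \<Psi> (\<tau> \<omega> x / U n) * \<Psi> (\<tau> \<omega> z / U n))"
      unfolding eq by (rule indep_vars_integrable[OF _ ind int]) auto
    have "expectation (\<lambda>\<omega>. \<Psi> (\<tau> \<omega> x / U n) * \<Psi> (\<tau> \<omega> z / U n))
        = (\<Prod>i\<in>{x, z}. expectation (\<lambda>\<omega>. \<Psi> (\<tau> \<omega> i / U n)))"
      unfolding eq by (rule indep_vars_lebesgue_integral[OF _ ind int]) auto
    then show "expectation (\<lambda>\<omega>. \<Psi> (\<tau> \<omega> x / U n) * \<Psi> (\<tau> \<omega> z / U n)) = e n * e n"
      using that by (simp add: E)
  qed
  have near_ne: "z \<in> nearset n x \<Longrightarrow> x \<noteq> z" for n x z by (auto simp: nearset_def)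
  have sq_le: "4 ^ n * (e n) \<le> C * Mn n" for n using e_le[of n] by (simp add: field_simps)
  show "AE \<omega> in M. (\<lambda>n. \<Sum>x\<in>torus n. \<Sum>z\<in>nearset n x. \<Psi> (\<tau> \<omega> x / U n) * \<Psi> (\<tau> \<omega> z / U n)) \<longlonglongrightarrow> 0"
  proof (rule AE_tendsto_0_summable)
    show "integrable M (\<lambda>\<omega>. \<Sum>x\<in>torus n. \<Sum>z\<in>nearset n x. \<Psi> (\<tau> \<omega> x / U n) * \<Psi> (\<tau> \<omega> z / U n))" for n
      by (intro Bochner_Integration.integrable_sum pair near_ne)
    show "summable (\<lambda>n. expectation (\<lambda>\<omega>. \<Sum>x\<in>torus n. \<Sum>z\<in>nearset n x. \<Psi> (\<tau> \<omega> x / U n) * \<Psi> (\<tau> \<omega> z / U n)))"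
    proof (rule summable_comparison_test_ev[OF _ summable_Mn_sq[of "50 * C\<^sup>2"]])
      show "eventually (\<lambda>n. norm (expectation (\<lambda>\<omega>. \<Sum>x\<in>torus n. \<Sum>z\<in>nearset n x. \<Psi> (\<tau> \<omega> x / U n) * \<Psi> (\<tau> \<omega> z / U n)))
         \<le> 50 * C\<^sup>2 * (Mn n)\<^sup>2 * real n powr (- 3 / 2)) sequentially"
        using eventually_ge_at_top[of 1]
      proof eventually_elim
        case (elim n)
        have "expectation (\<lambda>\<omega>. \<Sum>x\<in>torus n. \<Sum>z\<in>nearset n x. \<Psi> (\<tau> \<omega> x / U n) * \<Psi> (\<tau> \<omega> z / U n))
          = (\<Sum>x\<in>torus n. expectation (\<lambda>\<omega>. \<Sum>z\<in>nearset n x. \<Psi> (\<tau> \<omega> x / U n) * \<Psi> (\<tau> \<omega> z / U n)))"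
          by (intro Bochner_Integration.integral_sum Bochner_Integration.integrable_sum pair near_ne)
        also have "\<dots> = (\<Sum>x\<in>torus n. \<Sum>z\<in>nearset n x. e n * e n)"
        proof (rule sum.cong[OF refl])
          fix x
          have "expectation (\<lambda>\<omega>. \<Sum>z\<in>nearset n x. \<Psi> (\<tau> \<omega> x / U n) * \<Psi> (\<tau> \<omega> z / U n))
            = (\<Sum>z\<in>nearset n x. expectation (\<lambda>\<omega>. \<Psi> (\<tau> \<omega> x / U n) * \<Psi> (\<tau> \<omega> z / U n)))"
            by (intro Bochner_Integration.integral_sum pair near_ne)
          then show "expectation (\<lambda>\<omega>. \<Sum>z\<in>nearset n x. \<Psi> (\<tau> \<omega> x / U n) * \<Psi> (\<tau> \<omega> z / U n)) = (\<Sum>z\<in>nearset n x. e n * e n)"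
            using pair(2) near_ne by simp
        qed
        also have "\<dots> = (\<Sum>x\<in>torus n. real (card (nearset n x)) * (e n * e n))" by simp
        also have "\<dots> \<le> (\<Sum>x\<in>torus n. 50 * 4 ^ n * real n powr (- 3 / 2) * (e n * e n))"
          using card_nearset_le[OF elim] e0 by (intro sum_mono mult_right_mono) auto
        also have "\<dots> = 50 * real n powr (- 3 / 2) * ((4 ^ n * e n) * (4 ^ n * e n))"
          by (simp add: card_torus)
        also have "\<dots> \<le> 50 * real n powr (- 3 / 2) * ((C * Mn n) * (C * Mn n))"
        proof (rule mult_left_mono)
          show "(4 ^ n * e n) * (4 ^ n * e n) \<le> (C * Mn n) * (C * Mn n)"
            using e0 C Mn_pos[of n] by (intro mult_mono[OF sq_le sq_le]) auto
        qed simp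
        also have "\<dots> = 50 * C\<^sup>2 * (Mn n)\<^sup>2 * real n powr (- 3 / 2)"
          by (simp add: power2_eq_square)
        finally show ?case
          using \<Psi>0 by (subst real_norm_def, subst abs_of_nonneg)
            (auto intro!: Bochner_Integration.integral_nonneg sum_nonneg)
      qed
    qed
  qed (use \<Psi>0 in \<open>auto intro!: sum_nonneg\<close>)
  show "AE \<omega> in M. (\<lambda>n. Mn n * (\<Sum>z\<in>nearset n (0,0). \<Psi> (\<tau> \<omega> z / U n))) \<longlonglongrightarrow> 0"
  proof (rule AE_tendsto_0_summable)
    show "integrable M (\<lambda>\<omega>. Mn n * (\<Sum>z\<in>nearset n (0,0). \<Psi> (\<tau> \<omega> z / U n)))" for n
      by (intro integrable_mult_right Bochner_Integration.integrable_sum int)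
    show "summable (\<lambda>n. expectation (\<lambda>\<omega>. Mn n * (\<Sum>z\<in>nearset n (0,0). \<Psi> (\<tau> \<omega> z / U n))))"
    proof (rule summable_comparison_test_ev[OF _ summable_Mn_sq[of "50 * C"]])
      show "eventually (\<lambda>n. norm (expectation (\<lambda>\<omega>. Mn n * (\<Sum>z\<in>nearset n (0,0). \<Psi> (\<tau> \<omega> z / U n))))
         \<le> 50 * C * (Mn n)\<^sup>2 * real n powr (- 3 / 2)) sequentially"
        using eventually_ge_at_top[of 1]
      proof eventually_elim
        case (elim n)
        have "expectation (\<lambda>\<omega>. Mn n * (\<Sum>z\<in>nearset n (0,0). \<Psi> (\<tau> \<omega> z / U n)))
            = Mn n * (\<Sum>z\<in>nearset n (0,0). expectation (\<lambda>\<omega>. \<Psi> (\<tau> \<omega> z / U n)))"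
          by (simp add: int Bochner_Integration.integral_sum)
        also have "\<dots> = Mn n * (real (card (nearset n (0,0))) * e n)" by (simp add: E)
        also have "\<dots> \<le> Mn n * ((50 * 4 ^ n * real n powr (- 3 / 2)) * e n)"
          using card_nearset_le[OF elim, of "(0,0)"] e0 Mn_pos[of n]
          by (intro mult_left_mono mult_right_mono) auto
        also have "\<dots> = 50 * Mn n * real n powr (- 3 / 2) * (4 ^ n * e n)" by simp
        also have "\<dots> \<le> 50 * Mn n * real n powr (- 3 / 2) * (C * Mn n)"
          using sq_le Mn_pos[of n] by (intro mult_left_mono) auto
        also have "\<dots> = 50 * C * (Mn n)\<^sup>2 * real n powr (- 3 / 2)" by (simp add: power2_eq_square)
        finally have "expectation (\<lambda>\<omega>. Mn n * (\<Sum>z\<in>nearset n (0,0). \<Psi> (\<tau> \<omega> z / U n)))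
            \<le> 50 * C * (Mn n)\<^sup>2 * real n powr (- 3 / 2)" .
        moreover have "0 \<le> expectation (\<lambda>\<omega>. Mn n * (\<Sum>z\<in>nearset n (0,0). \<Psi> (\<tau> \<omega> z / U n)))"
          by (intro Bochner_Integration.integral_nonneg mult_nonneg_nonneg sum_nonneg \<Psi>0 less_imp_le[OF Mn_pos])
        ultimately show ?case by (simp only: real_norm_def abs_of_nonneg)
      qed
    qed
  qed (intro mult_nonneg_nonneg sum_nonneg \<Psi>0 less_imp_le[OF Mn_pos])
qed

end

subsection \<open>The limiting Laplace transforms and the arcsine law\<close>

lemma nn_integral_cmult_eq:
  assumes "f \<in> borel_measurable M" "integral\<^sup>N M f = I"
  shows "(\<integral>\<^sup>+x. c * f x \<partial>M) = c * I"
  using assms by (simp add: nn_integral_cmult)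

lemma Gamma_nn_integral_scaled:
  assumes "s > 0" "x > 0"
  shows "(\<integral>\<^sup>+z. ennreal (indicator {0..} z * (exp (- (x * z)) * z powr (s - 1))) \<partial>lborel)
    = ennreal (Gamma s * x powr (- s))"
proof -
  define I where "I = (\<integral>\<^sup>+z. ennreal (indicator {0..} z * (exp (- (x * z)) * z powr (s - 1))) \<partial>lborel)"
  have "ennreal (Gamma s) = (\<integral>\<^sup>+t. ennreal (indicator {0..} t * t powr (s - 1) / exp t) \<partial>lborel)"
    by (rule Gamma_conv_nn_integral_real[OF assms(1)])
  also have "\<dots> = ennreal \<bar>x\<bar> * (\<integral>\<^sup>+z. ennreal (indicator {0..} (0 + x * z) * (0 + x * z) powr (s - 1) / exp (0 + x * z)) \<partial>lborel)"
    using assms by (intro nn_integral_real_affine) auto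
  also have "(\<integral>\<^sup>+z. ennreal (indicator {0..} (0 + x * z) * (0 + x * z) powr (s - 1) / exp (0 + x * z)) \<partial>lborel)
     = (\<integral>\<^sup>+z. ennreal (x powr (s - 1)) * ennreal (indicator {0..} z * (exp (- (x * z)) * z powr (s - 1))) \<partial>lborel)"
  proof (rule nn_integral_cong)
    fix z :: real
    have "indicator {0..} (0 + x * z) * (0 + x * z) powr (s - 1) / exp (0 + x * z)
       = x powr (s - 1) * (indicator {0..} z * (exp (- (x * z)) * z powr (s - 1)))"
      using assms by (auto simp: indicator_def powr_mult exp_minus field_simps zero_le_mult_iff)
    then show "ennreal (indicator {0..} (0 + x * z) * (0 + x * z) powr (s - 1) / exp (0 + x * z))
       = ennreal (x powr (s - 1)) * ennreal (indicator {0..} z * (exp (- (x * z)) * z powr (s - 1)))"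
      by (simp add: ennreal_mult')
  qed
  also have "\<dots> = ennreal (x powr (s - 1)) * I"
    unfolding I_def by (rule nn_integral_cmult) measurable
  finally have "ennreal (x powr (- s)) * ennreal (Gamma s)
      = ennreal (x powr (- s)) * (ennreal \<bar>x\<bar> * (ennreal (x powr (s - 1)) * I))" by simp
  also have "\<dots> = ennreal (x powr (- s) * x * x powr (s - 1)) * I"
    using assms by (simp add: ennreal_mult mult.assoc)
  also have "x powr (- s) * x * x powr (s - 1) = 1"
    using assms by (simp add: powr_minus powr_diff field_simps)
  finally have "I = ennreal (x powr (- s)) * ennreal (Gamma s)" by simp
  also have "\<dots> = ennreal (Gamma s * x powr (- s))"
    using Gamma_real_pos[OF assms(1)] by (simp add: ennreal_mult'[symmetric] mult.commute)
  finally show ?thesis by (simp add: I_def)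
qed

text \<open>Writing 1/(z+a) as the integral of exp(-(z+a)s) and exchanging leaves two Gamma
  integrals. The factor \<open>s powr (1 - 1)\<close> preserves their shape; it is 1 for s > 0 and 0
  at s = 0.\<close>

lemma nn_integral_Stieltjes:
  assumes \<alpha>: "0 < \<alpha>" "\<alpha> < 1" and a: "a > 0"
  shows "(\<integral>\<^sup>+z. ennreal (indicator {0..} z * (1 / (z + a) * (\<alpha> * z powr (\<alpha> - 1)))) \<partial>lborel)
    = ennreal (\<alpha> * Gamma \<alpha> * Gamma (1 - \<alpha>) * a powr (\<alpha> - 1))"
proof -
  have "(\<integral>\<^sup>+z. ennreal (indicator {0..} z * (1 / (z + a) * (\<alpha> * z powr (\<alpha> - 1)))) \<partial>lborel)
     = (\<integral>\<^sup>+z. (\<integral>\<^sup>+s. ennreal (indicator {0..} z * (\<alpha> * z powr (\<alpha> - 1))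
          * (indicator {0..} s * (exp (- ((z + a) * s)) * s powr (1 - 1)))) \<partial>lborel) \<partial>lborel)"
  proof (rule nn_integral_cong)
    fix z :: real
    show "ennreal (indicator {0..} z * (1 / (z + a) * (\<alpha> * z powr (\<alpha> - 1)))) =
      (\<integral>\<^sup>+s. ennreal (indicator {0..} z * (\<alpha> * z powr (\<alpha> - 1))
          * (indicator {0..} s * (exp (- ((z + a) * s)) * s powr (1 - 1)))) \<partial>lborel)"
    proof (cases "z \<ge> 0")
      case True
      have "(\<integral>\<^sup>+s. ennreal (indicator {0..} z * (\<alpha> * z powr (\<alpha> - 1))
          * (indicator {0..} s * (exp (- ((z + a) * s)) * s powr (1 - 1)))) \<partial>lborel)
        = (\<integral>\<^sup>+s. ennreal (\<alpha> * z powr (\<alpha> - 1))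
          * ennreal (indicator {0..} s * (exp (- ((z + a) * s)) * s powr (1 - 1))) \<partial>lborel)"
        using True \<alpha> by (intro nn_integral_cong) (simp add: ennreal_mult')
      also have "\<dots> = ennreal (\<alpha> * z powr (\<alpha> - 1)) * ennreal (Gamma 1 * (z + a) powr (- 1))"
      proof -
        have "z + a > 0" using True a by simp
        then show ?thesis
          by (intro nn_integral_cmult_eq[OF _ Gamma_nn_integral_scaled]) auto
      qed
      also have "\<dots> = ennreal (1 / (z + a) * (\<alpha> * z powr (\<alpha> - 1)))"
        using True a \<alpha> by (simp add: ennreal_mult[symmetric] powr_minus_divide)
      finally show ?thesis using True by simp
    qed simp
  qed
  also have "\<dots> = (\<integral>\<^sup>+s. (\<integral>\<^sup>+z. ennreal (indicator {0..} z * (\<alpha> * z powr (\<alpha> - 1))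
          * (indicator {0..} s * (exp (- ((z + a) * s)) * s powr (1 - 1)))) \<partial>lborel) \<partial>lborel)"
    by (rule lborel_pair.Fubini') measurable
  also have "\<dots> = (\<integral>\<^sup>+s. ennreal (\<alpha> * Gamma \<alpha>) * ennreal (indicator {0..} s * (exp (- (a * s)) * s powr ((1 - \<alpha>) - 1))) \<partial>lborel)"
  proof (rule nn_integral_cong)
    fix s :: real
    show "(\<integral>\<^sup>+z. ennreal (indicator {0..} z * (\<alpha> * z powr (\<alpha> - 1))
          * (indicator {0..} s * (exp (- ((z + a) * s)) * s powr (1 - 1)))) \<partial>lborel)
       = ennreal (\<alpha> * Gamma \<alpha>) * ennreal (indicator {0..} s * (exp (- (a * s)) * s powr ((1 - \<alpha>) - 1)))"
    proof (cases "s > 0")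
      case True
      have "(\<integral>\<^sup>+z. ennreal (indicator {0..} z * (\<alpha> * z powr (\<alpha> - 1))
          * (indicator {0..} s * (exp (- ((z + a) * s)) * s powr (1 - 1)))) \<partial>lborel)
        = (\<integral>\<^sup>+z. ennreal (\<alpha> * exp (- (a * s))) * ennreal (indicator {0..} z * (exp (- (s * z)) * z powr (\<alpha> - 1))) \<partial>lborel)"
      proof (rule nn_integral_cong)
        fix z :: real
        have "exp (- ((z + a) * s)) = exp (- (a * s)) * exp (- (s * z))"
          by (simp add: exp_add[symmetric] algebra_simps)
        then show "ennreal (indicator {0..} z * (\<alpha> * z powr (\<alpha> - 1))
          * (indicator {0..} s * (exp (- ((z + a) * s)) * s powr (1 - 1))))
          = ennreal (\<alpha> * exp (- (a * s))) * ennreal (indicator {0..} z * (exp (- (s * z)) * z powr (\<alpha> - 1)))"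
          using True \<alpha> by (subst ennreal_mult[symmetric]) (auto simp: mult_ac)
      qed
      also have "\<dots> = ennreal (\<alpha> * exp (- (a * s))) * ennreal (Gamma \<alpha> * s powr (- \<alpha>))"
        by (intro nn_integral_cmult_eq[OF _ Gamma_nn_integral_scaled[OF \<alpha>(1) True]]) measurable
      also have "\<dots> = ennreal (\<alpha> * Gamma \<alpha> * (exp (- (a * s)) * s powr ((1 - \<alpha>) - 1)))"
        using \<alpha> Gamma_real_pos[of \<alpha>] by (simp add: ennreal_mult'[symmetric] mult_ac)
      finally show ?thesis using True \<alpha> Gamma_real_pos[of \<alpha>] by (simp add: ennreal_mult')
    next
      case False
      then have "indicator {0..} s = (0::real) \<or> s = 0" by auto
      then show ?thesis by (elim disjE) simp_all
    qed
  qed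
  also have "\<dots> = ennreal (\<alpha> * Gamma \<alpha>) * ennreal (Gamma (1 - \<alpha>) * a powr (- (1 - \<alpha>)))"
  proof -
    have "1 - \<alpha> > 0" using \<alpha> by simp
    then show ?thesis
      by (intro nn_integral_cmult_eq[OF _ Gamma_nn_integral_scaled[OF _ a]]) auto
  qed
  also have "\<dots> = ennreal (\<alpha> * Gamma \<alpha> * Gamma (1 - \<alpha>) * a powr (\<alpha> - 1))"
    using \<alpha> Gamma_real_pos[of \<alpha>] by (simp add: ennreal_mult'[symmetric] mult_ac)
  finally show ?thesis .
qed

lemma nn_integral_ratio_powr:
  assumes \<alpha>: "0 < \<alpha>" and a: "a > 0" and z: "z \<ge> 0"
  shows "(\<integral>\<^sup>+\<rho>. ennreal (indicator {0..1} \<rho> * (\<rho> powr (\<alpha> - 1) * (a + (1 - \<rho>) * z) powr (- (\<alpha> + 1)))) \<partial>lborel)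
    = ennreal (a powr (- \<alpha>) / (\<alpha> * (a + z)))"
proof -
  \<comment> \<open>An antiderivative: \<rho>/(a + (1-\<rho>)z) has derivative (a+z)/(a +
    (1-\<rho>)z)^2, and the chain rule for the power \<alpha> produces the integrand.\<close>
  define F where "F = (\<lambda>\<rho>. (\<rho> / (a + (1 - \<rho>) * z)) powr \<alpha> / (\<alpha> * (a + z)))"
  have d: "a + (1 - \<rho>) * z > 0" if "\<rho> \<le> 1" for \<rho> using that a z by (intro add_pos_nonneg) auto
  have "((\<lambda>\<rho>. \<rho> powr (\<alpha> - 1) * (a + (1 - \<rho>) * z) powr (- (\<alpha> + 1))) has_integral (F 1 - F 0)) {0..1}"
  proof (rule fundamental_theorem_of_calculus_interior)
    show "continuous_on {0..1} F"
      unfolding F_def using d a z \<alpha>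
      by (intro continuous_intros continuous_on_powr') (force intro!: divide_nonneg_pos)+
    fix \<rho> :: real assume \<rho>: "\<rho> \<in> {0<..<1}"
    define e where "e = a + (1 - \<rho>) * z"
    have e: "e > 0" using d \<rho> by (simp add: e_def)
    have az: "a + z > 0" using a z by simp
    have "((\<lambda>\<rho>. \<rho> / (a + (1 - \<rho>) * z)) has_real_derivative (1 * e - \<rho> * (- z)) / (e * e)) (at \<rho>)"
      unfolding e_def using d[of \<rho>] \<rho> by (auto intro!: derivative_eq_intros)
    moreover have "1 * e - \<rho> * (- z) = a + z" by (simp add: e_def algebra_simps)
    ultimately have du: "((\<lambda>\<rho>. \<rho> / (a + (1 - \<rho>) * z)) has_real_derivative (a + z) / (e * e)) (at \<rho>)" by simp
    have "((\<lambda>\<rho>. (\<rho> / (a + (1 - \<rho>) * z)) powr \<alpha>) has_real_derivative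
        \<alpha> * (\<rho> / e) powr (\<alpha> - 1) * ((a + z) / (e * e))) (at \<rho>)"
      using DERIV_fun_powr[OF du, of \<alpha>] \<rho> e by (simp add: e_def)
    then have "(F has_real_derivative \<alpha> * (\<rho> / e) powr (\<alpha> - 1) * ((a + z) / (e * e)) / (\<alpha> * (a + z))) (at \<rho>)"
      unfolding F_def by (rule DERIV_cdivide)
    moreover have "\<alpha> * (\<rho> / e) powr (\<alpha> - 1) * ((a + z) / (e * e)) / (\<alpha> * (a + z)) = \<rho> powr (\<alpha> - 1) * e powr (- (\<alpha> + 1))"
    proof -
      have "(\<rho> / e) powr (\<alpha> - 1) = \<rho> powr (\<alpha> - 1) * e powr (- (\<alpha> - 1))"
        using \<rho> e by (simp add: powr_divide powr_minus_divide del: minus_diff_eq)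
      moreover have "e powr (- (\<alpha> - 1)) / (e * e) = e powr (- (\<alpha> + 1))"
      proof -
        have "e powr (- (\<alpha> + 1)) = e powr (- (\<alpha> - 1) + (- 2))" by (simp add: algebra_simps)
        also have "\<dots> = e powr (- (\<alpha> - 1)) * e powr (- 2)" by (rule powr_add)
        also have "e powr (- 2) = 1 / (e * e)" using e by (simp add: powr_minus_divide power2_eq_square)
        finally show ?thesis by simp
      qed
      moreover have "\<alpha> * R * ((a + z) / (e * e)) / (\<alpha> * (a + z)) = R / (e * e)" for R
        using az \<alpha> by simp
      ultimately show ?thesis by (metis mult.assoc times_divide_eq_right)
    qed
    ultimately show "(F has_vector_derivative \<rho> powr (\<alpha> - 1) * (a + (1 - \<rho>) * z) powr (- (\<alpha> + 1))) (at \<rho>)"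
      by (simp add: has_real_derivative_iff_has_vector_derivative e_def)
  qed simp
  moreover have "F 1 - F 0 = a powr (- \<alpha>) / (\<alpha> * (a + z))"
    using a by (simp add: F_def powr_divide powr_minus_divide)
  ultimately have "((\<lambda>\<rho>. \<rho> powr (\<alpha> - 1) * (a + (1 - \<rho>) * z) powr (- (\<alpha> + 1))) has_integral
      a powr (- \<alpha>) / (\<alpha> * (a + z))) {0..1}" by simp
  from nn_integral_has_integral_lebesgue[OF _ this] show ?thesis by simp
qed

text \<open>\<open>ladder \<alpha> t z\<close> is \<open>\<integral>\<^sub>0\<^sup>t r\<^bsup>\<alpha>-1\<^esup> exp (-(t-r)z) dr\<close> with \<open>r = t\<rho>\<close>, and \<open>limH\<close> its integral
  over the rates \<open>z\<close> of the traps with \<open>p < z \<le> q\<close>; normalised, the limiting probability of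
  being at time \<open>t\<close> in such a trap and still sitting there at time \<open>t + \<theta>\<close>.\<close>

definition ladder :: "real \<Rightarrow> real \<Rightarrow> real \<Rightarrow> ennreal" where
  "ladder \<alpha> t z = (\<integral>\<^sup>+\<rho>. ennreal (indicator {0..1} \<rho> * (\<rho> powr (\<alpha> - 1) * (t powr \<alpha> * exp (- (t * (1 - \<rho>) * z))))) \<partial>lborel)"

definition limW :: "real \<Rightarrow> real \<Rightarrow> real \<Rightarrow> real \<Rightarrow> real \<Rightarrow> real" where
  "limW \<alpha> \<theta> p q z = indicator {p<..q} z * (exp (- (\<theta> * z)) * (\<alpha> * z powr (\<alpha> - 1)))"

definition limH :: "real \<Rightarrow> real \<Rightarrow> real \<Rightarrow> real \<Rightarrow> real \<Rightarrow> ennreal" where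
  "limH \<alpha> \<theta> p q t = (\<integral>\<^sup>+z. ennreal (limW \<alpha> \<theta> p q z) * ladder \<alpha> t z \<partial>lborel)"

lemma limW_measurable [measurable]: "limW \<alpha> \<theta> p q \<in> borel_measurable borel"
  unfolding limW_def by measurable

lemma ladder_measurable [measurable]:
  "(\<lambda>x. ladder \<alpha> (fst x) (snd x)) \<in> borel_measurable (borel \<Otimes>\<^sub>M borel)"
  "(\<lambda>z. ladder \<alpha> t z) \<in> borel_measurable borel"
  "(\<lambda>t. ladder \<alpha> t z) \<in> borel_measurable borel"
  unfolding ladder_def by measurable

lemma limH_measurable [measurable]: "limH \<alpha> \<theta> p q \<in> borel_measurable borel"
proof -
  have [measurable]: "(\<lambda>(t, z). ladder \<alpha> t z) \<in> borel_measurable (borel \<Otimes>\<^sub>M borel)"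
    using ladder_measurable(1)[of \<alpha>] by (simp add: case_prod_unfold)
  show ?thesis unfolding limH_def[abs_def] by measurable
qed

lemma limW_nonneg: "\<alpha> > 0 \<Longrightarrow> limW \<alpha> \<theta> p q z \<ge> 0"
  by (simp add: limW_def)

text \<open>The convolution theorem, with \<Gamma>(\<alpha>) a^(-\<alpha>) the transform of
  r^(\<alpha>-1) and 1/(a+z) that of exp(-rz). In the variable \<rho> it becomes an exchange of
  integrals: a Gamma integral in time, then \<open>nn_integral_ratio_powr\<close>.\<close>

lemma ladder_Laplace:
  assumes \<alpha>: "0 < \<alpha>" and a: "a > 0" and z: "z \<ge> 0"
  shows "(\<integral>\<^sup>+t. ennreal (indicator {0..} t * exp (- (a * t))) * ladder \<alpha> t z \<partial>lborel)
    = ennreal (Gamma \<alpha> * a powr (- \<alpha>) / (a + z))"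
proof -
  have "(\<integral>\<^sup>+t. ennreal (indicator {0..} t * exp (- (a * t))) * ladder \<alpha> t z \<partial>lborel)
     = (\<integral>\<^sup>+t. (\<integral>\<^sup>+\<rho>. ennreal (indicator {0..} t * exp (- (a * t))) * ennreal (indicator {0..1} \<rho> * (\<rho> powr (\<alpha> - 1) * (t powr \<alpha> * exp (- (t * (1 - \<rho>) * z))))) \<partial>lborel) \<partial>lborel)"
    unfolding ladder_def by (intro nn_integral_cong nn_integral_cmult[symmetric]) measurable
  also have "\<dots> = (\<integral>\<^sup>+\<rho>. (\<integral>\<^sup>+t. ennreal (indicator {0..} t * exp (- (a * t))) * ennreal (indicator {0..1} \<rho> * (\<rho> powr (\<alpha> - 1) * (t powr \<alpha> * exp (- (t * (1 - \<rho>) * z))))) \<partial>lborel) \<partial>lborel)"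
    by (rule lborel_pair.Fubini') measurable
  also have "\<dots> = (\<integral>\<^sup>+\<rho>. ennreal (Gamma (\<alpha> + 1)) * ennreal (indicator {0..1} \<rho> * (\<rho> powr (\<alpha> - 1) * (a + (1 - \<rho>) * z) powr (- (\<alpha> + 1)))) \<partial>lborel)"
  proof (rule nn_integral_cong)
    fix \<rho> :: real
    show "(\<integral>\<^sup>+t. ennreal (indicator {0..} t * exp (- (a * t))) * ennreal (indicator {0..1} \<rho> * (\<rho> powr (\<alpha> - 1) * (t powr \<alpha> * exp (- (t * (1 - \<rho>) * z))))) \<partial>lborel)
      = ennreal (Gamma (\<alpha> + 1)) * ennreal (indicator {0..1} \<rho> * (\<rho> powr (\<alpha> - 1) * (a + (1 - \<rho>) * z) powr (- (\<alpha> + 1))))"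
    proof (cases "\<rho> \<in> {0..1}")
      case True
      have x: "a + (1 - \<rho>) * z > 0" using True a z by (intro add_pos_nonneg) auto
      have "(\<integral>\<^sup>+t. ennreal (indicator {0..} t * exp (- (a * t))) * ennreal (indicator {0..1} \<rho> * (\<rho> powr (\<alpha> - 1) * (t powr \<alpha> * exp (- (t * (1 - \<rho>) * z))))) \<partial>lborel)
       = (\<integral>\<^sup>+t. ennreal (\<rho> powr (\<alpha> - 1)) * ennreal (indicator {0..} t * (exp (- ((a + (1 - \<rho>) * z) * t)) * t powr (\<alpha> + 1 - 1))) \<partial>lborel)"
      proof (rule nn_integral_cong)
        fix t :: real
        have "exp (- (a * t)) * exp (- (t * (1 - \<rho>) * z)) = exp (- ((a + (1 - \<rho>) * z) * t))"
          by (simp add: exp_add[symmetric] algebra_simps)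
        then have "(indicator {0..} t * exp (- (a * t))) * (indicator {0..1} \<rho> * (\<rho> powr (\<alpha> - 1) * (t powr \<alpha> * exp (- (t * (1 - \<rho>) * z)))))
          = \<rho> powr (\<alpha> - 1) * (indicator {0..} t * (exp (- ((a + (1 - \<rho>) * z) * t)) * t powr (\<alpha> + 1 - 1)))"
          using True by (simp add: mult_ac)
        then show "ennreal (indicator {0..} t * exp (- (a * t))) * ennreal (indicator {0..1} \<rho> * (\<rho> powr (\<alpha> - 1) * (t powr \<alpha> * exp (- (t * (1 - \<rho>) * z)))))
          = ennreal (\<rho> powr (\<alpha> - 1)) * ennreal (indicator {0..} t * (exp (- ((a + (1 - \<rho>) * z) * t)) * t powr (\<alpha> + 1 - 1)))"
          by (subst (1 2) ennreal_mult[symmetric]) auto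
      qed
      also have "\<dots> = ennreal (\<rho> powr (\<alpha> - 1)) * ennreal (Gamma (\<alpha> + 1) * (a + (1 - \<rho>) * z) powr (- (\<alpha> + 1)))"
        using \<alpha> by (intro nn_integral_cmult_eq[OF _ Gamma_nn_integral_scaled[OF _ x]]) auto
      also have "\<dots> = ennreal (Gamma (\<alpha> + 1)) * ennreal (indicator {0..1} \<rho> * (\<rho> powr (\<alpha> - 1) * (a + (1 - \<rho>) * z) powr (- (\<alpha> + 1))))"
        using True \<alpha> Gamma_real_pos[of "\<alpha> + 1"] by (subst (1 2) ennreal_mult[symmetric]) (auto simp: mult_ac)
      finally show ?thesis .
    qed simp
  qed
  also have "\<dots> = ennreal (Gamma (\<alpha> + 1)) * ennreal (a powr (- \<alpha>) / (\<alpha> * (a + z)))"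
    by (intro nn_integral_cmult_eq[OF _ nn_integral_ratio_powr[OF assms]]) measurable
  also have "\<dots> = ennreal (Gamma (\<alpha> + 1) * (a powr (- \<alpha>) / (\<alpha> * (a + z))))"
    using \<alpha> a z Gamma_real_pos[of "\<alpha> + 1"] by (subst ennreal_mult[symmetric]) auto
  also have "Gamma (\<alpha> + 1) * (a powr (- \<alpha>) / (\<alpha> * (a + z))) = Gamma \<alpha> * a powr (- \<alpha>) / (a + z)"
    using \<alpha> Gamma_plus1[of \<alpha>] by (simp add: nonpos_Ints_def)
  finally show ?thesis .
qed

lemma limH_Laplace:
  assumes \<alpha>: "0 < \<alpha>" and a: "a > 0" and p: "p \<ge> 0"
  shows "(\<integral>\<^sup>+t. ennreal (indicator {0..} t * exp (- (a * t))) * limH \<alpha> \<theta> p q t \<partial>lborel)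
    = ennreal (Gamma \<alpha> * a powr (- \<alpha>)) * (\<integral>\<^sup>+z. ennreal (limW \<alpha> \<theta> p q z / (z + a)) \<partial>lborel)"
proof -
  have [measurable]: "(\<lambda>(t, z). ladder \<alpha> t z) \<in> borel_measurable (borel \<Otimes>\<^sub>M borel)"
    using ladder_measurable(1)[of \<alpha>] by (simp add: case_prod_unfold)
  have "(\<integral>\<^sup>+t. ennreal (indicator {0..} t * exp (- (a * t))) * limH \<alpha> \<theta> p q t \<partial>lborel)
    = (\<integral>\<^sup>+t. (\<integral>\<^sup>+z. ennreal (indicator {0..} t * exp (- (a * t))) * (ennreal (limW \<alpha> \<theta> p q z) * ladder \<alpha> t z) \<partial>lborel) \<partial>lborel)"
    unfolding limH_def by (intro nn_integral_cong nn_integral_cmult[symmetric]) measurable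
  also have "\<dots> = (\<integral>\<^sup>+z. (\<integral>\<^sup>+t. ennreal (indicator {0..} t * exp (- (a * t))) * (ennreal (limW \<alpha> \<theta> p q z) * ladder \<alpha> t z) \<partial>lborel) \<partial>lborel)"
    by (rule lborel_pair.Fubini') measurable
  also have "\<dots> = (\<integral>\<^sup>+z. ennreal (Gamma \<alpha> * a powr (- \<alpha>)) * ennreal (limW \<alpha> \<theta> p q z / (z + a)) \<partial>lborel)"
  proof (rule nn_integral_cong)
    fix z :: real
    show "(\<integral>\<^sup>+t. ennreal (indicator {0..} t * exp (- (a * t))) * (ennreal (limW \<alpha> \<theta> p q z) * ladder \<alpha> t z) \<partial>lborel)
      = ennreal (Gamma \<alpha> * a powr (- \<alpha>)) * ennreal (limW \<alpha> \<theta> p q z / (z + a))"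
    proof (cases "z \<ge> 0")
      case True
      have "(\<integral>\<^sup>+t. ennreal (indicator {0..} t * exp (- (a * t))) * (ennreal (limW \<alpha> \<theta> p q z) * ladder \<alpha> t z) \<partial>lborel)
        = (\<integral>\<^sup>+t. ennreal (limW \<alpha> \<theta> p q z) * (ennreal (indicator {0..} t * exp (- (a * t))) * ladder \<alpha> t z) \<partial>lborel)"
        by (simp add: mult_ac)
      also have "\<dots> = ennreal (limW \<alpha> \<theta> p q z) * ennreal (Gamma \<alpha> * a powr (- \<alpha>) / (a + z))"
        by (intro nn_integral_cmult_eq[OF _ ladder_Laplace[OF \<alpha> a True]]) measurable
      also have "\<dots> = ennreal (Gamma \<alpha> * a powr (- \<alpha>)) * ennreal (limW \<alpha> \<theta> p q z / (z + a))"
        using limW_nonneg[OF \<alpha>] Gamma_real_pos[OF \<alpha>] True a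
        by (subst (1 2) ennreal_mult[symmetric]) (auto simp: mult_ac add.commute)
      finally show ?thesis .
    next
      case False
      then have "limW \<alpha> \<theta> p q z = 0" using p by (auto simp: limW_def indicator_def)
      then show ?thesis by simp
    qed
  qed
  also have "\<dots> = ennreal (Gamma \<alpha> * a powr (- \<alpha>)) * (\<integral>\<^sup>+z. ennreal (limW \<alpha> \<theta> p q z / (z + a)) \<partial>lborel)"
    by (rule nn_integral_cmult) measurable
  finally show ?thesis .
qed

text \<open>Passing from time t to s changes each exponential by a factor of at most exp(q|t-s|),
  since the rates do not exceed q. This multiplicative comparison will give continuity at time
  1.\<close>

lemma limH_le_scale:
  assumes \<alpha>: "0 < \<alpha>" and p: "0 \<le> p" and s: "s > 0" and t: "t > 0"
  shows "limH \<alpha> \<theta> p q s \<le> ennreal ((s / t) powr \<alpha> * exp (q * \<bar>t - s\<bar>)) * limH \<alpha> \<theta> p q t"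
proof -
  define c where "c = (s / t) powr \<alpha> * exp (q * \<bar>t - s\<bar>)"
  have lad: "ladder \<alpha> s z \<le> ennreal c * ladder \<alpha> t z" if z: "0 \<le> z" "z \<le> q" for z
  proof -
    have "ladder \<alpha> s z \<le> (\<integral>\<^sup>+\<rho>. ennreal c * ennreal (indicator {0..1} \<rho> * (\<rho> powr (\<alpha> - 1) * (t powr \<alpha> * exp (- (t * (1 - \<rho>) * z))))) \<partial>lborel)"
      unfolding ladder_def
    proof (rule nn_integral_mono)
      fix \<rho> :: real
      show "ennreal (indicator {0..1} \<rho> * (\<rho> powr (\<alpha> - 1) * (s powr \<alpha> * exp (- (s * (1 - \<rho>) * z)))))
        \<le> ennreal c * ennreal (indicator {0..1} \<rho> * (\<rho> powr (\<alpha> - 1) * (t powr \<alpha> * exp (- (t * (1 - \<rho>) * z)))))"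
      proof (cases "\<rho> \<in> {0..1}")
        case True
        have "(t - s) * ((1 - \<rho>) * z) \<le> \<bar>t - s\<bar> * ((1 - \<rho>) * z)"
          using True z by (intro mult_right_mono) auto
        also have "\<dots> \<le> \<bar>t - s\<bar> * (1 * q)"
          using True z by (intro mult_left_mono mult_mono) auto
        finally have "exp ((t - s) * ((1 - \<rho>) * z)) \<le> exp (q * \<bar>t - s\<bar>)" by (simp add: mult.commute)
        then have "s powr \<alpha> * (exp (- (t * (1 - \<rho>) * z)) * exp ((t - s) * ((1 - \<rho>) * z)))
            \<le> s powr \<alpha> * (exp (- (t * (1 - \<rho>) * z)) * exp (q * \<bar>t - s\<bar>))"
          by (intro mult_left_mono) auto
        moreover have "exp (- (t * (1 - \<rho>) * z)) * exp ((t - s) * ((1 - \<rho>) * z)) = exp (- (s * (1 - \<rho>) * z))"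
          by (simp add: exp_add[symmetric] algebra_simps)
        moreover have "s powr \<alpha> = (s / t) powr \<alpha> * t powr \<alpha>" using s t by (simp add: powr_divide)
        ultimately have "s powr \<alpha> * exp (- (s * (1 - \<rho>) * z)) \<le> c * (t powr \<alpha> * exp (- (t * (1 - \<rho>) * z)))"
          by (simp add: c_def mult_ac)
        then have "\<rho> powr (\<alpha> - 1) * (s powr \<alpha> * exp (- (s * (1 - \<rho>) * z))) \<le> \<rho> powr (\<alpha> - 1) * (c * (t powr \<alpha> * exp (- (t * (1 - \<rho>) * z))))"
          by (intro mult_left_mono) auto
        then show ?thesis using True
          by (subst ennreal_mult[symmetric]) (auto simp: c_def mult_ac intro!: ennreal_leI)
      qed simp
    qed
    also have "\<dots> = ennreal c * ladder \<alpha> t z"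
      unfolding ladder_def by (rule nn_integral_cmult) measurable
    finally show ?thesis .
  qed
  have "limH \<alpha> \<theta> p q s \<le> (\<integral>\<^sup>+z. ennreal c * (ennreal (limW \<alpha> \<theta> p q z) * ladder \<alpha> t z) \<partial>lborel)"
    unfolding limH_def
  proof (rule nn_integral_mono)
    fix z :: real
    show "ennreal (limW \<alpha> \<theta> p q z) * ladder \<alpha> s z \<le> ennreal c * (ennreal (limW \<alpha> \<theta> p q z) * ladder \<alpha> t z)"
    proof (cases "z \<in> {p<..q}")
      case True
      then have "ennreal (limW \<alpha> \<theta> p q z) * ladder \<alpha> s z \<le> ennreal (limW \<alpha> \<theta> p q z) * (ennreal c * ladder \<alpha> t z)"
        using lad[of z] p by (intro mult_left_mono) auto
      then show ?thesis by (simp add: mult_ac)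
    qed (simp add: limW_def)
  qed
  also have "\<dots> = ennreal c * limH \<alpha> \<theta> p q t"
    unfolding limH_def by (rule nn_integral_cmult) measurable
  finally show ?thesis by (simp add: c_def)
qed

lemma limH_finite:
  assumes \<alpha>: "0 < \<alpha>" and p: "0 \<le> p" "p \<le> q" and t: "t \<ge> 0" and \<theta>: "\<theta> \<ge> 0"
  shows "limH \<alpha> \<theta> p q t < \<infinity>"
proof -
  have lad: "ladder \<alpha> t z \<le> ennreal (t powr \<alpha> / \<alpha>)" if z: "0 \<le> z" for z
  proof -
    have "ladder \<alpha> t z \<le> (\<integral>\<^sup>+\<rho>. ennreal (t powr \<alpha> / \<alpha>) * ennreal (indicator {0..1} \<rho> * (\<alpha> * \<rho> powr (\<alpha> - 1))) \<partial>lborel)"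
      unfolding ladder_def
    proof (rule nn_integral_mono)
      fix \<rho> :: real
      show "ennreal (indicator {0..1} \<rho> * (\<rho> powr (\<alpha> - 1) * (t powr \<alpha> * exp (- (t * (1 - \<rho>) * z)))))
        \<le> ennreal (t powr \<alpha> / \<alpha>) * ennreal (indicator {0..1} \<rho> * (\<alpha> * \<rho> powr (\<alpha> - 1)))"
      proof (cases "\<rho> \<in> {0..1}")
        case True
        then have "exp (- (t * (1 - \<rho>) * z)) \<le> 1" using t z by simp
        then have "\<rho> powr (\<alpha> - 1) * (t powr \<alpha> * exp (- (t * (1 - \<rho>) * z))) \<le> \<rho> powr (\<alpha> - 1) * (t powr \<alpha> * 1)"
          by (intro mult_left_mono) auto
        then show ?thesis using True \<alpha>
          by (subst ennreal_mult[symmetric]) (auto intro!: ennreal_leI simp: mult_ac)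
      qed simp
    qed
    also have "\<dots> = ennreal (t powr \<alpha> / \<alpha>) * (\<integral>\<^sup>+\<rho>. ennreal (indicator {0..1} \<rho> * (\<alpha> * \<rho> powr (\<alpha> - 1))) \<partial>lborel)"
      by (rule nn_integral_cmult) measurable
    also have "(\<integral>\<^sup>+\<rho>. ennreal (indicator {0..1} \<rho> * (\<alpha> * \<rho> powr (\<alpha> - 1))) \<partial>lborel) = ennreal 1"
      using nn_integral_powr_Icc[OF \<alpha>, of 1] by simp
    finally show ?thesis by simp
  qed
  have "limH \<alpha> \<theta> p q t \<le> (\<integral>\<^sup>+z. ennreal (t powr \<alpha> / \<alpha>) * ennreal (indicator {0..q} z * (\<alpha> * z powr (\<alpha> - 1))) \<partial>lborel)"
    unfolding limH_def
  proof (rule nn_integral_mono)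
    fix z :: real
    show "ennreal (limW \<alpha> \<theta> p q z) * ladder \<alpha> t z \<le> ennreal (t powr \<alpha> / \<alpha>) * ennreal (indicator {0..q} z * (\<alpha> * z powr (\<alpha> - 1)))"
    proof (cases "z \<in> {p<..q}")
      case True
      have "exp (- (\<theta> * z)) \<le> 1" using True \<theta> p by simp
      then have "exp (- (\<theta> * z)) * (\<alpha> * z powr (\<alpha> - 1)) \<le> 1 * (\<alpha> * z powr (\<alpha> - 1))"
        using \<alpha> by (intro mult_right_mono) auto
      then have "limW \<alpha> \<theta> p q z \<le> indicator {0..q} z * (\<alpha> * z powr (\<alpha> - 1))"
        using True p by (simp add: limW_def)
      then have "ennreal (limW \<alpha> \<theta> p q z) * ladder \<alpha> t z \<le> ennreal (indicator {0..q} z * (\<alpha> * z powr (\<alpha> - 1))) * ennreal (t powr \<alpha> / \<alpha>)"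
        using lad[of z] True p by (intro mult_mono ennreal_leI) auto
      then show ?thesis by (simp add: mult.commute)
    qed (simp add: limW_def)
  qed
  also have "\<dots> = ennreal (t powr \<alpha> / \<alpha>) * (\<integral>\<^sup>+z. ennreal (indicator {0..q} z * (\<alpha> * z powr (\<alpha> - 1))) \<partial>lborel)"
    by (rule nn_integral_cmult) measurable
  also have "(\<integral>\<^sup>+z. ennreal (indicator {0..q} z * (\<alpha> * z powr (\<alpha> - 1))) \<partial>lborel) = ennreal (q powr \<alpha>)"
    using \<alpha> p by (intro nn_integral_powr_Icc) auto
  finally show ?thesis
    by (rule le_less_trans) (simp add: ennreal_mult_less_top)
qed

text \<open>Monotone convergence as the windows exhaust all rates; exchanging the integrals leaves a
  Gamma integral in z with rate 1 + \<theta> - \<rho>.\<close>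

lemma limH_1_tendsto:
  assumes \<alpha>: "0 < \<alpha>" and \<theta>: "\<theta> \<ge> 0"
  shows "(\<lambda>j. limH \<alpha> \<theta> (1 / real (Suc j)) (real (Suc j)) 1) \<longlonglongrightarrow>
    ennreal (\<alpha> * Gamma \<alpha>) * (\<integral>\<^sup>+\<rho>. ennreal (indicator {0..1} \<rho> * (\<rho> powr (\<alpha> - 1) * (1 + \<theta> - \<rho>) powr (- \<alpha>))) \<partial>lborel)"
proof -
  have [measurable]: "(\<lambda>(t, z). ladder \<alpha> t z) \<in> borel_measurable (borel \<Otimes>\<^sub>M borel)"
    using ladder_measurable(1)[of \<alpha>] by (simp add: case_prod_unfold)
  define f where "f = (\<lambda>j z. ennreal (limW \<alpha> \<theta> (1 / real (Suc j)) (real (Suc j)) z) * ladder \<alpha> 1 z)"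
  define W where "W = (\<lambda>z. indicator {0<..} z * (exp (- (\<theta> * z)) * (\<alpha> * z powr (\<alpha> - 1))))"
  have "(\<lambda>j. integral\<^sup>N lborel (f j)) \<longlonglongrightarrow> (\<integral>\<^sup>+z. ennreal (W z) * ladder \<alpha> 1 z \<partial>lborel)"
  proof (rule nn_integral_LIMSEQ)
    show "incseq f"
    proof (intro incseq_SucI le_funI)
      fix j z
      have "{1 / real (Suc j)<..real (Suc j)} \<subseteq> {1 / real (Suc (Suc j))<..real (Suc (Suc j))}"
      proof -
        have "1 / real (Suc (Suc j)) \<le> 1 / real (Suc j)" by (intro divide_left_mono) auto
        then show ?thesis by force
      qed
      then have "limW \<alpha> \<theta> (1 / real (Suc j)) (real (Suc j)) z \<le> limW \<alpha> \<theta> (1 / real (Suc (Suc j))) (real (Suc (Suc j))) z"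
        unfolding limW_def using \<alpha> by (intro mult_right_mono) (auto simp: indicator_def)
      then show "f j z \<le> f (Suc j) z"
        unfolding f_def by (intro mult_right_mono ennreal_leI) auto
    qed
    show "f j \<in> borel_measurable lborel" for j unfolding f_def by measurable
    fix z :: real
    have "eventually (\<lambda>j. limW \<alpha> \<theta> (1 / real (Suc j)) (real (Suc j)) z = W z) sequentially"
    proof (cases "z > 0")
      case True
      have "(\<lambda>j. 1 / real (Suc j)) \<longlonglongrightarrow> 0" by (rule LIMSEQ_Suc[OF lim_1_over_n])
      then have "eventually (\<lambda>j. 1 / real (Suc j) < z) sequentially" using True by (rule order_tendstoD(2))
      moreover have "eventually (\<lambda>j. real (Suc j) \<ge> z) sequentially"
        using filterlim_compose[OF filterlim_real_sequentially filterlim_Suc] by (simp add: filterlim_at_top)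
      ultimately show ?thesis
        by eventually_elim (use True in \<open>simp add: limW_def W_def\<close>)
    next
      case False
      have "\<not> 1 / real (Suc j) < z" for j
        using False by (auto simp: not_less intro: order_trans[of z 0])
      then show ?thesis using False by (simp add: limW_def W_def)
    qed
    then have "eventually (\<lambda>j. f j z = ennreal (W z) * ladder \<alpha> 1 z) sequentially"
      by eventually_elim (simp only: f_def)
    then show "(\<lambda>j. f j z) \<longlonglongrightarrow> ennreal (W z) * ladder \<alpha> 1 z" by (rule tendsto_eventually)
  qed
  moreover have "(\<integral>\<^sup>+z. ennreal (W z) * ladder \<alpha> 1 z \<partial>lborel) =
    ennreal (\<alpha> * Gamma \<alpha>) * (\<integral>\<^sup>+\<rho>. ennreal (indicator {0..1} \<rho> * (\<rho> powr (\<alpha> - 1) * (1 + \<theta> - \<rho>) powr (- \<alpha>))) \<partial>lborel)"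
  proof -
    have [measurable]: "W \<in> borel_measurable borel" unfolding W_def by measurable
    have "(\<integral>\<^sup>+z. ennreal (W z) * ladder \<alpha> 1 z \<partial>lborel)
      = (\<integral>\<^sup>+z. (\<integral>\<^sup>+\<rho>. ennreal (W z) * ennreal (indicator {0..1} \<rho> * (\<rho> powr (\<alpha> - 1) * (1 powr \<alpha> * exp (- (1 * (1 - \<rho>) * z))))) \<partial>lborel) \<partial>lborel)"
      unfolding ladder_def by (intro nn_integral_cong nn_integral_cmult[symmetric]) measurable
    also have "\<dots> = (\<integral>\<^sup>+\<rho>. (\<integral>\<^sup>+z. ennreal (W z) * ennreal (indicator {0..1} \<rho> * (\<rho> powr (\<alpha> - 1) * (1 powr \<alpha> * exp (- (1 * (1 - \<rho>) * z))))) \<partial>lborel) \<partial>lborel)"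
      by (rule lborel_pair.Fubini') measurable
    also have "\<dots> = (\<integral>\<^sup>+\<rho>. ennreal (\<alpha> * Gamma \<alpha>) * ennreal (indicator {0..1} \<rho> * (\<rho> powr (\<alpha> - 1) * (1 + \<theta> - \<rho>) powr (- \<alpha>))) \<partial>lborel)"
    proof (rule nn_integral_cong_AE)
      \<comment> \<open>When \<theta> = 0 the rate 1 + \<theta> - \<rho> vanishes at \<rho> = 1 and
        the Gamma integral diverges there.\<close>
      have "AE \<rho> in lborel. \<rho> \<noteq> (1::real)" by (rule AE_lborel_singleton)
      then show "AE \<rho> in lborel. (\<integral>\<^sup>+z. ennreal (W z) * ennreal (indicator {0..1} \<rho> * (\<rho> powr (\<alpha> - 1) * (1 powr \<alpha> * exp (- (1 * (1 - \<rho>) * z))))) \<partial>lborel)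
        = ennreal (\<alpha> * Gamma \<alpha>) * ennreal (indicator {0..1} \<rho> * (\<rho> powr (\<alpha> - 1) * (1 + \<theta> - \<rho>) powr (- \<alpha>)))"
      proof eventually_elim
        case (elim \<rho>)
        show ?case
        proof (cases "\<rho> \<in> {0..1}")
          case True
          then have x: "1 + \<theta> - \<rho> > 0" using elim \<theta> by auto
          have "(\<integral>\<^sup>+z. ennreal (W z) * ennreal (indicator {0..1} \<rho> * (\<rho> powr (\<alpha> - 1) * (1 powr \<alpha> * exp (- (1 * (1 - \<rho>) * z))))) \<partial>lborel)
            = (\<integral>\<^sup>+z. ennreal (\<alpha> * \<rho> powr (\<alpha> - 1)) * ennreal (indicator {0..} z * (exp (- ((1 + \<theta> - \<rho>) * z)) * z powr (\<alpha> - 1))) \<partial>lborel)"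
          proof (rule nn_integral_cong)
            fix z :: real
            have "exp (- (\<theta> * z)) * exp (- (1 * (1 - \<rho>) * z)) = exp (- ((1 + \<theta> - \<rho>) * z))"
              by (simp add: exp_add[symmetric] algebra_simps)
            then have "W z * (indicator {0..1} \<rho> * (\<rho> powr (\<alpha> - 1) * (1 powr \<alpha> * exp (- (1 * (1 - \<rho>) * z)))))
               = \<alpha> * \<rho> powr (\<alpha> - 1) * (indicator {0..} z * (exp (- ((1 + \<theta> - \<rho>) * z)) * z powr (\<alpha> - 1)))"
              using True by (cases "z = 0") (auto simp: W_def indicator_def mult_ac)
            then show "ennreal (W z) * ennreal (indicator {0..1} \<rho> * (\<rho> powr (\<alpha> - 1) * (1 powr \<alpha> * exp (- (1 * (1 - \<rho>) * z)))))
              = ennreal (\<alpha> * \<rho> powr (\<alpha> - 1)) * ennreal (indicator {0..} z * (exp (- ((1 + \<theta> - \<rho>) * z)) * z powr (\<alpha> - 1)))"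
              using \<alpha> by (subst (1 2) ennreal_mult[symmetric]) (auto simp: W_def)
          qed
          also have "\<dots> = ennreal (\<alpha> * \<rho> powr (\<alpha> - 1)) * ennreal (Gamma \<alpha> * (1 + \<theta> - \<rho>) powr (- \<alpha>))"
            by (intro nn_integral_cmult_eq[OF _ Gamma_nn_integral_scaled[OF \<alpha> x]]) measurable
          also have "\<dots> = ennreal (\<alpha> * Gamma \<alpha>) * ennreal (indicator {0..1} \<rho> * (\<rho> powr (\<alpha> - 1) * (1 + \<theta> - \<rho>) powr (- \<alpha>)))"
            using True \<alpha> Gamma_real_pos[OF \<alpha>] by (subst (1 2) ennreal_mult[symmetric]) (auto simp: mult_ac)
          finally show ?thesis .
        qed simp
      qed
    qed
    also have "\<dots> = ennreal (\<alpha> * Gamma \<alpha>) * (\<integral>\<^sup>+\<rho>. ennreal (indicator {0..1} \<rho> * (\<rho> powr (\<alpha> - 1) * (1 + \<theta> - \<rho>) powr (- \<alpha>))) \<partial>lborel)"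
      by (rule nn_integral_cmult) measurable
    finally show ?thesis .
  qed
  ultimately show ?thesis by (simp add: limH_def f_def)
qed

lemma Gamma_reflection_real:
  fixes \<alpha> :: real
  assumes "0 < \<alpha>" "\<alpha> < 1"
  shows "Gamma \<alpha> * Gamma (1 - \<alpha>) = pi / sin (\<alpha> * pi)"
proof -
  have 1: "Gamma (1 - complex_of_real \<alpha>) = of_real (Gamma (1 - \<alpha>))"
    using Gamma_complex_of_real[of "1 - \<alpha>"] by simp
  have 2: "sin (complex_of_real pi * of_real \<alpha>) = of_real (sin (\<alpha> * pi))"
    using sin_of_real[of "pi * \<alpha>", where 'a = complex] by (simp add: mult.commute)
  have "complex_of_real (Gamma \<alpha> * Gamma (1 - \<alpha>)) = Gamma (of_real \<alpha>) * Gamma (1 - of_real \<alpha>)"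
    by (simp add: Gamma_complex_of_real 1)
  also have "\<dots> = of_real pi / sin (of_real pi * of_real \<alpha>)" by (rule Gamma_reflection_complex)
  also have "\<dots> = complex_of_real (pi / sin (\<alpha> * pi))"
    unfolding 2 by simp
  finally show ?thesis using of_real_eq_iff by blast
qed

text \<open>Substitute s = \<rho>/(1+\<theta>). With u = 1/(1+\<theta>) the Jacobian and the two
  powers multiply to u u^(\<alpha>-1) u^(-\<alpha>) = 1.\<close>

lemma arcsine_integral:
  assumes \<alpha>: "0 < \<alpha>" "\<alpha> < 1" and \<theta>: "\<theta> \<ge> 0"
  shows "(\<integral>\<^sup>+\<rho>. ennreal (indicator {0..1} \<rho> * (\<rho> powr (\<alpha> - 1) * (1 + \<theta> - \<rho>) powr (- \<alpha>))) \<partial>lborel)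
    = ennreal (integral {0..1 / (1 + \<theta>)} (\<lambda>s. s powr (\<alpha> - 1) * (1 - s) powr (- \<alpha>)))"
proof -
  define u where "u = 1 / (1 + \<theta>)"
  have u: "0 < u" "u \<le> 1" using \<theta> by (auto simp: u_def)
  define f where "f = (\<lambda>s::real. s powr (\<alpha> - 1) * (1 - s) powr (- \<alpha>))"
  have "((\<lambda>s. s powr (\<alpha> - 1) * (1 - s) powr ((1 - \<alpha>) - 1)) has_integral Beta \<alpha> (1 - \<alpha>)) {0..1}"
    using \<alpha> by (intro has_integral_Beta_real) auto
  then have "f integrable_on {0..1}" by (auto simp: f_def integrable_on_def)
  then have "f integrable_on {0..u}" using u by (rule_tac integrable_subinterval_real) auto
  then have "(f has_integral (integral {0..u} f)) {0..u}" by (rule integrable_integral)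
  from nn_integral_has_integral_lebesgue[OF _ this]
  have "ennreal (integral {0..u} f) = (\<integral>\<^sup>+s. ennreal (indicator {0..u} s * f s) \<partial>lborel)"
    by (simp add: f_def)
  also have "\<dots> = ennreal \<bar>u\<bar> * (\<integral>\<^sup>+\<rho>. ennreal (indicator {0..u} (0 + u * \<rho>) * f (0 + u * \<rho>)) \<partial>lborel)"
    using u by (intro nn_integral_real_affine) (auto simp: f_def)
  also have "\<dots> = (\<integral>\<^sup>+\<rho>. ennreal \<bar>u\<bar> * ennreal (indicator {0..u} (0 + u * \<rho>) * f (0 + u * \<rho>)) \<partial>lborel)"
    by (rule nn_integral_cmult[symmetric]) (auto simp: f_def)
  also have "\<dots> = (\<integral>\<^sup>+\<rho>. ennreal (indicator {0..1} \<rho> * (\<rho> powr (\<alpha> - 1) * (1 + \<theta> - \<rho>) powr (- \<alpha>))) \<partial>lborel)"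
  proof (rule nn_integral_cong)
    fix \<rho> :: real
    show "ennreal \<bar>u\<bar> * ennreal (indicator {0..u} (0 + u * \<rho>) * f (0 + u * \<rho>)) =
      ennreal (indicator {0..1} \<rho> * (\<rho> powr (\<alpha> - 1) * (1 + \<theta> - \<rho>) powr (- \<alpha>)))"
    proof (cases "\<rho> \<in> {0..1}")
      case True
      have "1 - u * \<rho> = u * (1 + \<theta> - \<rho>)" using \<theta> by (simp add: u_def field_simps)
      then have "f (u * \<rho>) = (u powr (\<alpha> - 1) * u powr (- \<alpha>)) * (\<rho> powr (\<alpha> - 1) * (1 + \<theta> - \<rho>) powr (- \<alpha>))"
        using True u \<theta> by (simp add: f_def powr_mult)
      moreover have "u * (u powr (\<alpha> - 1) * u powr (- \<alpha>)) = 1"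
        using u by (simp add: powr_diff powr_minus field_simps)
      ultimately have "u * f (u * \<rho>) = \<rho> powr (\<alpha> - 1) * (1 + \<theta> - \<rho>) powr (- \<alpha>)"
        by (metis mult.assoc mult_1)
      moreover have "u * \<rho> \<in> {0..u}" using True u by (auto intro: mult_left_le)
      ultimately show ?thesis using True u
        by (subst ennreal_mult[symmetric]) (auto simp: f_def)
    next
      case False
      then have "u * \<rho> \<notin> {0..u}" using u by (auto simp: zero_le_mult_iff mult_le_cancel_left1)
      then show ?thesis using False by simp
    qed
  qed
  finally show ?thesis by (simp add: f_def u_def)
qed

lemma integral_arcsine_nonneg:
  "integral {0..u} (\<lambda>s::real. s powr (\<alpha> - 1) * (1 - s) powr (- \<alpha>)) \<ge> 0"
  by (cases "(\<lambda>s::real. s powr (\<alpha> - 1) * (1 - s) powr (- \<alpha>)) integrable_on {0..u}")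
     (auto intro: Henstock_Kurzweil_Integration.integral_nonneg simp: not_integrable_integral)

text \<open>The Beta integral and the reflection formula. It is the case \<theta> = 0 of the limit:
  the masses of the windows tend to 1, so none escapes to very shallow or very deep traps.\<close>

lemma Asl_1:
  assumes "0 < \<alpha>" "\<alpha> < 1"
  shows "Asl \<alpha> 1 = 1"
proof -
  have "((\<lambda>s. s powr (\<alpha> - 1) * (1 - s) powr ((1 - \<alpha>) - 1)) has_integral Beta \<alpha> (1 - \<alpha>)) {0..1}"
    using assms by (intro has_integral_Beta_real) auto
  then have "integral {0..1} (\<lambda>s. s powr (\<alpha> - 1) * (1 - s) powr (- \<alpha>)) = Beta \<alpha> (1 - \<alpha>)"
    by (simp add: integral_unique)
  also have "\<dots> = pi / sin (\<alpha> * pi)"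
    using Gamma_reflection_real[OF assms] by (simp add: Beta_def)
  finally have *: "integral {0..1} (\<lambda>s. s powr (\<alpha> - 1) * (1 - s) powr (- \<alpha>)) = pi / sin (\<alpha> * pi)" .
  have "sin (\<alpha> * pi) > 0" using assms by (intro sin_gt_zero) auto
  then show ?thesis unfolding Asl_def * by simp
qed

subsection \<open>The trap model on the torus and its resolvent\<close>

lemma exp_integrable:
  assumes "a > (0::real)"
  shows "set_integrable lborel {0..} (\<lambda>s. exp (- (a * s)))"
    and "(LBINT s:{0..}. exp (- (a * s))) = 1 / a"
proof -
  have hb: "has_bochner_integral lborel (\<lambda>s. exp (- (a * s)) * indicator {0..} s) (1 / a)"
  proof (rule has_bochner_integral_nn_integral)
    have "(\<integral>\<^sup>+s. ennreal (exp (- (a * s))) * indicator {0..} s \<partial>lborel) = ennreal (0 - (- exp (- (a * 0)) / a))"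
    proof (rule nn_integral_FTC_atLeast)
      show "((\<lambda>s. - exp (- (a * s)) / a) has_real_derivative exp (- (a * s))) (at s)" for s
        using assms by (auto intro!: derivative_eq_intros)
      have "filterlim (\<lambda>s. a * s) at_top at_top"
        using assms by (intro filterlim_tendsto_pos_mult_at_top[OF tendsto_const] filterlim_ident)
      then have "((\<lambda>s. exp (- (a * s))) \<longlongrightarrow> 0) at_top"
        by (intro filterlim_compose[OF exp_at_bot] filterlim_compose[OF filterlim_uminus_at_bot_at_top])
      then have "((\<lambda>s. - exp (- (a * s)) / a) \<longlongrightarrow> - 0 / a) at_top" by (intro tendsto_intros) (use assms in auto)
      then show "((\<lambda>s. - exp (- (a * s)) / a) \<longlongrightarrow> 0) at_top" by simp
    qed auto
    then show "(\<integral>\<^sup>+s. ennreal (exp (- (a * s)) * indicator {0..} s) \<partial>lborel) = ennreal (1 / a)"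
      by (simp add: ennreal_mult' ennreal_indicator)
  qed (use assms in auto)
  then show "set_integrable lborel {0..} (\<lambda>s. exp (- (a * s)))"
    by (simp add: set_integrable_def has_bochner_integral_iff mult.commute)
  show "(LBINT s:{0..}. exp (- (a * s))) = 1 / a"
    using has_bochner_integral_integral_eq[OF hb] by (simp add: set_lebesgue_integral_def mult.commute)
qed

locale btm =
  fixes n :: nat and t :: "int \<times> int \<Rightarrow> real" and T :: real
  assumes t_pos: "\<And>x. t x > 0" and T_pos: "T > 0"
begin

text \<open>Time in units of \<open>T\<close>, so that the two observation times become 1 and 1 +
  \<theta>.\<close>

definition P :: "real \<Rightarrow> int \<times> int \<Rightarrow> int \<times> int \<Rightarrow> real" where
  "P s x y = ctmc_trans (torus n) (btm_gen n t) (s * T) x y"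

lemma gen_apply: "x \<in> torus n \<Longrightarrow> (\<Sum>z\<in>torus n. btm_gen n t x z * f z) = (srw n f x - f x) / t x"
  using btm_gen_apply[where \<tau> = t, OF t_pos] by blast

lemma gen_off_diag: "x \<noteq> y \<Longrightarrow> btm_gen n t x y \<ge> 0"
  using t_pos[of x] by (simp add: btm_gen_def)

lemma gen_row_sum: "x \<in> torus n \<Longrightarrow> (\<Sum>y\<in>torus n. btm_gen n t x y) = 0"
  using gen_apply[of x "\<lambda>_. 1"] by (simp add: srw_def)

text \<open>Multiplied by \<open>t x\<close> the generator becomes P - I for the simple random walk,
  which is symmetric because the set of steps is.\<close>

lemma gen_reversible:
  assumes "x \<in> torus n" "y \<in> torus n"
  shows "t x * btm_gen n t x y = t y * btm_gen n t y x"
proof -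
  have len: "real (length (filter (\<lambda>e. wrap n (fst x + fst e, snd x + snd e) = z) unit_dirs)) =
     (if wrap n (x + (1,0)) = z then 1 else 0) + (if wrap n (x + (-1,0)) = z then 1 else 0)
     + (if wrap n (x + (0,1)) = z then 1 else 0) + (if wrap n (x + (0,-1)) = z then 1 else 0)" for x z
    by (auto simp: unit_dirs_def plus_prod_def)
  have sw: "wrap n (x + e) = y \<longleftrightarrow> wrap n (y - e) = x" if "x \<in> torus n" "y \<in> torus n" for x y e
    using that by (metis add_diff_cancel_right' diff_add_cancel wrap_add_wrap wrap_diff_wrap wrap_torus)
  have [simp]: "y - (1,0) = y + (-1,0)" "y - (-1,0) = y + (1,0)" "y - (0,1) = y + (0,-1)" "y - (0,-1) = y + (0,1)"
    for y :: "int \<times> int" by (auto simp: minus_prod_def plus_prod_def)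
  have "t x * btm_gen n t x y = real (length (filter (\<lambda>e. wrap n (fst x + fst e, snd x + snd e) = y) unit_dirs)) / 4
      - (if x = y then 1 else 0)" for x y
    using t_pos[of x] t_pos[of y] by (simp add: btm_gen_def field_simps)
  then show ?thesis
    unfolding len using sw[OF assms] by simp
qed

lemma gen_dirichlet: "(\<Sum>x\<in>torus n. t x * f x * (\<Sum>z\<in>torus n. btm_gen n t x z * f z)) \<le> 0"
proof -
  have "(\<Sum>x\<in>torus n. t x * f x * (\<Sum>z\<in>torus n. btm_gen n t x z * f z)) = (\<Sum>x\<in>torus n. f x * (srw n f x - f x))"
  proof (rule sum.cong[OF refl])
    fix x assume "x \<in> torus n"
    then show "t x * f x * (\<Sum>z\<in>torus n. btm_gen n t x z * f z) = f x * (srw n f x - f x)"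
      using t_pos[of x] by (simp add: gen_apply)
  qed
  then show ?thesis using srw_dirichlet_nonpos[where f = f and n = n] by simp
qed

lemma P_0: "P 0 x y = (if x = y then 1 else 0)"
  by (simp add: P_def ctmc_trans_0)

lemma P_nonneg: "s \<ge> 0 \<Longrightarrow> x \<in> torus n \<Longrightarrow> y \<in> torus n \<Longrightarrow> P s x y \<ge> 0"
  unfolding P_def using T_pos gen_off_diag by (intro ctmc_trans_nonneg) auto

lemma P_row_sum: "x \<in> torus n \<Longrightarrow> (\<Sum>y\<in>torus n. P s x y) = 1"
  unfolding P_def by (intro ctmc_trans_row_sum gen_row_sum) auto

lemma P_le_1: "s \<ge> 0 \<Longrightarrow> x \<in> torus n \<Longrightarrow> y \<in> torus n \<Longrightarrow> P s x y \<le> 1"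
  using member_le_sum[of y "torus n" "P s x"] P_nonneg P_row_sum by auto

lemma P_add: "x \<in> torus n \<Longrightarrow> P (s + r) x y = (\<Sum>z\<in>torus n. P s x z * P r z y)"
  unfolding P_def by (simp add: distrib_right ctmc_trans_add)

lemma P_reversible: "x \<in> torus n \<Longrightarrow> y \<in> torus n \<Longrightarrow> t x * P s x y = t y * P s y x"
  unfolding P_def using gen_reversible by (intro ctmc_trans_reversible) auto

lemma P_diag_antimono: "y \<in> torus n \<Longrightarrow> s \<le> r \<Longrightarrow> P r y y \<le> P s y y"
  unfolding P_def
  by (rule ctmc_trans_diag_antimono[where \<tau> = t])
     (use t_pos gen_reversible gen_dirichlet T_pos in \<open>auto intro: mult_right_mono\<close>)

text \<open>The term z = y of the Chapman-Kolmogorov sum; the other terms are nonnegative.\<close>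

lemma P_stay: "s \<ge> 0 \<Longrightarrow> r \<ge> 0 \<Longrightarrow> x \<in> torus n \<Longrightarrow> y \<in> torus n \<Longrightarrow> P s x y * P r y y \<le> P (s + r) x y"
  unfolding P_add
  using member_le_sum[of y "torus n" "\<lambda>z. P s x z * P r z y"] P_nonneg by auto

lemma P_continuous: "x \<in> torus n \<Longrightarrow> continuous_on S (\<lambda>s. P s x y)"
  unfolding P_def
  by (rule continuous_on_compose2[OF ctmc_trans_continuous[where A = UNIV]]) (auto intro!: continuous_intros)

lemma P_measurable: "x \<in> torus n \<Longrightarrow> (\<lambda>s. P s x y) \<in> borel_measurable borel"
  using P_continuous[of x UNIV y] by (rule borel_measurable_continuous_onI)

lemma P_deriv:
  assumes "x \<in> torus n"
  shows "((\<lambda>s. P s x y) has_real_derivative T * ((srw n (\<lambda>z. P s z y) x - P s x y) / t x)) (at s)"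
proof -
  have "((\<lambda>s. s * T) has_real_derivative T) (at s)" by (auto intro!: derivative_eq_intros)
  from DERIV_chain2[OF ctmc_trans_deriv[OF finite_torus assms, of "btm_gen n t" y] this]
  have "((\<lambda>s. P s x y) has_real_derivative (\<Sum>z\<in>torus n. btm_gen n t x z * P s z y) * T) (at s)"
    by (simp add: P_def[abs_def])
  then show ?thesis using gen_apply[OF assms, of "\<lambda>z. P s z y"] by (simp add: mult.commute)
qed

definition J :: "real \<Rightarrow> int \<times> int \<Rightarrow> int \<times> int \<Rightarrow> real" where
  "J a x y = (LBINT s:{0..}. P s x y * exp (- (a * s)))"

lemma P_integrable:
  assumes "a > 0" "x \<in> torus n" "y \<in> torus n"
  shows "set_integrable lborel {0..} (\<lambda>s. P s x y * exp (- (a * s)))"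
  unfolding set_integrable_def
proof (rule Bochner_Integration.integrable_bound[OF exp_integrable(1)[OF assms(1), unfolded set_integrable_def]])
  note [measurable] = P_measurable[OF assms(2)]
  show "(\<lambda>s. indicator {0..} s *\<^sub>R (P s x y * exp (- (a * s)))) \<in> borel_measurable lborel" by measurable
  show "AE s in lborel. norm (indicator {0..} s *\<^sub>R (P s x y * exp (- (a * s)))) \<le> norm (indicator {0..} s *\<^sub>R exp (- (a * s)))"
    using P_nonneg[OF _ assms(2,3)] P_le_1[OF _ assms(2,3)]
    by (intro AE_I2) (auto simp: indicator_def abs_mult intro!: mult_left_le_one_le)
qed

lemma J_nonneg: "x \<in> torus n \<Longrightarrow> y \<in> torus n \<Longrightarrow> J a x y \<ge> 0"
  unfolding J_def set_lebesgue_integral_def using P_nonneg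
  by (intro Bochner_Integration.integral_nonneg) (auto simp: indicator_def)

lemma J_reversible: "x \<in> torus n \<Longrightarrow> y \<in> torus n \<Longrightarrow> t x * J a x y = t y * J a y x"
proof -
  assume xy: "x \<in> torus n" "y \<in> torus n"
  have "t x * J a x y = (LBINT s:{0..}. t x * (P s x y * exp (- (a * s))))"
    by (simp add: J_def)
  also have "\<dots> = (LBINT s:{0..}. t y * (P s y x * exp (- (a * s))))"
    using P_reversible[OF xy] by (simp flip: mult.assoc)
  finally show ?thesis by (simp add: J_def)
qed

lemma J_sum:
  assumes "a > 0" "x \<in> torus n"
  shows "(\<Sum>y\<in>torus n. J a x y) = 1 / a"
proof -
  have "(\<Sum>y\<in>torus n. J a x y) = (LBINT s:{0..}. (\<Sum>y\<in>torus n. P s x y * exp (- (a * s))))"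
    unfolding J_def set_lebesgue_integral_def scaleR_sum_right
    using P_integrable[OF assms] unfolding set_integrable_def
    by (intro Bochner_Integration.integral_sum[symmetric]) auto
  also have "\<dots> = (LBINT s:{0..}. exp (- (a * s)))"
    using P_row_sum[OF assms(2)] by (simp flip: sum_distrib_right)
  finally show ?thesis using exp_integrable(2)[OF assms(1)] by simp
qed

text \<open>Integrate the derivative of P exp(-as) over \<open>{0..}\<close>: the boundary value is
  0 at infinity and the indicator of x = y at time 0. Multiplying by \<open>t x / T\<close> clears
  the random rate from the walk part.\<close>

lemma resolvent_identity:
  assumes a: "a > 0" and x: "x \<in> torus n" and y: "y \<in> torus n"
  shows "(a * t x / T + 1) * J a x y - srw n (\<lambda>z. J a z y) x = (if x = y then t x / T else 0)"
proof -
  define F where "F = (\<lambda>s. P s x y * exp (- (a * s)))"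
  define F' where "F' = (\<lambda>s. T / t x * (srw n (\<lambda>z. P s z y * exp (- (a * s))) x - P s x y * exp (- (a * s)))
      - a * (P s x y * exp (- (a * s))))"
  have srw_eq: "srw n (\<lambda>z. h z * c) x = srw n h x * c" for h c
    by (simp add: srw_def algebra_simps)
  have dF: "(F has_real_derivative F' s) (at s)" for s
  proof -
    have "(F has_real_derivative T * ((srw n (\<lambda>z. P s z y) x - P s x y) / t x) * exp (- (a * s))
        + (- a * exp (- (a * s))) * P s x y) (at s)"
      unfolding F_def
      by (rule DERIV_mult[OF P_deriv[OF x]]) (auto intro!: derivative_eq_intros)
    moreover have "T * ((srw n (\<lambda>z. P s z y) x - P s x y) / t x) * exp (- (a * s))
        + (- a * exp (- (a * s))) * P s x y = F' s"
      unfolding F'_def srw_eq by (simp add: algebra_simps diff_divide_distrib)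
    ultimately show ?thesis by simp
  qed
  have int: "set_integrable lborel {0..} (\<lambda>s. P s z y * exp (- (a * s)))" if "z \<in> torus n" for z
    by (rule P_integrable[OF a that y])
  have srw_int: "set_integrable lborel {0..} (\<lambda>s. srw n (\<lambda>z. P s z y * exp (- (a * s))) x)"
    and srw_J: "(LBINT s:{0..}. srw n (\<lambda>z. P s z y * exp (- (a * s))) x) = srw n (\<lambda>z. J a z y) x"
    unfolding srw_def J_def
    by (auto intro!: set_integral_add set_integrable_divide int simp: set_integral_add int set_integral_divide_zero)
  have F'_int: "set_integrable lborel {0..} F'"
    unfolding F'_def by (intro set_integral_diff set_integrable_mult_right srw_int int x)
  have F'_J: "(LBINT s:{0..}. F' s) = T / t x * (srw n (\<lambda>z. J a z y) x - J a x y) - a * J a x y"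
    unfolding F'_def
    by (simp add: set_integral_diff srw_int int x srw_J J_def del: mult_minus_right)
  have F'_cont: "continuous_on UNIV F'"
    unfolding F'_def srw_def using x by (intro continuous_intros P_continuous) auto
  have lim0: "(F \<longlongrightarrow> 0) at_top"
  proof (rule Lim_null_comparison)
    show "eventually (\<lambda>s. norm (F s) \<le> exp (- (a * s))) at_top"
      using eventually_ge_at_top[of 0]
    proof eventually_elim
      case (elim s)
      then show ?case using P_nonneg[OF elim x y] P_le_1[OF elim x y]
        by (simp add: F_def abs_mult mult_left_le_one_le)
    qed
    have "filterlim (\<lambda>s. a * s) at_top at_top"
      using a by (intro filterlim_tendsto_pos_mult_at_top[OF tendsto_const] filterlim_ident)
    then show "((\<lambda>s. exp (- (a * s))) \<longlongrightarrow> 0) at_top"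
      by (intro filterlim_compose[OF exp_at_bot] filterlim_compose[OF filterlim_uminus_at_bot_at_top])
  qed
  have "(LBINT s:{0..}. F' s) = 0 - F 0"
  proof -
    have lim: "((\<lambda>R. LBINT s:{0..R}. F' s) \<longlongrightarrow> (LBINT s:{0..}. F' s)) at_top"
      by (rule tendsto_set_lebesgue_integral_at_top) (use F'_int in auto)
    have eq: "(LBINT s:{0..R}. F' s) = F R - F 0" if "R \<ge> 0" for R
    proof -
      have "integral\<^sup>L lborel (\<lambda>s. indicator {0..R} s *\<^sub>R F' s) = F R - F 0"
        by (rule integral_FTC_Icc[OF that])
           (use dF F'_cont in \<open>auto simp: has_real_derivative_iff_has_vector_derivative[symmetric]
              intro: has_field_derivative_at_within continuous_on_subset\<close>)
      then show ?thesis by (simp add: set_lebesgue_integral_def)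
    qed
    have "((\<lambda>R. F R - F 0) \<longlongrightarrow> (LBINT s:{0..}. F' s)) at_top"
      by (rule Lim_transform_eventually[OF lim])
         (use eventually_ge_at_top[of 0] in eventually_elim, simp add: eq)
    moreover have "((\<lambda>R. F R - F 0) \<longlongrightarrow> 0 - F 0) at_top" by (intro tendsto_intros lim0)
    ultimately show ?thesis by (rule tendsto_unique[rotated]) simp
  qed
  then have "T / t x * (srw n (\<lambda>z. J a z y) x - J a x y) - a * J a x y = - (if x = y then 1 else 0)"
    unfolding F'_J by (simp add: F_def P_0)
  then have "t x / T * (T / t x * (srw n (\<lambda>z. J a z y) x - J a x y) - a * J a x y) = - (if x = y then t x / T else 0)"
    by simp
  moreover have "t x / T * (T / t x * (srw n (\<lambda>z. J a z y) x - J a x y) - a * J a x y)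
      = (srw n (\<lambda>z. J a z y) x - J a x y) - a * t x / T * J a x y"
    using t_pos[of x] T_pos by (simp add: right_diff_distrib)
  ultimately show ?thesis by (simp add: distrib_right)
qed

text \<open>The density of the resolvent with respect to the reversible measure. By
  \<open>resolvent_identity\<close> it inverts I - P + a\<tau>/T, so it is the Green function of the
  killed walk.\<close>

definition Gr :: "real \<Rightarrow> int \<times> int \<Rightarrow> int \<times> int \<Rightarrow> real" where
  "Gr a x y = J a x y * T / t y"

text \<open>\<open>G_eq\<close> is \<open>green_kernel_apply\<close> for a column of
  \<open>Gr\<close>, with \<open>m\<close> the column mean that the kernel does not see.
  \<open>death\<close> is conservation of mass along rows, carried over to columns by
  reversibility.\<close>

lemma trap_green_btm:
  assumes a: "a \<ge> 1" and g: "g = green n (0,0)" "g > 0" and b: "b \<ge> 0"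
    and v: "\<And>x. v x = g * t x / T"
    and kappa: "(\<Sum>x\<in>torus n. a * v x / (1 + a * v x)) \<ge> 1"
  shows "trap_green (torus n) (\<lambda>x z. green n (x - z)) (Gr a) (\<lambda>y. (\<Sum>x\<in>torus n. Gr a x y) / 4 ^ n) v a g b"
proof
  have a0: "a > 0" using a by simp
  have G0: "Gr a x y \<ge> 0" if "x \<in> torus n" "y \<in> torus n" for x y
    unfolding Gr_def using J_nonneg[OF that] T_pos t_pos[of y] by simp
  show "green n (x - x) = g" for x :: "int \<times> int" by (simp add: g zero_prod_def)
  show "\<bar>green n (x - z)\<bar> \<le> g" for x z by (simp add: g abs_green_le)
  show "green n (x - z) = green n (z - x)" for x z :: "int \<times> int"
    using green_uminus[of n "x - z"] by simp
  show "v x > 0" for x using g(2) t_pos[of x] T_pos by (simp add: v)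
  show "0 \<le> Gr a x y" if "x \<in> torus n" "y \<in> torus n" for x y by (rule G0[OF that])
  show "0 \<le> (\<Sum>x\<in>torus n. Gr a x y) / 4 ^ n" if "y \<in> torus n" for y
    by (intro divide_nonneg_nonneg sum_nonneg G0 that) auto
  have Vz: "a * v z / g = a * t z / T" for z using g(2) by (simp add: v)
  show "Gr a x y = (\<Sum>x\<in>torus n. Gr a x y) / 4 ^ n + green n (x - y)
      - (\<Sum>z\<in>torus n. green n (x - z) * (a * v z / g * Gr a z y))" if x: "x \<in> torus n" and y: "y \<in> torus n" for x y
  proof -
    have eq: "Gr a z y - srw n (\<lambda>z. Gr a z y) z = (if z = y then 1 else 0) - a * v z / g * Gr a z y"
      if z: "z \<in> torus n" for z
    proof -
      have Gr_J: "Gr a z y = J a z y * (T / t y)" for z by (simp add: Gr_def)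
      have "srw n (\<lambda>z. Gr a z y) z = srw n (\<lambda>z. J a z y) z * (T / t y)"
        unfolding srw_def Gr_J by (simp only: times_divide_eq_left distrib_right)
      then have "(a * t z / T + 1) * Gr a z y - srw n (\<lambda>z. Gr a z y) z
          = ((a * t z / T + 1) * J a z y - srw n (\<lambda>z. J a z y) z) * (T / t y)"
        by (simp add: Gr_def left_diff_distrib diff_divide_distrib mult.assoc)
      also have "\<dots> = (if z = y then 1 else 0)"
        unfolding resolvent_identity[OF a0 z y] using t_pos[of y] T_pos by simp
      finally show ?thesis unfolding Vz by (simp add: algebra_simps)
    qed
    have "Gr a x y - (\<Sum>z\<in>torus n. Gr a z y) / 4 ^ n
        = (\<Sum>z\<in>torus n. green n (x - z) * (Gr a z y - srw n (\<lambda>z. Gr a z y) z))"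
      using green_kernel_apply[OF x, of "\<lambda>z. Gr a z y"] by simp
    also have "\<dots> = (\<Sum>z\<in>torus n. green n (x - z) * (if z = y then 1 else 0) - green n (x - z) * (a * v z / g * Gr a z y))"
      by (intro sum.cong refl) (simp only: eq right_diff_distrib)
    also have "\<dots> = green n (x - y) - (\<Sum>z\<in>torus n. green n (x - z) * (a * v z / g * Gr a z y))"
      using y by (simp add: sum_subtractf if_distrib[of "\<lambda>u. _ * u"] cong: if_cong)
    finally show ?thesis by simp
  qed
  show "(\<Sum>z\<in>torus n. a * v z / g * Gr a z y) = 1" if y: "y \<in> torus n" for y
  proof -
    have "(\<Sum>z\<in>torus n. a * v z / g * Gr a z y) = (\<Sum>z\<in>torus n. a * J a y z)"
    proof (rule sum.cong[OF refl])
      fix z assume z: "z \<in> torus n"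
      have "a * v z / g * Gr a z y = a * (t z * J a z y) / t y"
        unfolding Vz Gr_def using T_pos by simp
      also have "\<dots> = a * J a y z" unfolding J_reversible[OF z y] using t_pos[of y] by simp
      finally show "a * v z / g * Gr a z y = a * J a y z" .
    qed
    also have "\<dots> = 1" using J_sum[OF a0 y] a0 by (simp flip: sum_distrib_left)
    finally show ?thesis .
  qed
qed (use assms in auto)

lemma J_eq_Gr: "J a x y = Gr a x y * t y / T"
  using t_pos[of y] T_pos by (simp add: Gr_def)

end

subsection \<open>Uniform asymptotics in a typical environment\<close>

lemma continuous_at_right_cut:
  fixes \<phi> :: "real \<Rightarrow> real"
  assumes "\<And>v. v \<ge> \<delta> \<Longrightarrow> isCont \<phi> v"
  shows "continuous (at_right x) (\<lambda>v. if v \<ge> \<delta> then \<phi> v else 0)"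
proof (cases "x \<ge> \<delta>")
  case True
  have "(\<phi> \<longlongrightarrow> \<phi> x) (at_right x)"
    using assms[OF True] by (simp add: isCont_def filterlim_at_split)
  moreover have "eventually (\<lambda>v. \<phi> v = (if v \<ge> \<delta> then \<phi> v else 0)) (at_right x)"
    using True by (auto simp: eventually_at_filter)
  ultimately show ?thesis
    using True by (auto simp: continuous_within intro: Lim_transform_eventually)
next
  case False
  have "eventually (\<lambda>v. v < \<delta>) (at_right x)"
    using False by (intro order_tendstoD(2)[OF tendsto_ident_at]) auto
  then have "eventually (\<lambda>v. 0 = (if v \<ge> \<delta> then \<phi> v else 0)) (at_right x)"
    by eventually_elim simp
  with tendsto_const show ?thesis
    unfolding continuous_within using False by (auto intro: Lim_transform_eventually)
qed

definition Phi :: "real \<Rightarrow> real \<Rightarrow> real" where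
  "Phi a v = (if v \<ge> 0 then a * v / (1 + a * v) else 0)"

text \<open>Under z = 1/v the factor v/(1+av) becomes 1/(z+a) and the cut becomes z \<le>
  1/\<delta>. A test function has to be nondecreasing, so the cut is from below only; a window is
  the difference of two such functions.\<close>

definition PhiC :: "real \<Rightarrow> real \<Rightarrow> real \<Rightarrow> real \<Rightarrow> real" where
  "PhiC a \<theta> \<delta> v = (if v \<ge> \<delta> then exp (- (\<theta> / v)) * (v / (1 + a * v)) else 0)"

lemma ratio_mono:
  fixes a :: real
  assumes "a \<ge> 0" "0 \<le> x" "x \<le> y"
  shows "x / (1 + a * x) \<le> y / (1 + a * y)"
proof -
  have "1 + a * x > 0" "1 + a * y > 0" using assms by (auto intro: add_pos_nonneg)
  moreover have "x * (1 + a * y) \<le> y * (1 + a * x)" using assms by (simp add: algebra_simps)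
  ultimately show ?thesis by (simp add: divide_le_eq le_divide_eq field_simps)
qed

context trap_environment
begin

text \<open>The Stieltjes integral of the intensity \<alpha>z^(\<alpha>-1) at a = 1, equal to
  \<pi>\<alpha>/sin(\<pi>\<alpha>).\<close>

definition c\<alpha> :: real where "c\<alpha> = \<alpha> * Gamma \<alpha> * Gamma (1 - \<alpha>)"

text \<open>In terms of the rates z, the limit of the rescaled sums of \<open>PhiC\<close> with cut
  1/q.\<close>

definition E :: "real \<Rightarrow> real \<Rightarrow> real \<Rightarrow> real" where
  "E a \<theta> q = enn2real (\<integral>\<^sup>+z. ennreal (limW \<alpha> \<theta> 0 q z / (z + a)) \<partial>lborel)"

lemma c\<alpha>_pos: "c\<alpha> > 0"
  using \<alpha> Gamma_real_pos[of \<alpha>] Gamma_real_pos[of "1 - \<alpha>"] by (simp add: c\<alpha>_def)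

lemma test_fun_Phi:
  assumes a: "a \<ge> 1"
  shows "test_fun (Phi a) (c\<alpha> * a powr \<alpha>)"
  unfolding test_fun_def
proof (intro conjI allI impI)
  fix x y :: real assume xy: "x \<le> y"
  show "Phi a x \<le> Phi a y"
  proof (cases "x \<ge> 0")
    case True
    have "a * (x / (1 + a * x)) \<le> a * (y / (1 + a * y))"
      using True xy a by (intro mult_left_mono ratio_mono) auto
    then show ?thesis using True xy by (simp add: Phi_def)
  next
    case False
    then show ?thesis using a by (auto simp: Phi_def)
  qed
next
  fix x :: real
  show "continuous (at_right x) (Phi a)"
    unfolding Phi_def[abs_def]
  proof (rule continuous_at_right_cut)
    fix v :: real assume "v \<ge> 0"
    then have "1 + a * v > 0" using a by (intro add_pos_nonneg) auto
    then show "isCont (\<lambda>v. a * v / (1 + a * v)) v" by (intro continuous_intros) auto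
  qed
  show "Phi a x \<le> 1" using a by (auto simp: Phi_def divide_le_eq_1 add_pos_nonneg)
next
  fix x :: real assume "x \<le> 0" then show "Phi a x = 0" by (cases "x = 0") (auto simp: Phi_def)
next
  show "0 \<le> c\<alpha> * a powr \<alpha>" using c\<alpha>_pos by simp
  have "(\<integral>\<^sup>+z. ennreal (indicator {0..} z * (Phi a (1 / z) * (\<alpha> * z powr (\<alpha> - 1)))) \<partial>lborel)
     = (\<integral>\<^sup>+z. ennreal a * ennreal (indicator {0..} z * (1 / (z + a) * (\<alpha> * z powr (\<alpha> - 1)))) \<partial>lborel)"
  proof (rule nn_integral_cong)
    fix z :: real
    show "ennreal (indicator {0..} z * (Phi a (1 / z) * (\<alpha> * z powr (\<alpha> - 1))))
      = ennreal a * ennreal (indicator {0..} z * (1 / (z + a) * (\<alpha> * z powr (\<alpha> - 1))))"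
    proof (cases "z > 0")
      case True
      have "Phi a (1 / z) = a * (1 / (z + a))" using True a by (simp add: Phi_def field_simps)
      then show ?thesis using True a by (simp add: ennreal_mult'[symmetric])
    qed (cases "z = 0", auto)
  qed
  also have "\<dots> = ennreal a * ennreal (\<alpha> * Gamma \<alpha> * Gamma (1 - \<alpha>) * a powr (\<alpha> - 1))"
    using \<alpha> a by (intro nn_integral_cmult_eq[OF _ nn_integral_Stieltjes]) auto
  also have "\<dots> = ennreal (c\<alpha> * a powr \<alpha>)"
  proof -
    have "a * a powr (\<alpha> - 1) = a powr \<alpha>" using a by (simp add: powr_diff)
    then have "a * (\<alpha> * Gamma \<alpha> * Gamma (1 - \<alpha>) * a powr (\<alpha> - 1)) = c\<alpha> * a powr \<alpha>"
      by (metis c\<alpha>_def mult.left_commute)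
    then show ?thesis using a by (simp only: ennreal_mult'[symmetric])
  qed
  finally show "(\<integral>\<^sup>+z. ennreal (indicator {0..} z * (Phi a (1 / z) * (\<alpha> * z powr (\<alpha> - 1)))) \<partial>lborel)
     = ennreal (c\<alpha> * a powr \<alpha>)" .
qed

lemma limW_ratio_finite:
  assumes a: "a > 0" and \<theta>: "\<theta> \<ge> 0"
  shows "(\<integral>\<^sup>+z. ennreal (limW \<alpha> \<theta> 0 q z / (z + a)) \<partial>lborel) < \<infinity>"
proof -
  have "(\<integral>\<^sup>+z. ennreal (limW \<alpha> \<theta> 0 q z / (z + a)) \<partial>lborel)
     \<le> (\<integral>\<^sup>+z. ennreal (indicator {0..} z * (1 / (z + a) * (\<alpha> * z powr (\<alpha> - 1)))) \<partial>lborel)"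
  proof (intro nn_integral_mono ennreal_leI)
    fix z :: real
    show "limW \<alpha> \<theta> 0 q z / (z + a) \<le> indicator {0..} z * (1 / (z + a) * (\<alpha> * z powr (\<alpha> - 1)))"
    proof (cases "z \<in> {0<..q}")
      case True
      then have "exp (- (\<theta> * z)) \<le> 1" using \<theta> by simp
      then have "exp (- (\<theta> * z)) * (\<alpha> * z powr (\<alpha> - 1)) \<le> 1 * (\<alpha> * z powr (\<alpha> - 1))"
        using \<alpha> by (intro mult_right_mono) auto
      then show ?thesis using True a by (simp add: limW_def divide_right_mono)
    next
      case False
      then show ?thesis using a \<alpha> by (auto simp: limW_def indicator_def)
    qed
  qed
  also have "\<dots> < \<infinity>" using nn_integral_Stieltjes[OF \<alpha> a] by simp
  finally show ?thesis .
qed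

lemma ennreal_E:
  assumes "a > 0" "\<theta> \<ge> 0"
  shows "ennreal (E a \<theta> q) = (\<integral>\<^sup>+z. ennreal (limW \<alpha> \<theta> 0 q z / (z + a)) \<partial>lborel)"
  unfolding E_def using limW_ratio_finite[OF assms] by (simp add: less_top)

lemma E_diff:
  assumes a: "a > 0" and \<theta>: "\<theta> \<ge> 0" and pq: "0 \<le> p" "p \<le> q"
  shows "ennreal (E a \<theta> q - E a \<theta> p) = (\<integral>\<^sup>+z. ennreal (limW \<alpha> \<theta> p q z / (z + a)) \<partial>lborel)" and "E a \<theta> p \<le> E a \<theta> q"
proof -
  have "ennreal (E a \<theta> q) = (\<integral>\<^sup>+z. ennreal (limW \<alpha> \<theta> 0 p z / (z + a)) + ennreal (limW \<alpha> \<theta> p q z / (z + a)) \<partial>lborel)"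
    unfolding ennreal_E[OF a \<theta>]
  proof (rule nn_integral_cong)
    fix z :: real
    have "limW \<alpha> \<theta> 0 q z = limW \<alpha> \<theta> 0 p z + limW \<alpha> \<theta> p q z"
      using pq by (auto simp: limW_def indicator_def)
    moreover have "limW \<alpha> \<theta> r s z / (z + a) \<ge> 0" if "r \<ge> 0" for r s
      using \<alpha> a that by (auto simp: limW_def indicator_def)
    ultimately show "ennreal (limW \<alpha> \<theta> 0 q z / (z + a)) = ennreal (limW \<alpha> \<theta> 0 p z / (z + a)) + ennreal (limW \<alpha> \<theta> p q z / (z + a))"
      using pq by (subst ennreal_plus[symmetric]) (auto simp: add_divide_distrib)
  qed
  also have "\<dots> = ennreal (E a \<theta> p) + (\<integral>\<^sup>+z. ennreal (limW \<alpha> \<theta> p q z / (z + a)) \<partial>lborel)"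
    unfolding ennreal_E[OF a \<theta>] by (rule nn_integral_add) measurable
  finally have eq: "ennreal (E a \<theta> q) = ennreal (E a \<theta> p) + (\<integral>\<^sup>+z. ennreal (limW \<alpha> \<theta> p q z / (z + a)) \<partial>lborel)" .
  have E0: "E a \<theta> r \<ge> 0" for r by (simp add: E_def)
  have "ennreal (E a \<theta> p) \<le> ennreal (E a \<theta> q)" unfolding eq by simp
  then show "E a \<theta> p \<le> E a \<theta> q" using E0 by simp
  show "ennreal (E a \<theta> q - E a \<theta> p) = (\<integral>\<^sup>+z. ennreal (limW \<alpha> \<theta> p q z / (z + a)) \<partial>lborel)"
    using E0 by (simp add: ennreal_minus[symmetric] eq)
qed

lemma test_fun_PhiC:
  assumes a: "a \<ge> 1" and \<theta>: "\<theta> \<ge> 0" and \<delta>: "\<delta> > 0"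
  shows "test_fun (PhiC a \<theta> \<delta>) (E a \<theta> (1 / \<delta>))"
  unfolding test_fun_def
proof (intro conjI allI impI)
  fix x y :: real assume xy: "x \<le> y"
  show "PhiC a \<theta> \<delta> x \<le> PhiC a \<theta> \<delta> y"
  proof (cases "x \<ge> \<delta>")
    case True
    have "\<theta> / y \<le> \<theta> / x" using True xy \<theta> \<delta> by (intro divide_left_mono) auto
    then have "exp (- (\<theta> / x)) * (x / (1 + a * x)) \<le> exp (- (\<theta> / y)) * (y / (1 + a * y))"
      using True xy a \<delta> by (intro mult_mono ratio_mono) (auto intro!: divide_nonneg_nonneg)
    then show ?thesis using True xy by (simp add: PhiC_def)
  next
    case False
    then show ?thesis using a \<delta> by (auto simp: PhiC_def intro!: mult_nonneg_nonneg divide_nonneg_nonneg)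
  qed
next
  fix x :: real
  show "continuous (at_right x) (PhiC a \<theta> \<delta>)"
    unfolding PhiC_def[abs_def]
  proof (rule continuous_at_right_cut)
    fix v :: real assume v: "v \<ge> \<delta>"
    then have "1 + a * v > 0" using a \<delta> by (intro add_pos_nonneg) auto
    then show "isCont (\<lambda>v. exp (- (\<theta> / v)) * (v / (1 + a * v))) v"
      using v \<delta> by (intro continuous_intros) auto
  qed
  show "PhiC a \<theta> \<delta> x \<le> 1"
  proof (cases "x \<ge> \<delta>")
    case True
    have "1 * x \<le> a * x" using True a \<delta> by (intro mult_right_mono) auto
    then have "x \<le> 1 + a * x" "0 < 1 + a * x" using True \<delta> by linarith+
    then have "x / (1 + a * x) \<le> 1" by (simp add: divide_le_eq_1_pos)
    moreover have "exp (- (\<theta> / x)) \<le> 1" using True \<theta> \<delta> by simp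
    ultimately have "exp (- (\<theta> / x)) * (x / (1 + a * x)) \<le> 1 * 1"
      using True a \<delta> by (intro mult_mono) (auto intro!: divide_nonneg_nonneg)
    then show ?thesis by (simp add: PhiC_def)
  qed (simp add: PhiC_def)
next
  fix x :: real assume "x \<le> 0" then show "PhiC a \<theta> \<delta> x = 0" using \<delta> by (simp add: PhiC_def)
next
  show "0 \<le> E a \<theta> (1 / \<delta>)" by (simp add: E_def)
  have "ennreal (E a \<theta> (1 / \<delta>)) = (\<integral>\<^sup>+z. ennreal (limW \<alpha> \<theta> 0 (1 / \<delta>) z / (z + a)) \<partial>lborel)"
    using a \<theta> by (intro ennreal_E) auto
  also have "\<dots> = (\<integral>\<^sup>+z. ennreal (indicator {0..} z * (PhiC a \<theta> \<delta> (1 / z) * (\<alpha> * z powr (\<alpha> - 1)))) \<partial>lborel)"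
  proof (intro nn_integral_cong arg_cong[where f = ennreal])
    fix z :: real
    show "limW \<alpha> \<theta> 0 (1 / \<delta>) z / (z + a) = indicator {0..} z * (PhiC a \<theta> \<delta> (1 / z) * (\<alpha> * z powr (\<alpha> - 1)))"
    proof (cases "z > 0")
      case True
      have 1: "\<delta> \<le> 1 / z \<longleftrightarrow> z \<le> 1 / \<delta>" using True \<delta> by (simp add: field_simps)
      have 2: "1 / z / (1 + a * (1 / z)) = 1 / (z + a)" using True a by (simp add: field_simps)
      have 3: "\<theta> / (1 / z) = \<theta> * z" by simp
      show ?thesis using True unfolding limW_def PhiC_def 1 2 3 by (simp add: indicator_def)
    qed (cases "z = 0", auto simp: limW_def)
  qed
  finally show "(\<integral>\<^sup>+z. ennreal (indicator {0..} z * (PhiC a \<theta> \<delta> (1 / z) * (\<alpha> * z powr (\<alpha> - 1)))) \<partial>lborel)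
     = ennreal (E a \<theta> (1 / \<delta>))" ..
qed

text \<open>Integer \<open>a\<close> and \<open>j\<close> keep this a countable conjunction. The
  value 0 beside \<open>\<theta>\<close> serves to measure the mass carried by a window.\<close>

definition good :: "real \<Rightarrow> 'w \<Rightarrow> bool" where
  "good \<theta> \<omega> \<longleftrightarrow> \<omega> \<in> space M \<and>
    (\<forall>a::nat. a \<ge> 1 \<longrightarrow> (\<lambda>n. (\<Sum>x\<in>torus n. Phi a (\<tau> \<omega> x / U n)) / Mn n) \<longlonglongrightarrow> c\<alpha> * a powr \<alpha>) \<and>
    (\<forall>(a::nat) (j::nat). a \<ge> 1 \<longrightarrow> (\<forall>\<theta>'\<in>{0, \<theta>}. \<forall>\<delta>\<in>{1 / real (Suc j), real (Suc j)}.
       (\<lambda>n. (\<Sum>x\<in>torus n. PhiC a \<theta>' \<delta> (\<tau> \<omega> x / U n)) / Mn n) \<longlonglongrightarrow> E a \<theta>' (1 / \<delta>))) \<and>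
    (\<lambda>n. \<Sum>x\<in>torus n. \<Sum>z\<in>nearset n x. Phi 1 (\<tau> \<omega> x / U n) * Phi 1 (\<tau> \<omega> z / U n)) \<longlonglongrightarrow> 0 \<and>
    (\<lambda>n. Mn n * (\<Sum>z\<in>nearset n (0,0). Phi 1 (\<tau> \<omega> z / U n))) \<longlonglongrightarrow> 0"

lemma AE_good:
  assumes \<theta>: "\<theta> \<ge> 0"
  shows "AE \<omega> in M. good \<theta> \<omega>"
proof -
  have 1: "AE \<omega> in M. (\<lambda>n. (\<Sum>x\<in>torus n. Phi (real a) (\<tau> \<omega> x / U n)) / Mn n) \<longlonglongrightarrow> c\<alpha> * real a powr \<alpha>"
    if "a \<ge> 1" for a :: nat
    using that by (intro lln test_fun_Phi) auto
  have h1: "AE \<omega> in M. \<forall>a::nat. a \<ge> 1 \<longrightarrow>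
      (\<lambda>n. (\<Sum>x\<in>torus n. Phi a (\<tau> \<omega> x / U n)) / Mn n) \<longlonglongrightarrow> c\<alpha> * a powr \<alpha>"
    unfolding AE_all_countable using 1 by (intro allI AE_impI) auto
  have 2: "AE \<omega> in M. \<forall>\<theta>'\<in>{0, \<theta>}. \<forall>\<delta>\<in>{1 / real (Suc j), real (Suc j)}.
       (\<lambda>n. (\<Sum>x\<in>torus n. PhiC (real a) \<theta>' \<delta> (\<tau> \<omega> x / U n)) / Mn n) \<longlonglongrightarrow> E (real a) \<theta>' (1 / \<delta>)"
    if "a \<ge> 1" for a j :: nat
    using \<theta> that by (intro AE_finite_allI lln test_fun_PhiC) auto
  have 3: "AE \<omega> in M. \<forall>(a::nat) (j::nat). a \<ge> 1 \<longrightarrow> (\<forall>\<theta>'\<in>{0, \<theta>}. \<forall>\<delta>\<in>{1 / real (Suc j), real (Suc j)}.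
       (\<lambda>n. (\<Sum>x\<in>torus n. PhiC a \<theta>' \<delta> (\<tau> \<omega> x / U n)) / Mn n) \<longlonglongrightarrow> E a \<theta>' (1 / \<delta>))"
    unfolding AE_all_countable using 2 by (intro allI AE_impI) auto
  have p1: "test_fun (Phi 1) (c\<alpha> * 1 powr \<alpha>)" by (rule test_fun_Phi) simp
  show ?thesis
    using h1 3 near_pairs_tendsto_0[OF p1] AE_space
  proof eventually_elim
    case (elim \<omega>)
    then show ?case unfolding good_def by blast
  qed
qed

lemma tendsto_real_powr_neg: "c > 0 \<Longrightarrow> (\<lambda>n. real n powr (- c)) \<longlonglongrightarrow> 0"
  using tendsto_neg_powr[OF _ filterlim_real_sequentially, of "- c"] by simp

text \<open>The quotient b/g is of order n^(-1/4) and \<open>Mn n\<close> of order n^\<gamma>, with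
  \<gamma> - 1/4 negative.\<close>

lemma b_over_g_tendsto: "(\<lambda>n. b n / g n) \<longlonglongrightarrow> 0" "(\<lambda>n. b n / g n * Mn n) \<longlonglongrightarrow> 0"
proof -
  have bg: "b n / g n \<le> 64 * real n powr (- (1/4))" "b n / g n \<ge> 0" if "n \<ge> 1" for n
  proof -
    have "b n / g n \<le> b n / (real n / 64)"
      using that g_bounds[OF that] by (intro divide_left_mono) (auto simp: b_def g_pos)
    also have "\<dots> = 64 * (real n powr (3/4) / real n powr 1)" using that by (simp add: b_def)
    also have "real n powr (3/4) / real n powr 1 = real n powr (3/4 - 1)" by (rule powr_diff[symmetric])
    finally show "b n / g n \<le> 64 * real n powr (- (1/4))" by simp
    show "b n / g n \<ge> 0" using g_pos[OF that] by (simp add: b_def)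
  qed
  show "(\<lambda>n. b n / g n) \<longlonglongrightarrow> 0"
  proof (rule tendsto_sandwich[OF _ _ tendsto_const])
    show "eventually (\<lambda>n. 0 \<le> b n / g n) sequentially" "eventually (\<lambda>n. b n / g n \<le> 64 * real n powr (- (1/4))) sequentially"
      using eventually_ge_at_top[of 1] by (eventually_elim, simp add: bg)+
    show "(\<lambda>n. 64 * real n powr (- (1/4))) \<longlonglongrightarrow> 0"
      using tendsto_mult[OF tendsto_const[of 64] tendsto_real_powr_neg[of "1/4"]] by simp
  qed
  show "(\<lambda>n. b n / g n * Mn n) \<longlonglongrightarrow> 0"
  proof (rule tendsto_sandwich[OF _ _ tendsto_const])
    show "eventually (\<lambda>n. 0 \<le> b n / g n * Mn n) sequentially"
      using eventually_ge_at_top[of 1] by eventually_elim (intro mult_nonneg_nonneg bg less_imp_le[OF Mn_pos])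
    show "eventually (\<lambda>n. b n / g n * Mn n \<le> 64 * 24 powr \<alpha> * real n powr (- (1/4 - \<gamma>))) sequentially"
      using eventually_ge_at_top[of 1]
    proof eventually_elim
      case (elim n)
      have "b n / g n * Mn n \<le> (64 * real n powr (- (1/4))) * (24 powr \<alpha> * real n powr \<gamma>)"
        using elim bg Mn_bounds(2) Mn_pos[of n] by (intro mult_mono) auto
      also have "\<dots> = 64 * 24 powr \<alpha> * (real n powr (- (1/4)) * real n powr \<gamma>)" by simp
      also have "real n powr (- (1/4)) * real n powr \<gamma> = real n powr (- (1/4 - \<gamma>))" by (simp flip: powr_add)
      finally show ?case .
    qed
    show "(\<lambda>n. 64 * 24 powr \<alpha> * real n powr (- (1/4 - \<gamma>))) \<longlonglongrightarrow> 0"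
      using tendsto_mult[OF tendsto_const[of "64 * 24 powr \<alpha>"] tendsto_real_powr_neg[of "1/4 - \<gamma>"]] \<gamma> by simp
  qed
qed

lemma Mn_at_top: "filterlim Mn at_top sequentially"
proof (rule filterlim_at_top_mono)
  have "filterlim (\<lambda>n. exp (\<gamma> * ln (real n))) at_top sequentially"
    using \<gamma> by (intro filterlim_compose[OF exp_at_top] filterlim_tendsto_pos_mult_at_top[OF tendsto_const]
      filterlim_compose[OF ln_at_top filterlim_real_sequentially]) auto
  moreover have "eventually (\<lambda>n. exp (\<gamma> * ln (real n)) = real n powr \<gamma>) sequentially"
    using eventually_ge_at_top[of 1] by eventually_elim (simp add: powr_def)
  ultimately have "filterlim (\<lambda>n. real n powr \<gamma>) at_top sequentially"
    by (rule filterlim_mono_eventually[OF _ order_refl order_refl])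
  then show "filterlim (\<lambda>n. (1/64) powr \<alpha> * real n powr \<gamma>) at_top sequentially"
    by (rule filterlim_tendsto_pos_mult_at_top[OF tendsto_const, rotated]) simp
  show "eventually (\<lambda>n. (1/64) powr \<alpha> * real n powr \<gamma> \<le> Mn n) sequentially"
    using eventually_ge_at_top[of 1] by eventually_elim (rule Mn_bounds)
qed

end

text \<open>A typical environment is frozen; what follows inside this locale are deterministic
  limits in n.\<close>

locale good_env = trap_environment +
  fixes \<theta> :: real and \<omega> :: 'a
  assumes \<theta>_nonneg: "\<theta> \<ge> 0" and good: "good \<theta> \<omega>"
begin

definition v :: "nat \<Rightarrow> int \<times> int \<Rightarrow> real" where "v n x = \<tau> \<omega> x / U n"
text \<open>The quantity gK of \<open>trap_green\<close> for the torus of level n, of order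
  \<open>Mn n\<close>.\<close>

definition kap :: "real \<Rightarrow> nat \<Rightarrow> real" where "kap a n = (\<Sum>x\<in>torus n. Phi a (v n x))"
definition S :: "nat \<Rightarrow> real" where "S n = (\<Sum>x\<in>torus n. \<Sum>z\<in>nearset n x. Phi 1 (v n x) * Phi 1 (v n z))"
definition Z :: "nat \<Rightarrow> real" where "Z n = (\<Sum>z\<in>nearset n (0,0). Phi 1 (v n z))"
abbreviation "Gr n \<equiv> btm.Gr n (\<tau> \<omega>) (T n)"
abbreviation "P n \<equiv> btm.P n (\<tau> \<omega>) (T n)"
abbreviation "J n \<equiv> btm.J n (\<tau> \<omega>) (T n)"

lemma \<omega>_space: "\<omega> \<in> space M" using good by (simp add: good_def)

lemma t_pos: "\<tau> \<omega> x > 0" using \<tau>_pos \<omega>_space by blast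

lemma btm: "n \<ge> 1 \<Longrightarrow> btm (\<tau> \<omega>) (T n)"
  by unfold_locales (use t_pos T_pos in auto)

lemma v_pos: "v n x > 0" using t_pos U_pos[of n] by (simp add: v_def)

lemma v_eq: "n \<ge> 1 \<Longrightarrow> v n x = g n * \<tau> \<omega> x / T n"
  by (simp add: v_def U_def)

lemma Phi_v: "Phi a (v n x) = a * v n x / (1 + a * v n x)"
  using v_pos[of n x] by (simp add: Phi_def)

lemma kap_tendsto: "(a::nat) \<ge> 1 \<Longrightarrow> (\<lambda>n. kap a n / Mn n) \<longlonglongrightarrow> c\<alpha> * a powr \<alpha>"
  using good by (simp add: good_def kap_def v_def)

lemma S_tendsto: "S \<longlonglongrightarrow> 0"
  using good by (simp add: good_def S_def[abs_def] v_def)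

lemma MZ_tendsto: "(\<lambda>n. Mn n * Z n) \<longlonglongrightarrow> 0"
  using good by (simp add: good_def Z_def v_def)

lemma Z_nonneg: "Z n \<ge> 0"
  unfolding Z_def Phi_v using v_pos by (intro sum_nonneg) (auto simp: less_imp_le add_pos_pos)

lemma kap_at_top: "(a::nat) \<ge> 1 \<Longrightarrow> filterlim (kap a) at_top sequentially"
proof -
  assume a: "a \<ge> 1"
  have "filterlim (\<lambda>n. kap a n / Mn n * Mn n) at_top sequentially"
    by (rule filterlim_tendsto_pos_mult_at_top[OF kap_tendsto[OF a] _ Mn_at_top])
       (use c\<alpha>_pos a in simp)
  moreover have "kap a n / Mn n * Mn n = kap a n" for n using Mn_pos[of n] by simp
  ultimately show ?thesis by simp
qed

lemma v0_tendsto: "(\<lambda>n. v n (0,0)) \<longlonglongrightarrow> 0"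
  unfolding v_def by (rule tendsto_divide_0[OF tendsto_const filterlim_at_top_imp_at_infinity[OF U_at_top]])

text \<open>The errors of \<open>trap_green\<close> depend on y only through 1/\<psi>(y), which is
  at most (1+\<delta>)/\<delta> on the traps considered; this makes them uniform in y.\<close>

lemma uniform_green:
  fixes a :: nat
  assumes a: "a \<ge> 1" and \<delta>: "\<delta> > 0" and \<epsilon>: "\<epsilon> > 0"
  shows "eventually (\<lambda>n. \<forall>y\<in>torus n. \<delta> \<le> v n y \<longrightarrow>
     \<bar>(1 + real a * v n y) * Gr n a y y / g n - 1\<bar> \<le> \<epsilon> \<and>
     \<bar>kap a n / g n * Gr n a (0,0) y - 1 / (1 + real a * v n y)\<bar> \<le> \<epsilon>) sequentially"
proof -
  define \<psi>0 where "\<psi>0 = \<delta> / (1 + \<delta>)"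
  have \<psi>0: "\<psi>0 > 0" using \<delta> by (simp add: \<psi>0_def)
  define bK where "bK = (\<lambda>n. b n / g n * kap a n)"
  have "(\<lambda>n. b n / g n * Mn n * (kap a n / Mn n)) \<longlonglongrightarrow> 0 * (c\<alpha> * a powr \<alpha>)"
    by (rule tendsto_mult[OF b_over_g_tendsto(2) kap_tendsto[OF a]])
  moreover have "b n / g n * Mn n * (kap a n / Mn n) = bK n" for n
    using Mn_pos[of n] by (simp add: bK_def)
  ultimately have bK: "bK \<longlonglongrightarrow> 0" by simp
  have "(\<lambda>n. (kap a n / Mn n) * (Mn n * Z n)) \<longlonglongrightarrow> (c\<alpha> * a powr \<alpha>) * 0"
    by (rule tendsto_mult[OF kap_tendsto[OF a] MZ_tendsto])
  moreover have "(kap a n / Mn n) * (Mn n * Z n) = kap a n * Z n" for n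
    using Mn_pos[of n] by simp
  ultimately have kZ: "(\<lambda>n. kap a n * Z n) \<longlonglongrightarrow> 0" by simp
  have kinv: "(\<lambda>n. 1 / kap a n) \<longlonglongrightarrow> 0"
    by (rule tendsto_divide_0[OF tendsto_const filterlim_at_top_imp_at_infinity[OF kap_at_top[OF a]]])
  \<comment> \<open>\<open>e\<close> bounds \<open>err\<close>, \<open>r1\<close> the diagonal and
    \<open>r2\<close> the off-diagonal error, with 1/\<psi> replaced by 1/\<psi>0. The last term of
    \<open>r2\<close> removes the factor 1 + av of the starting point.\<close>
  define e where "e = (\<lambda>n. 2 * bK n + 10 * (real a)\<^sup>2 * S n + real a * S n / \<psi>0)"
  have e: "e \<longlonglongrightarrow> 0"
    unfolding e_def
    by (intro tendsto_add_zero tendsto_mult_right_zero tendsto_divide_zero bK S_tendsto)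
  define r1 where "r1 = (\<lambda>n. (1 + e n) * (1 / kap a n) + b n / g n + 10 * real a * (S n / \<psi>0))"
  have "(\<lambda>n. (1 + e n) * (1 / kap a n)) \<longlonglongrightarrow> (1 + 0) * 0"
    by (intro tendsto_mult tendsto_add tendsto_const e kinv)
  then have r1: "r1 \<longlonglongrightarrow> 0"
    unfolding r1_def
    by (intro tendsto_add_zero tendsto_mult_right_zero tendsto_divide_zero b_over_g_tendsto S_tendsto) simp
  define r2 where "r2 = (\<lambda>n. e n + 2 * bK n + 10 * real a * (kap a n * Z n) + real a * v n (0,0))"
  have r2: "r2 \<longlonglongrightarrow> 0"
    unfolding r2_def by (intro tendsto_add_zero tendsto_mult_right_zero e bK kZ v0_tendsto)
  have MZ1: "eventually (\<lambda>n. Mn n * Z n < \<psi>0) sequentially" using order_tendstoD(2)[OF MZ_tendsto \<psi>0] .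
  have M1: "eventually (\<lambda>n. Mn n \<ge> 1) sequentially" using Mn_at_top by (simp add: filterlim_at_top)
  have k1: "eventually (\<lambda>n. kap a n \<ge> 1) sequentially" using kap_at_top[OF a] by (simp add: filterlim_at_top)
  show ?thesis
    using order_tendstoD(2)[OF r1 \<epsilon>] order_tendstoD(2)[OF r2 \<epsilon>] order_tendstoD(2)[OF v0_tendsto \<delta>]
      MZ1 M1 k1 eventually_ge_at_top[of 1]
  proof eventually_elim
    case (elim n)
    interpret bt: btm n "\<tau> \<omega>" "T n" by (rule btm[OF elim(7)])
    interpret tg: trap_green "torus n" "\<lambda>x z. green n (x - z)" "Gr n a" "\<lambda>y. (\<Sum>x\<in>torus n. Gr n a x y) / 4 ^ n" "v n" "real a" "g n" "b n"
    proof (rule bt.trap_green_btm)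
      show "g n = green n (0,0)" by (simp add: g_def)
      show "v n x = g n * \<tau> \<omega> x / T n" for x by (rule v_eq[OF elim(7)])
      show "1 \<le> (\<Sum>x\<in>torus n. a * v n x / (1 + real a * v n x))"
        using elim(6) by (simp add: kap_def Phi_v)
    qed (use a g_pos[OF elim(7)] in \<open>auto simp: b_def\<close>)
    have near: "tg.near x = nearset n x" for x by (simp add: tg.near_def nearset_def)
    have psi: "tg.\<psi> x = Phi 1 (v n x)" for x by (simp add: tg.\<psi>_def Phi_v)
    have Seq: "tg.S = S n" by (simp add: tg.S_def S_def near psi)
    have gK: "g n * tg.K = kap a n" unfolding tg.gK kap_def Phi_v ..
    then have Keq: "tg.K = kap a n / g n" using g_pos[OF elim(7)] by (simp add: field_simps)
    have bKeq: "2 * b n * tg.K = 2 * bK n" by (simp add: Keq bK_def)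
    show ?case
    proof (intro ballI impI)
      fix y assume y: "y \<in> torus n" and vy: "\<delta> \<le> v n y"
      have psi_y: "\<psi>0 \<le> tg.\<psi> y"
        unfolding \<psi>0_def tg.\<psi>_def using ratio_mono[of 1 \<delta> "v n y"] \<delta> vy by simp
      have Sy: "S n / tg.\<psi> y \<le> S n / \<psi>0"
        using psi_y \<psi>0 tg.S_nonneg unfolding Seq by (intro divide_left_mono) auto
      have err_le: "tg.err y \<le> e n"
      proof -
        have "real a * (S n / tg.\<psi> y) \<le> real a * (S n / \<psi>0)" using Sy by (intro mult_left_mono) auto
        then show ?thesis by (simp add: tg.err_def e_def Seq bKeq)
      qed
      have "\<bar>(1 + real a * v n y) * Gr n a y y / g n - 1\<bar> \<le> (1 + tg.err y) / (g n * tg.K) + b n / g n + 10 * real a * (tg.S / tg.\<psi> y)"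
        by (rule tg.G_diag_approx[OF y])
      also have "\<dots> \<le> r1 n"
        unfolding gK Seq r1_def using err_le elim(6) Sy
        by (intro add_mono mult_left_mono) (auto simp: divide_right_mono)
      finally have 1: "\<bar>(1 + real a * v n y) * Gr n a y y / g n - 1\<bar> \<le> \<epsilon>" using elim(1) by linarith
      have y0: "y \<noteq> (0,0)" using elim(3) vy by auto
      \<comment> \<open>A near site y with v \<ge> \<delta> alone would force Z \<ge> \<psi>0,
        whereas \<open>Mn n * Z n\<close> is already below \<psi>0 and \<open>Mn n\<close> at least
        1.\<close>
      have far: "\<bar>green n ((0,0) - y)\<bar> \<le> b n"
      proof (rule ccontr)
        assume "\<not> ?thesis"
        then have "y \<in> nearset n (0,0)" using y y0 by (auto simp: nearset_def)
        then have "Phi 1 (v n y) \<le> Z n" unfolding Z_def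
          by (rule member_le_sum) (auto simp: nearset_def Phi_v less_imp_le[OF v_pos] add_nonneg_nonneg)
        then have "\<psi>0 \<le> Z n" using psi_y by (simp add: psi)
        also have "Z n \<le> Mn n * Z n" using elim(5) Z_nonneg[of n] by (simp add: mult_le_cancel_right1)
        finally show False using elim(4) by simp
      qed
      define q where "q = tg.K * Gr n a (0,0) y"
      define w where "w = a * v n (0,0)"
      have w0: "w > 0" using v_pos[of n "(0,0)"] a by (simp add: w_def)
      have "\<bar>tg.K * ((1 + real a * v n (0,0)) * Gr n a (0,0) y) - 1 / (1 + real a * v n y)\<bar>
         \<le> tg.err y + 2 * b n * tg.K + 10 * real a * (g n * tg.K * (\<Sum>z\<in>tg.near (0,0). tg.\<psi> z))"
        by (rule tg.G_offdiag_approx[OF zero_in_torus y far])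
      also have "\<dots> \<le> e n + 2 * bK n + 10 * real a * (kap a n * Z n)"
        unfolding gK near psi Z_def[symmetric] using err_le bKeq by simp
      finally have "\<bar>(1 + w) * q - 1 / (1 + real a * v n y)\<bar> \<le> e n + 2 * bK n + 10 * real a * (kap a n * Z n)"
        by (simp add: q_def w_def mult_ac)
      moreover have "\<bar>q - 1 / (1 + real a * v n y)\<bar> \<le> \<bar>(1 + w) * q - 1 / (1 + real a * v n y)\<bar> + w"
      proof -
        define u where "u = 1 / (1 + real a * v n y)"
        have u: "0 \<le> u" "u \<le> 1" using v_pos[of n y] by (auto simp: u_def divide_le_eq_1 add_pos_nonneg)
        have "(1 + w) * (q - u) = ((1 + w) * q - u) - w * u" by (simp add: algebra_simps)
        then have "(1 + w) * \<bar>q - u\<bar> = \<bar>((1 + w) * q - u) - w * u\<bar>" using w0 by (metis abs_mult abs_of_pos add_pos_pos zero_less_one)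
        also have "\<dots> \<le> \<bar>(1 + w) * q - u\<bar> + \<bar>w * u\<bar>" by (rule abs_triangle_ineq4)
        also have "\<bar>w * u\<bar> \<le> w" using w0 u by (simp add: abs_mult mult_left_le)
        finally have "(1 + w) * \<bar>q - u\<bar> \<le> \<bar>(1 + w) * q - u\<bar> + w" by simp
        moreover have "1 * \<bar>q - u\<bar> \<le> (1 + w) * \<bar>q - u\<bar>" using w0 by (intro mult_right_mono) auto
        ultimately show ?thesis by (simp add: u_def)
      qed
      ultimately have "\<bar>q - 1 / (1 + real a * v n y)\<bar> \<le> r2 n" by (simp add: r2_def w_def)
      then have "\<bar>kap a n / g n * Gr n a (0,0) y - 1 / (1 + real a * v n y)\<bar> \<le> \<epsilon>"
        using elim(2) by (simp add: q_def Keq)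
      with 1 show "\<bar>(1 + real a * v n y) * Gr n a y y / g n - 1\<bar> \<le> \<epsilon> \<and>
        \<bar>kap a n / g n * Gr n a (0,0) y - 1 / (1 + real a * v n y)\<bar> \<le> \<epsilon>" by blast
    qed
  qed
qed

end

lemma exp_neg_lipschitz:
  fixes x y :: real
  assumes "x \<ge> 0" "y \<ge> 0"
  shows "\<bar>exp (- x) - exp (- y)\<bar> \<le> \<bar>x - y\<bar>"
proof -
  have *: "exp (- x) - exp (- y) \<le> y - x" "exp (- y) \<le> exp (- x)" if "0 \<le> x" "x \<le> y" for x y :: real
  proof -
    have "exp (- x) - exp (- y) = exp (- x) * (1 - exp (- (y - x)))"
      by (simp add: right_diff_distrib flip: exp_add)
    also have "\<dots> \<le> 1 * (y - x)"
    proof (rule mult_mono)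
      show "1 - exp (- (y - x)) \<le> y - x" using exp_ge_add_one_self[of "- (y - x)"] by linarith
    qed (use that in auto)
    finally show "exp (- x) - exp (- y) \<le> y - x" by simp
    show "exp (- y) \<le> exp (- x)" using that by simp
  qed
  show ?thesis
  proof (cases "x \<le> y")
    case True
    then show ?thesis using *[OF assms(1) True] by (simp add: abs_of_nonneg)
  next
    case False
    then have "y \<le> x" by simp
    from *[OF assms(2) this] False show ?thesis by (simp add: abs_if)
  qed
qed

section \<open>The limit function of a window of depths\<close>

context trap_environment
begin

text \<open>The normalisation makes the Laplace transform equal to (E q - E p)/(c\<alpha>
  a^\<alpha>), the limit obtained for the chain in \<open>Laplace_tendsto\<close>.\<close>

definition hlim :: "real \<Rightarrow> real \<Rightarrow> real \<Rightarrow> real \<Rightarrow> real" where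
  "hlim \<theta> p q t = enn2real (limH \<alpha> \<theta> p q t) / (c\<alpha> * Gamma \<alpha>)"

lemma cG_pos: "c\<alpha> * Gamma \<alpha> > 0"
  using c\<alpha>_pos Gamma_real_pos \<alpha> by simp

lemma hlim_nonneg: "hlim \<theta> p q t \<ge> 0"
  using cG_pos by (simp add: hlim_def)

lemma hlim_measurable [measurable]: "hlim \<theta> p q \<in> borel_measurable borel"
  unfolding hlim_def[abs_def] by measurable

lemma ennreal_limH:
  assumes "0 \<le> p" "p \<le> q" "t \<ge> 0" "\<theta> \<ge> 0"
  shows "ennreal (enn2real (limH \<alpha> \<theta> p q t)) = limH \<alpha> \<theta> p q t"
  using limH_finite[OF \<alpha>(1) assms] by (simp add: less_top)

lemma hlim_Laplace:
  assumes pq: "0 \<le> p" "p \<le> q" and \<theta>: "\<theta> \<ge> 0" and a: "a > 0"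
  shows "set_integrable lborel {0..} (\<lambda>s. hlim \<theta> p q s * exp (- (a * s)))"
    and "(LBINT s:{0..}. hlim \<theta> p q s * exp (- (a * s))) = (E a \<theta> q - E a \<theta> p) / (c\<alpha> * a powr \<alpha>)"
proof -
  define L where "L = Gamma \<alpha> * a powr (- \<alpha>) * (E a \<theta> q - E a \<theta> p)"
  have "has_bochner_integral lborel (\<lambda>s. indicator {0..} s * exp (- (a * s)) * enn2real (limH \<alpha> \<theta> p q s)) L"
  proof (rule has_bochner_integral_nn_integral)
    have "(\<integral>\<^sup>+s. ennreal (indicator {0..} s * exp (- (a * s)) * enn2real (limH \<alpha> \<theta> p q s)) \<partial>lborel)
       = (\<integral>\<^sup>+s. ennreal (indicator {0..} s * exp (- (a * s))) * limH \<alpha> \<theta> p q s \<partial>lborel)"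
    proof (rule nn_integral_cong)
      fix s :: real
      show "ennreal (indicator {0..} s * exp (- (a * s)) * enn2real (limH \<alpha> \<theta> p q s))
        = ennreal (indicator {0..} s * exp (- (a * s))) * limH \<alpha> \<theta> p q s"
      proof (cases "s \<ge> 0")
        case True
        then show ?thesis using ennreal_limH[OF pq True \<theta>] by (simp add: ennreal_mult)
      qed simp
    qed
    also have "\<dots> = ennreal (Gamma \<alpha> * a powr (- \<alpha>)) * ennreal (E a \<theta> q - E a \<theta> p)"
      unfolding limH_Laplace[OF \<alpha>(1) a pq(1)] E_diff(1)[OF a \<theta> pq] ..
    also have "\<dots> = ennreal L"
      using E_diff(2)[OF a \<theta> pq] Gamma_real_pos[OF \<alpha>(1)] by (simp add: L_def ennreal_mult)
    finally show "(\<integral>\<^sup>+s. ennreal (indicator {0..} s * exp (- (a * s)) * enn2real (limH \<alpha> \<theta> p q s)) \<partial>lborel) = ennreal L" .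
    show "0 \<le> L" using E_diff(2)[OF a \<theta> pq] Gamma_real_pos[OF \<alpha>(1)] by (simp add: L_def)
  qed auto
  then have "has_bochner_integral lborel (\<lambda>s. indicator {0..} s * exp (- (a * s)) * enn2real (limH \<alpha> \<theta> p q s) / (c\<alpha> * Gamma \<alpha>)) (L / (c\<alpha> * Gamma \<alpha>))"
    by (rule has_bochner_integral_divide_zero)
  moreover have "indicator {0..} s * exp (- (a * s)) * enn2real (limH \<alpha> \<theta> p q s) / (c\<alpha> * Gamma \<alpha>)
      = indicator {0..} s *\<^sub>R (hlim \<theta> p q s * exp (- (a * s)))" for s
    by (simp add: hlim_def)
  moreover have "L / (c\<alpha> * Gamma \<alpha>) = (E a \<theta> q - E a \<theta> p) / (c\<alpha> * a powr \<alpha>)"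
    using Gamma_real_pos[OF \<alpha>(1)] c\<alpha>_pos a by (simp add: L_def powr_minus_divide field_simps)
  ultimately have "has_bochner_integral lborel (\<lambda>s. indicator {0..} s *\<^sub>R (hlim \<theta> p q s * exp (- (a * s))))
      ((E a \<theta> q - E a \<theta> p) / (c\<alpha> * a powr \<alpha>))" by simp
  then show "set_integrable lborel {0..} (\<lambda>s. hlim \<theta> p q s * exp (- (a * s)))"
    and "(LBINT s:{0..}. hlim \<theta> p q s * exp (- (a * s))) = (E a \<theta> q - E a \<theta> p) / (c\<alpha> * a powr \<alpha>)"
    by (auto simp: set_integrable_def set_lebesgue_integral_def has_bochner_integral_iff)
qed

text \<open>\<open>limH_le_scale\<close>, used in both directions, squeezes the value at s between
  multiples of the value at 1.\<close>

lemma hlim_isCont: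
  assumes pq: "0 \<le> p" "p \<le> q" and \<theta>: "\<theta> \<ge> 0"
  shows "isCont (hlim \<theta> p q) 1"
proof -
  have scale: "hlim \<theta> p q s \<le> (s / t) powr \<alpha> * exp (q * \<bar>t - s\<bar>) * hlim \<theta> p q t" if "s > 0" "t > 0" for s t
  proof -
    have "enn2real (limH \<alpha> \<theta> p q s) \<le> (s / t) powr \<alpha> * exp (q * \<bar>t - s\<bar>) * enn2real (limH \<alpha> \<theta> p q t)"
    proof -
      have "ennreal (enn2real (limH \<alpha> \<theta> p q s)) \<le> ennreal ((s / t) powr \<alpha> * exp (q * \<bar>t - s\<bar>)) * ennreal (enn2real (limH \<alpha> \<theta> p q t))"
        using limH_le_scale[OF \<alpha>(1) pq(1) that, of \<theta> q] ennreal_limH[OF pq _ \<theta>] that by simp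
      then show ?thesis by (simp add: ennreal_mult'[symmetric])
    qed
    then have "enn2real (limH \<alpha> \<theta> p q s) / (c\<alpha> * Gamma \<alpha>)
        \<le> (s / t) powr \<alpha> * exp (q * \<bar>t - s\<bar>) * enn2real (limH \<alpha> \<theta> p q t) / (c\<alpha> * Gamma \<alpha>)"
      using cG_pos by (intro divide_right_mono) auto
    then show ?thesis by (simp add: hlim_def)
  qed
  have pos: "eventually (\<lambda>s. s > (0::real)) (at 1)"
    by (rule order_tendstoD(1)[OF tendsto_ident_at]) simp
  show ?thesis
    unfolding isCont_def
  proof (rule tendsto_sandwich)
    show "eventually (\<lambda>s. s powr \<alpha> * exp (- (q * \<bar>s - 1\<bar>)) * hlim \<theta> p q 1 \<le> hlim \<theta> p q s) (at 1)"
      using pos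
    proof eventually_elim
      case (elim s)
      define A where "A = s powr \<alpha> * exp (- (q * \<bar>s - 1\<bar>))"
      define B where "B = (1 / s) powr \<alpha> * exp (q * \<bar>s - 1\<bar>)"
      have AB: "A * B = 1" using elim by (simp add: A_def B_def powr_divide exp_minus)
      have "hlim \<theta> p q 1 \<le> B * hlim \<theta> p q s" using scale[of 1 s] elim by (simp add: B_def)
      then have "A * hlim \<theta> p q 1 \<le> A * (B * hlim \<theta> p q s)" by (intro mult_left_mono) (auto simp: A_def)
      also have "\<dots> = hlim \<theta> p q s" using AB by (simp flip: mult.assoc)
      finally show ?case by (simp add: A_def)
    qed
    show "eventually (\<lambda>s. hlim \<theta> p q s \<le> s powr \<alpha> * exp (q * \<bar>1 - s\<bar>) * hlim \<theta> p q 1) (at 1)"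
      using pos by eventually_elim (use scale[of _ 1] in simp)
    have "((\<lambda>s. s powr \<alpha> * exp (- (q * \<bar>s - 1\<bar>)) * hlim \<theta> p q 1) \<longlongrightarrow> 1 powr \<alpha> * exp (- (q * \<bar>1 - 1\<bar>)) * hlim \<theta> p q 1) (at 1)"
      by (intro tendsto_intros) auto
    then show "((\<lambda>s. s powr \<alpha> * exp (- (q * \<bar>s - 1\<bar>)) * hlim \<theta> p q 1) \<longlongrightarrow> hlim \<theta> p q 1) (at 1)" by simp
    have "((\<lambda>s. s powr \<alpha> * exp (q * \<bar>1 - s\<bar>) * hlim \<theta> p q 1) \<longlongrightarrow> 1 powr \<alpha> * exp (q * \<bar>1 - 1\<bar>) * hlim \<theta> p q 1) (at 1)"
      by (intro tendsto_intros) auto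
    then show "((\<lambda>s. s powr \<alpha> * exp (q * \<bar>1 - s\<bar>) * hlim \<theta> p q 1) \<longlongrightarrow> hlim \<theta> p q 1) (at 1)" by simp
  qed
qed

text \<open>After division by \<open>c\<alpha> * Gamma \<alpha>\<close> the constant is
  1/(\<Gamma>(\<alpha>) \<Gamma>(1-\<alpha>)) = sin(\<alpha>\<pi>)/\<pi>, the prefactor of
  \<open>Asl\<close>.\<close>

lemma hlim_1_tendsto:
  assumes \<theta>: "\<theta> \<ge> 0"
  shows "(\<lambda>j. hlim \<theta> (1 / real (Suc j)) (real (Suc j)) 1) \<longlonglongrightarrow> Asl \<alpha> (1 / (1 + \<theta>))"
proof -
  define I where "I = integral {0..1 / (1 + \<theta>)} (\<lambda>s. s powr (\<alpha> - 1) * (1 - s) powr (- \<alpha>))"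
  have I0: "I \<ge> 0" unfolding I_def by (rule integral_arcsine_nonneg)
  have G0: "Gamma \<alpha> > 0" "Gamma (1 - \<alpha>) > 0" using \<alpha> Gamma_real_pos by auto
  have pq: "0 \<le> 1 / real (Suc j)" "1 / real (Suc j) \<le> real (Suc j)" for j
  proof -
    have "1 / real (Suc j) \<le> 1" "1 \<le> real (Suc j)" by auto
    then show "1 / real (Suc j) \<le> real (Suc j)" by (rule order_trans)
  qed simp
  have "(\<lambda>j. limH \<alpha> \<theta> (1 / real (Suc j)) (real (Suc j)) 1) \<longlonglongrightarrow> ennreal (\<alpha> * Gamma \<alpha>) * ennreal I"
    using limH_1_tendsto[OF \<alpha>(1) \<theta>] unfolding arcsine_integral[OF \<alpha> \<theta>] I_def .
  then have "(\<lambda>j. ennreal (enn2real (limH \<alpha> \<theta> (1 / real (Suc j)) (real (Suc j)) 1))) \<longlonglongrightarrow> ennreal (\<alpha> * Gamma \<alpha> * I)"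
    using \<alpha> G0 I0 ennreal_limH[OF pq _ \<theta>, of 1] by (simp add: ennreal_mult)
  then have lim: "(\<lambda>j. enn2real (limH \<alpha> \<theta> (1 / real (Suc j)) (real (Suc j)) 1)) \<longlonglongrightarrow> \<alpha> * Gamma \<alpha> * I"
    using \<alpha> G0 I0 by (subst (asm) tendsto_ennreal_iff) auto
  have "(\<lambda>j. hlim \<theta> (1 / real (Suc j)) (real (Suc j)) 1) \<longlonglongrightarrow> \<alpha> * Gamma \<alpha> * I / (c\<alpha> * Gamma \<alpha>)"
    unfolding hlim_def by (rule tendsto_divide[OF lim tendsto_const]) (use cG_pos in linarith)
  moreover have "\<alpha> * Gamma \<alpha> * I / (c\<alpha> * Gamma \<alpha>) = Asl \<alpha> (1 / (1 + \<theta>))"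
  proof -
    have "\<alpha> * Gamma \<alpha> * I / (c\<alpha> * Gamma \<alpha>) = I / (Gamma \<alpha> * Gamma (1 - \<alpha>))"
      using \<alpha> G0 by (simp add: c\<alpha>_def)
    also have "\<dots> = Asl \<alpha> (1 / (1 + \<theta>))"
      unfolding Gamma_reflection_real[OF \<alpha>] Asl_def I_def by simp
    finally show ?thesis .
  qed
  ultimately show ?thesis by simp
qed

end

section \<open>Inversion of the transforms in a typical environment\<close>

context good_env
begin

text \<open>The transform of P(y,y) is G(y,y) v/g, close to v/(1+av), which is the transform of
  exp(-s/v). The constants of the Tauberian lemma depend on s, \<delta> and \<epsilon> only, so one
  choice serves all traps and all n.\<close>

lemma diag_uniform:
  assumes s: "s > 0" and \<delta>: "\<delta> > 0" and \<epsilon>: "\<epsilon> > 0"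
  shows "eventually (\<lambda>n. \<forall>y\<in>torus n. \<delta> \<le> v n y \<longrightarrow> \<bar>P n s y y - exp (- (s / v n y))\<bar> \<le> \<epsilon>) sequentially"
proof -
  define e where "e = \<epsilon> / 3"
  \<comment> \<open>On traps with v \<ge> \<delta> the slope of exp(-r/v) is at most 1/\<delta>; the
    bound s/2 keeps the averaging interval within positive times.\<close>
  define \<rho> where "\<rho> = min (e * \<delta>) (s / 2)"
  have e: "e > 0" using \<epsilon> by (simp add: e_def)
  have \<rho>: "0 < \<rho>" "\<rho> < s" "\<rho> \<le> e * \<delta>" using e \<delta> s by (auto simp: \<rho>_def)
  obtain K :: nat and \<eta> where \<eta>: "\<eta> > 0" and taub:
    "\<And>f h. f \<in> borel_measurable borel \<Longrightarrow> h \<in> borel_measurable borel \<Longrightarrow>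
       (\<And>r. r \<ge> 0 \<Longrightarrow> f r \<ge> 0) \<Longrightarrow> (\<And>r. r \<ge> 0 \<Longrightarrow> h r \<ge> 0) \<Longrightarrow>
       set_integrable lborel {0..} (\<lambda>r. f r * exp (- r)) \<Longrightarrow>
       set_integrable lborel {0..} (\<lambda>r. h r * exp (- r)) \<Longrightarrow>
       (LBINT r:{0..}. f r * exp (- r)) \<le> 1 \<Longrightarrow> (LBINT r:{0..}. h r * exp (- r)) \<le> 1 \<Longrightarrow>
       (\<And>r. s - \<rho> \<le> r \<Longrightarrow> r \<le> s \<Longrightarrow> f r - e \<le> f s) \<Longrightarrow>
       (\<And>r. s \<le> r \<Longrightarrow> r \<le> s + \<rho> \<Longrightarrow> f s - e \<le> f r) \<Longrightarrow>
       (\<And>r. s - \<rho> \<le> r \<Longrightarrow> r \<le> s + \<rho> \<Longrightarrow> \<bar>h r - h s\<bar> \<le> e) \<Longrightarrow>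
       (\<And>a::nat. 1 \<le> a \<Longrightarrow> a \<le> K \<Longrightarrow>
          \<bar>(LBINT r:{0..}. f r * exp (- (a * r))) - (LBINT r:{0..}. h r * exp (- (a * r)))\<bar> \<le> \<eta>) \<Longrightarrow>
       \<bar>f s - h s\<bar> \<le> 3 * e"
  proof (rule laplace_tauberian[OF \<rho>(1,2) e zero_le_one], goal_cases)
    case (1 K \<eta>)
    show ?case by (rule 1(1)[OF 1(2)]) (rule 1(3))
  qed
  have "eventually (\<lambda>n. \<forall>a\<in>{1..K}. \<forall>y\<in>torus n. \<delta> \<le> v n y \<longrightarrow>
     \<bar>(1 + real a * v n y) * Gr n (real a) y y / g n - 1\<bar> \<le> \<eta>) sequentially"
  proof (rule eventually_ball_finite, simp, rule ballI)
    fix a assume "a \<in> {1..K}"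
    then have "a \<ge> 1" by simp
    from uniform_green[OF this \<delta> \<eta>]
    show "eventually (\<lambda>n. \<forall>y\<in>torus n. \<delta> \<le> v n y \<longrightarrow>
     \<bar>(1 + real a * v n y) * Gr n (real a) y y / g n - 1\<bar> \<le> \<eta>) sequentially"
      by eventually_elim blast
  qed
  then show ?thesis
    using eventually_ge_at_top[of 1]
  proof eventually_elim
    case (elim n)
    interpret bt: btm n "\<tau> \<omega>" "T n" by (rule btm[OF elim(2)])
    show ?case
    proof (intro ballI impI)
      fix y assume y: "y \<in> torus n" and vy: "\<delta> \<le> v n y"
      note vp = v_pos[of n y]
      note [measurable] = bt.P_measurable[OF y]
      have ex: "exp (- (r / v n y)) * exp (- (real a * r)) = exp (- ((real a + 1 / v n y) * r))" for r and a :: nat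
        by (simp add: algebra_simps flip: exp_add)
      have av: "real a + 1 / v n y > 0" for a :: nat using vp by (intro add_nonneg_pos) auto
      have fL: "set_integrable lborel {0..} (\<lambda>r. (1 - P n r y y) * exp (- (real a * r)))"
        "(LBINT r:{0..}. (1 - P n r y y) * exp (- (real a * r))) = 1 / real a - J n (real a) y y" if "a \<ge> 1" for a :: nat
      proof -
        have a0: "real a > 0" using that by simp
        show "set_integrable lborel {0..} (\<lambda>r. (1 - P n r y y) * exp (- (real a * r)))"
          unfolding left_diff_distrib mult_1
          by (intro set_integral_diff exp_integrable[OF a0] bt.P_integrable[OF a0 y y])
        show "(LBINT r:{0..}. (1 - P n r y y) * exp (- (real a * r))) = 1 / real a - J n (real a) y y"
          unfolding left_diff_distrib mult_1 bt.J_def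
          by (subst set_integral_diff) (use exp_integrable[OF a0] bt.P_integrable[OF a0 y y] in auto)
      qed
      have hL: "set_integrable lborel {0..} (\<lambda>r. (1 - exp (- (r / v n y))) * exp (- (real a * r)))"
        "(LBINT r:{0..}. (1 - exp (- (r / v n y))) * exp (- (real a * r))) = 1 / real a - 1 / (real a + 1 / v n y)" if "a \<ge> 1" for a :: nat
      proof -
        have a0: "real a > 0" using that by simp
        show "set_integrable lborel {0..} (\<lambda>r. (1 - exp (- (r / v n y))) * exp (- (real a * r)))"
          unfolding left_diff_distrib mult_1 ex
          by (intro set_integral_diff exp_integrable[OF a0] exp_integrable[OF av])
        show "(LBINT r:{0..}. (1 - exp (- (r / v n y))) * exp (- (real a * r))) = 1 / real a - 1 / (real a + 1 / v n y)"
          unfolding left_diff_distrib mult_1 ex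
          by (subst set_integral_diff) (use exp_integrable[OF a0] exp_integrable[OF av] in auto)
      qed
      \<comment> \<open>Complements are compared, because the Tauberian lemma asks for a function
        that almost increases, while return probabilities decrease.\<close>
      have "\<bar>(1 - P n s y y) - (1 - exp (- (s / v n y)))\<bar> \<le> 3 * e"
      proof (rule taub[of "\<lambda>r. 1 - P n r y y" "\<lambda>r. 1 - exp (- (r / v n y))"])
        show "set_integrable lborel {0..} (\<lambda>r. (1 - P n r y y) * exp (- r))"
          "set_integrable lborel {0..} (\<lambda>r. (1 - exp (- (r / v n y))) * exp (- r))"
          using fL(1)[of 1] hL(1)[of 1] by simp_all
        show "(LBINT r:{0..}. (1 - P n r y y) * exp (- r)) \<le> 1"
          using fL(2)[of 1] bt.J_nonneg[OF y y, of 1] by simp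
        have "1 / (1 + 1 / v n y) \<ge> 0" using vp by simp
        then show "(LBINT r:{0..}. (1 - exp (- (r / v n y))) * exp (- r)) \<le> 1"
          using hL(2)[of 1] by simp
        show "1 - P n r y y \<ge> 0" if "r \<ge> 0" for r using bt.P_le_1[OF that y y] by simp
        show "1 - exp (- (r / v n y)) \<ge> 0" if "r \<ge> 0" for r using that vp by simp
        show "1 - P n r y y - e \<le> 1 - P n s y y" if "r \<le> s" for r using bt.P_diag_antimono[OF y that] e by simp
        show "1 - P n s y y - e \<le> 1 - P n r y y" if "s \<le> r" for r using bt.P_diag_antimono[OF y that] e by simp
        show "\<bar>(1 - exp (- (r / v n y))) - (1 - exp (- (s / v n y)))\<bar> \<le> e" if r: "s - \<rho> \<le> r" "r \<le> s + \<rho>" for r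
        proof -
          have "\<bar>exp (- (r / v n y)) - exp (- (s / v n y))\<bar> \<le> \<bar>r / v n y - s / v n y\<bar>"
            using r \<rho> s vp by (intro exp_neg_lipschitz) auto
          also have "\<dots> = \<bar>r - s\<bar> / v n y" using vp by (simp flip: diff_divide_distrib)
          also have "\<dots> \<le> \<rho> / \<delta>" using r vy \<delta> by (intro frac_le) auto
          also have "\<dots> \<le> e" using \<rho> \<delta> by (simp add: divide_le_eq)
          finally show ?thesis by linarith
        qed
        fix a :: nat assume a: "1 \<le> a" "a \<le> K"
        have a0: "real a > 0" using a by simp
        define X where "X = (1 + real a * v n y) * Gr n (real a) y y / g n - 1"
        have "\<bar>X\<bar> \<le> \<eta>" unfolding X_def using elim(1) a y vy by simp
        have pos: "1 + real a * v n y > 0" using vp by (intro add_pos_nonneg) auto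
        have "J n (real a) y y = Gr n (real a) y y * v n y / g n"
          unfolding bt.J_eq_Gr v_eq[OF elim(2)] using g_pos[OF elim(2)] by simp
        moreover have "1 / (real a + 1 / v n y) = v n y / (1 + real a * v n y)" using vp by (simp add: field_simps)
        ultimately have "J n (real a) y y - 1 / (real a + 1 / v n y) = v n y / (1 + real a * v n y) * X"
          using pos by (simp add: X_def right_diff_distrib)
        moreover have "\<bar>v n y / (1 + real a * v n y)\<bar> \<le> 1"
        proof -
          have "1 * v n y \<le> real a * v n y" using a vp by (intro mult_right_mono) auto
          then have "v n y \<le> 1 + real a * v n y" by linarith
          then show ?thesis using pos vp by (simp add: divide_le_eq_1_pos)
        qed
        ultimately have "\<bar>J n (real a) y y - 1 / (real a + 1 / v n y)\<bar> \<le> 1 * \<eta>"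
          unfolding \<open>J n (real a) y y - 1 / (real a + 1 / v n y) = v n y / (1 + real a * v n y) * X\<close> abs_mult
          using \<open>\<bar>X\<bar> \<le> \<eta>\<close> by (intro mult_mono) auto
        then show "\<bar>(LBINT r:{0..}. (1 - P n r y y) * exp (- (real a * r))) - (LBINT r:{0..}. (1 - exp (- (r / v n y))) * exp (- (real a * r)))\<bar> \<le> \<eta>"
          unfolding fL(2)[OF a(1)] hL(2)[OF a(1)] by linarith
      qed measurable
      then show "\<bar>P n s y y - exp (- (s / v n y))\<bar> \<le> \<epsilon>" by (simp add: e_def)
    qed
  qed
qed

text \<open>Time 0 is separate, since the Tauberian lemma needs a positive time; there both
  quantities are 1.\<close>

lemma diag_uniform_\<theta>:
  assumes \<theta>': "\<theta>' \<ge> 0" and \<delta>: "\<delta> > 0" and \<epsilon>: "\<epsilon> > 0"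
  shows "eventually (\<lambda>n. \<forall>y\<in>torus n. \<delta> \<le> v n y \<longrightarrow> \<bar>P n \<theta>' y y - exp (- (\<theta>' / v n y))\<bar> \<le> \<epsilon>) sequentially"
proof (cases "\<theta>' = 0")
  case True
  show ?thesis using eventually_ge_at_top[of 1]
  proof eventually_elim
    case (elim n)
    interpret bt: btm n "\<tau> \<omega>" "T n" by (rule btm[OF elim])
    show ?case using True \<epsilon> by (simp add: bt.P_0)
  qed
next
  case False
  then show ?thesis using diag_uniform assms by simp
qed

definition win :: "real \<Rightarrow> real \<Rightarrow> nat \<Rightarrow> (int \<times> int) set" where
  "win \<delta> \<Delta> n = {y\<in>torus n. \<delta> \<le> v n y \<and> v n y < \<Delta>}"

text \<open>With \<open>\<theta>'\<close> equal to \<open>\<theta>\<close> and s = 1 this is the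
  contribution of the window to the two-time probability, with \<open>\<theta>'\<close> equal to 0
  the mass of the window. The first time s stays free for the Laplace transform.\<close>

definition f :: "real \<Rightarrow> real \<Rightarrow> real \<Rightarrow> nat \<Rightarrow> real \<Rightarrow> real" where
  "f \<theta>' \<delta> \<Delta> n s = (\<Sum>y\<in>win \<delta> \<Delta> n. P n s (0,0) y * P n \<theta>' y y)"

lemma win_subset: "win \<delta> \<Delta> n \<subseteq> torus n" by (auto simp: win_def)

text \<open>The transform of P(0,y) is G(0,y) v/g, close to v/((1+av) kap). The window sum is thus a
  difference of two \<open>PhiC\<close> sums divided by \<open>kap\<close>, and laws of large
  numbers for numerator and denominator give the quotient.\<close>

lemma Laplace_tendsto:
  fixes a j :: nat
  assumes a: "a \<ge> 1" and \<theta>': "\<theta>' \<in> {0, \<theta>}" and \<delta>: "\<delta> = 1 / real (Suc j)" and \<Delta>: "\<Delta> = real (Suc j)"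
  shows "(\<lambda>n. \<Sum>y\<in>win \<delta> \<Delta> n. J n (real a) (0,0) y * P n \<theta>' y y)
    \<longlonglongrightarrow> (E (real a) \<theta>' (1 / \<delta>) - E (real a) \<theta>' (1 / \<Delta>)) / (c\<alpha> * real a powr \<alpha>)"
proof -
  have \<delta>0: "\<delta> > 0" and D0: "\<Delta> > 0" using \<delta> \<Delta> by auto
  have "\<delta> \<le> 1" using \<delta> by simp
  moreover have "1 \<le> \<Delta>" using \<Delta> by simp
  ultimately have \<delta>\<Delta>: "\<delta> \<le> \<Delta>" by linarith
  have \<theta>0: "\<theta>' \<ge> 0" using \<theta>' \<theta>_nonneg by auto
  define L where "L = E (real a) \<theta>' (1 / \<delta>) - E (real a) \<theta>' (1 / \<Delta>)"
  define main where "main = (\<lambda>n. \<Sum>y\<in>win \<delta> \<Delta> n. v n y * (exp (- (\<theta>' / v n y)) * (1 / (1 + real a * v n y))))"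
  define X where "X = (\<lambda>n. \<Sum>y\<in>win \<delta> \<Delta> n. v n y * (P n \<theta>' y y * (kap (real a) n / g n * Gr n (real a) (0,0) y)))"
  have main_lim: "(\<lambda>n. main n / Mn n) \<longlonglongrightarrow> L"
  proof -
    have "main n = (\<Sum>x\<in>torus n. PhiC (real a) \<theta>' \<delta> (v n x)) - (\<Sum>x\<in>torus n. PhiC (real a) \<theta>' \<Delta> (v n x))" for n
    proof -
      have "main n = (\<Sum>x\<in>torus n. if x \<in> win \<delta> \<Delta> n then v n x * (exp (- (\<theta>' / v n x)) * (1 / (1 + real a * v n x))) else 0)"
        unfolding main_def by (subst sum.inter_restrict[symmetric]) (auto simp: win_def intro!: sum.cong)
      also have "\<dots> = (\<Sum>x\<in>torus n. PhiC (real a) \<theta>' \<delta> (v n x) - PhiC (real a) \<theta>' \<Delta> (v n x))"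
        using \<delta>\<Delta> by (intro sum.cong refl) (auto simp: win_def PhiC_def)
      finally show ?thesis by (simp add: sum_subtractf)
    qed
    moreover have "(\<lambda>n. (\<Sum>x\<in>torus n. PhiC (real a) \<theta>' d (v n x)) / Mn n) \<longlonglongrightarrow> E (real a) \<theta>' (1 / d)"
      if "d \<in> {\<delta>, \<Delta>}" for d
      using good a \<theta>' that unfolding good_def v_def \<delta> \<Delta> by auto
    ultimately show ?thesis
      unfolding L_def by (simp only: diff_divide_distrib) (intro tendsto_diff; simp)
  qed
  have diff_lim: "(\<lambda>n. (X n - main n) / Mn n) \<longlonglongrightarrow> 0"
  proof (rule tendstoI)
    fix \<epsilon> :: real assume \<epsilon>: "\<epsilon> > 0"
    define \<psi>0 where "\<psi>0 = \<delta> / (1 + \<delta>)"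
    have \<psi>0: "\<psi>0 > 0" using \<delta>0 by (simp add: \<psi>0_def)
    \<comment> \<open>The window holds at most \<open>kap 1 n / \<psi>0\<close> traps, eventually
      fewer than (c\<alpha> + 1) Mn / \<psi>0, each with an error of at most 2\<Delta>\<eta>; this
      \<eta> makes the total \<epsilon>/2 after division by Mn.\<close>
    define \<eta> where "\<eta> = \<epsilon> * \<psi>0 / (4 * \<Delta> * (c\<alpha> + 1))"
    have \<eta>: "\<eta> > 0" using \<epsilon> \<psi>0 D0 c\<alpha>_pos by (simp add: \<eta>_def)
    have "(\<lambda>n. kap 1 n / Mn n) \<longlonglongrightarrow> c\<alpha>" using kap_tendsto[of 1] by simp
    then have k1: "eventually (\<lambda>n. kap 1 n / Mn n < c\<alpha> + 1) sequentially"
      by (rule order_tendstoD(2)) simp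
    show "eventually (\<lambda>n. dist ((X n - main n) / Mn n) 0 < \<epsilon>) sequentially"
      using uniform_green[OF a \<delta>0 \<eta>] diag_uniform_\<theta>[OF \<theta>0 \<delta>0 \<eta>] k1 eventually_ge_at_top[of 1]
    proof eventually_elim
      case (elim n)
      interpret bt: btm n "\<tau> \<omega>" "T n" by (rule btm[OF elim(4)])
      have one: "\<bar>v n y * (P n \<theta>' y y * (kap (real a) n / g n * Gr n (real a) (0,0) y))
          - v n y * (exp (- (\<theta>' / v n y)) * (1 / (1 + real a * v n y)))\<bar> \<le> \<Delta> * (2 * \<eta>) * (Phi 1 (v n y) / \<psi>0)"
        if yw: "y \<in> win \<delta> \<Delta> n" for y
      proof -
        have y: "y \<in> torus n" and vy: "\<delta> \<le> v n y" "v n y < \<Delta>" using yw by (auto simp: win_def)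
        note vp = v_pos[of n y]
        define p q r u where "p = P n \<theta>' y y" and "q = kap (real a) n / g n * Gr n (real a) (0,0) y"
          and "r = exp (- (\<theta>' / v n y))" and "u = 1 / (1 + real a * v n y)"
        have 1: "\<bar>p - r\<bar> \<le> \<eta>" using elim(2) y vy by (simp add: p_def r_def)
        have 2: "\<bar>q - u\<bar> \<le> \<eta>" using elim(1) y vy by (simp add: q_def u_def)
        have p: "0 \<le> p" "p \<le> 1" unfolding p_def using bt.P_nonneg[OF \<theta>0 y y] bt.P_le_1[OF \<theta>0 y y] by auto
        have u: "0 \<le> u" "u \<le> 1" using vp by (auto simp: u_def divide_le_eq_1 add_pos_nonneg)
        have "p * q - r * u = p * (q - u) + (p - r) * u" by (simp add: algebra_simps)
        then have "\<bar>p * q - r * u\<bar> \<le> \<bar>p\<bar> * \<bar>q - u\<bar> + \<bar>p - r\<bar> * \<bar>u\<bar>"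
          by (metis abs_mult abs_triangle_ineq)
        also have "\<dots> \<le> 1 * \<eta> + \<eta> * 1" using 1 2 p u \<eta> by (intro add_mono mult_mono) auto
        finally have "\<bar>p * q - r * u\<bar> \<le> 2 * \<eta>" by simp
        then have "v n y * \<bar>p * q - r * u\<bar> \<le> \<Delta> * (2 * \<eta>)" using vp vy D0 by (intro mult_mono) auto
        also have "\<dots> \<le> \<Delta> * (2 * \<eta>) * (Phi 1 (v n y) / \<psi>0)"
        proof -
          have "\<psi>0 \<le> Phi 1 (v n y)"
            unfolding \<psi>0_def Phi_v using ratio_mono[of 1 \<delta> "v n y"] \<delta>0 vy by simp
          then have "1 \<le> Phi 1 (v n y) / \<psi>0" using \<psi>0 by simp
          then have "\<Delta> * (2 * \<eta>) * 1 \<le> \<Delta> * (2 * \<eta>) * (Phi 1 (v n y) / \<psi>0)"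
            using D0 \<eta> by (intro mult_left_mono) auto
          then show ?thesis by simp
        qed
        finally show ?thesis
          unfolding p_def[symmetric] q_def[symmetric] r_def[symmetric] u_def[symmetric]
            right_diff_distrib[symmetric] abs_mult using vp by simp
      qed
      have "\<bar>X n - main n\<bar> \<le> (\<Sum>y\<in>win \<delta> \<Delta> n. \<Delta> * (2 * \<eta>) * (Phi 1 (v n y) / \<psi>0))"
        unfolding X_def main_def sum_subtractf[symmetric]
        by (rule order_trans[OF sum_abs sum_mono]) (rule one)
      also have "\<dots> \<le> (\<Sum>y\<in>torus n. \<Delta> * (2 * \<eta>) * (Phi 1 (v n y) / \<psi>0))"
      proof (intro sum_mono2 win_subset finite_torus)
        fix y
        show "0 \<le> \<Delta> * (2 * \<eta>) * (Phi 1 (v n y) / \<psi>0)"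
          using D0 \<eta> \<psi>0 v_pos[of n y] by (simp add: Phi_v)
      qed
      also have "\<dots> = \<Delta> * (2 * \<eta>) / \<psi>0 * kap 1 n"
        by (simp add: kap_def sum_distrib_left sum_divide_distrib)
      finally have "\<bar>X n - main n\<bar> / Mn n \<le> \<Delta> * (2 * \<eta>) / \<psi>0 * kap 1 n / Mn n"
        using Mn_pos[of n] by (intro divide_right_mono) auto
      also have "\<dots> = \<Delta> * (2 * \<eta>) / \<psi>0 * (kap 1 n / Mn n)" by simp
      also have "\<dots> \<le> \<Delta> * (2 * \<eta>) / \<psi>0 * (c\<alpha> + 1)"
        using elim(3) D0 \<eta> \<psi>0 by (intro mult_left_mono) auto
      also have "\<dots> = \<epsilon> / 2"
      proof -
        have "c\<alpha> + 1 \<noteq> 0" using c\<alpha>_pos by linarith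
        then show ?thesis using D0 \<psi>0 by (simp add: \<eta>_def divide_simps)
      qed
      also have "\<dots> < \<epsilon>" using \<epsilon> by simp
      finally show ?case using Mn_pos[of n] by (simp add: abs_divide)
    qed
  qed
  have X_lim: "(\<lambda>n. X n / Mn n) \<longlonglongrightarrow> L"
    using tendsto_add[OF diff_lim main_lim] by (simp add: diff_divide_distrib)
  have ca: "c\<alpha> * real a powr \<alpha> \<noteq> 0" using c\<alpha>_pos a by simp
  have "(\<lambda>n. (X n / Mn n) / (kap (real a) n / Mn n)) \<longlonglongrightarrow> L / (c\<alpha> * real a powr \<alpha>)"
    by (rule tendsto_divide[OF X_lim kap_tendsto[OF a] ca])
  moreover have "eventually (\<lambda>n. (X n / Mn n) / (kap (real a) n / Mn n) = (\<Sum>y\<in>win \<delta> \<Delta> n. J n (real a) (0,0) y * P n \<theta>' y y)) sequentially"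
  proof -
    have "eventually (\<lambda>n. kap (real a) n \<ge> 1) sequentially" using kap_at_top[OF a] by (simp add: filterlim_at_top)
    then show ?thesis using eventually_ge_at_top[of 1]
    proof eventually_elim
      case (elim n)
      interpret bt: btm n "\<tau> \<omega>" "T n" by (rule btm[OF elim(2)])
      have gn: "g n > 0" by (rule g_pos[OF elim(2)])
      have "X n / kap (real a) n = (\<Sum>y\<in>win \<delta> \<Delta> n. J n (real a) (0,0) y * P n \<theta>' y y)"
        unfolding X_def sum_divide_distrib
      proof (rule sum.cong[OF refl])
        fix y
        have "J n (real a) (0,0) y = Gr n (real a) (0,0) y * v n y / g n"
          unfolding bt.J_eq_Gr v_eq[OF elim(2)] using gn by simp
        then show "v n y * (P n \<theta>' y y * (kap (real a) n / g n * Gr n (real a) (0,0) y)) / kap (real a) n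
           = J n (real a) (0,0) y * P n \<theta>' y y"
          using elim(1) by simp
      qed
      then show ?case using Mn_pos[of n] by simp
    qed
  qed
  ultimately show ?thesis
    unfolding L_def by (rule Lim_transform_eventually)
qed

text \<open>The Tauberian lemma is applied in the first time, with the second time as a fixed
  weight. For the regularity, a chain at a trap of the window is found there again after a time of
  at most \<rho> with probability at least 1 - e, so \<open>f\<close> can drop by at most e.\<close>

lemma f_tendsto:
  assumes \<theta>': "\<theta>' \<in> {0, \<theta>}" and \<delta>: "\<delta> = 1 / real (Suc j)" and \<Delta>: "\<Delta> = real (Suc j)"
  shows "(\<lambda>n. f \<theta>' \<delta> \<Delta> n 1) \<longlonglongrightarrow> hlim \<theta>' (1 / real (Suc j)) (real (Suc j)) 1"
proof (rule tendstoI)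
  fix \<epsilon> :: real assume \<epsilon>: "\<epsilon> > 0"
  define p q where "p = 1 / real (Suc j)" and "q = real (Suc j)"
  have pq: "0 \<le> p" "p \<le> q"
  proof -
    have "p \<le> 1" "1 \<le> q" by (auto simp: p_def q_def)
    then show "p \<le> q" by (rule order_trans)
  qed (simp add: p_def)
  have \<delta>0: "\<delta> > 0" using \<delta> by simp
  have \<theta>0: "\<theta>' \<ge> 0" using \<theta>' \<theta>_nonneg by auto
  define h where "h = hlim \<theta>' p q"
  define e where "e = \<epsilon> / 4"
  have e: "e > 0" using \<epsilon> by (simp add: e_def)
  obtain d where d: "d > 0" "\<And>s. \<bar>s - 1\<bar> < d \<Longrightarrow> \<bar>h s - h 1\<bar> < e"
    using hlim_isCont[OF pq \<theta>0] e unfolding h_def continuous_at_eps_delta dist_real_def by blast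
  \<comment> \<open>The term e\<delta>/2 makes \<rho>/v at most e/2 on the window; the other half of
    e is left for the error of \<open>diag_uniform\<close> at time \<rho>.\<close>
  define \<rho> where "\<rho> = min (min (d / 2) (1 / 2)) (e * \<delta> / 2)"
  have \<rho>: "0 < \<rho>" "\<rho> < 1" "\<rho> < d" "\<rho> \<le> e * \<delta> / 2" using d e \<delta>0 by (auto simp: \<rho>_def)
  define LT where "LT = (\<lambda>a::nat. (E (real a) \<theta>' q - E (real a) \<theta>' p) / (c\<alpha> * real a powr \<alpha>))"
  have h_int: "set_integrable lborel {0..} (\<lambda>s. h s * exp (- (real a * s)))"
    and h_LT: "(LBINT s:{0..}. h s * exp (- (real a * s))) = LT a" if "a \<ge> 1" for a :: nat
    using hlim_Laplace[OF pq \<theta>0, of "real a"] that by (simp_all add: h_def LT_def)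
  have LT0: "LT 1 \<ge> 0" using E_diff(2)[OF _ \<theta>0 pq, of 1] c\<alpha>_pos by (simp add: LT_def)
  \<comment> \<open>A common bound for the two transforms at 1: that of f is at most 1, that of h is
    \<open>LT 1\<close>.\<close>
  define B where "B = 1 + LT 1"
  have B: "B \<ge> 0" using LT0 by (simp add: B_def)
  obtain K :: nat and \<eta> where \<eta>: "\<eta> > 0" and taub:
    "\<And>f h. f \<in> borel_measurable borel \<Longrightarrow> h \<in> borel_measurable borel \<Longrightarrow>
       (\<And>r. r \<ge> 0 \<Longrightarrow> f r \<ge> 0) \<Longrightarrow> (\<And>r. r \<ge> 0 \<Longrightarrow> h r \<ge> 0) \<Longrightarrow>
       set_integrable lborel {0..} (\<lambda>r. f r * exp (- r)) \<Longrightarrow>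
       set_integrable lborel {0..} (\<lambda>r. h r * exp (- r)) \<Longrightarrow>
       (LBINT r:{0..}. f r * exp (- r)) \<le> B \<Longrightarrow> (LBINT r:{0..}. h r * exp (- r)) \<le> B \<Longrightarrow>
       (\<And>r. 1 - \<rho> \<le> r \<Longrightarrow> r \<le> 1 \<Longrightarrow> f r - e \<le> f 1) \<Longrightarrow>
       (\<And>r. 1 \<le> r \<Longrightarrow> r \<le> 1 + \<rho> \<Longrightarrow> f 1 - e \<le> f r) \<Longrightarrow>
       (\<And>r. 1 - \<rho> \<le> r \<Longrightarrow> r \<le> 1 + \<rho> \<Longrightarrow> \<bar>h r - h 1\<bar> \<le> e) \<Longrightarrow>
       (\<And>a::nat. 1 \<le> a \<Longrightarrow> a \<le> K \<Longrightarrow>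
          \<bar>(LBINT r:{0..}. f r * exp (- (a * r))) - (LBINT r:{0..}. h r * exp (- (a * r)))\<bar> \<le> \<eta>) \<Longrightarrow>
       \<bar>f 1 - h 1\<bar> \<le> 3 * e"
  proof (rule laplace_tauberian[OF \<rho>(1,2) e B], goal_cases)
    case (1 K \<eta>)
    show ?case by (rule 1(1)[OF 1(2)]) (rule 1(3))
  qed
  have "eventually (\<lambda>n. \<forall>a\<in>{1..K}. \<bar>(\<Sum>y\<in>win \<delta> \<Delta> n. J n (real a) (0,0) y * P n \<theta>' y y) - LT a\<bar> < \<eta>) sequentially"
  proof (rule eventually_ball_finite, simp, rule ballI)
    fix a assume "a \<in> {1..K}"
    then have "a \<ge> 1" by simp
    from Laplace_tendsto[OF this \<theta>' \<delta> \<Delta>]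
    have "(\<lambda>n. \<Sum>y\<in>win \<delta> \<Delta> n. J n (real a) (0,0) y * P n \<theta>' y y) \<longlonglongrightarrow> LT a"
      by (simp add: LT_def \<delta> \<Delta> p_def q_def)
    from tendstoD[OF this \<eta>]
    show "eventually (\<lambda>n. \<bar>(\<Sum>y\<in>win \<delta> \<Delta> n. J n (real a) (0,0) y * P n \<theta>' y y) - LT a\<bar> < \<eta>) sequentially"
      by (simp add: dist_real_def)
  qed
  moreover have "e / 2 > 0" using e by simp
  note diag_uniform[OF \<rho>(1) \<delta>0 this]
  ultimately show "eventually (\<lambda>n. dist (f \<theta>' \<delta> \<Delta> n 1) (hlim \<theta>' (1 / real (Suc j)) (real (Suc j)) 1) < \<epsilon>) sequentially"
    using eventually_ge_at_top[of 1]
  proof eventually_elim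
    case (elim n)
    interpret bt: btm n "\<tau> \<omega>" "T n" by (rule btm[OF elim(3)])
    define o' :: "int \<times> int" where "o' = (0,0)"
    have o: "o' \<in> torus n" by (simp add: o'_def)
    define F where "F = (\<lambda>y. P n \<theta>' y y)"
    have F: "0 \<le> F y" "F y \<le> 1" if "y \<in> torus n" for y
      unfolding F_def using bt.P_nonneg[OF \<theta>0 that that] bt.P_le_1[OF \<theta>0 that that] by auto
    have yw: "y \<in> torus n" if "y \<in> win \<delta> \<Delta> n" for y using that win_subset by blast
    have feq: "f \<theta>' \<delta> \<Delta> n s = (\<Sum>y\<in>win \<delta> \<Delta> n. P n s o' y * F y)" for s
      by (simp add: f_def F_def o'_def)
    have f_int: "set_integrable lborel {0..} (\<lambda>s. f \<theta>' \<delta> \<Delta> n s * exp (- (real a * s)))"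
      and f_LT: "(LBINT s:{0..}. f \<theta>' \<delta> \<Delta> n s * exp (- (real a * s))) = (\<Sum>y\<in>win \<delta> \<Delta> n. J n (real a) o' y * F y)"
      if "a \<ge> 1" for a :: nat
    proof -
      have a0: "real a > 0" using that by simp
      have eq: "f \<theta>' \<delta> \<Delta> n s * exp (- (real a * s)) = (\<Sum>y\<in>win \<delta> \<Delta> n. (P n s o' y * exp (- (real a * s))) * F y)" for s
        unfolding feq sum_distrib_right by (intro sum.cong refl) simp
      have i: "set_integrable lborel {0..} (\<lambda>s. (P n s o' y * exp (- (real a * s))) * F y)" if "y \<in> win \<delta> \<Delta> n" for y
        using bt.P_integrable[OF a0 o yw[OF that]] by simp
      show "set_integrable lborel {0..} (\<lambda>s. f \<theta>' \<delta> \<Delta> n s * exp (- (real a * s)))"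
        unfolding eq set_integrable_def scaleR_sum_right
        using i unfolding set_integrable_def by (intro Bochner_Integration.integrable_sum)
      have "(LBINT s:{0..}. f \<theta>' \<delta> \<Delta> n s * exp (- (real a * s)))
          = (\<Sum>y\<in>win \<delta> \<Delta> n. LBINT s:{0..}. (P n s o' y * exp (- (real a * s))) * F y)"
        unfolding eq set_lebesgue_integral_def scaleR_sum_right
        using i unfolding set_integrable_def by (intro Bochner_Integration.integral_sum)
      then show "(LBINT s:{0..}. f \<theta>' \<delta> \<Delta> n s * exp (- (real a * s))) = (\<Sum>y\<in>win \<delta> \<Delta> n. J n (real a) o' y * F y)"
        by (simp add: bt.J_def)
    qed
    have f0: "f \<theta>' \<delta> \<Delta> n s \<ge> 0" if "s \<ge> 0" for s
      unfolding feq using bt.P_nonneg[OF that o] F yw by (intro sum_nonneg mult_nonneg_nonneg) auto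
    have f1: "f \<theta>' \<delta> \<Delta> n s \<le> 1" if "s \<ge> 0" for s
    proof -
      have "f \<theta>' \<delta> \<Delta> n s \<le> (\<Sum>y\<in>win \<delta> \<Delta> n. P n s o' y)"
        unfolding feq using bt.P_nonneg[OF that o] F yw by (intro sum_mono mult_left_le) auto
      also have "\<dots> \<le> (\<Sum>y\<in>torus n. P n s o' y)"
        using bt.P_nonneg[OF that o] by (intro sum_mono2 win_subset) auto
      also have "\<dots> = 1" by (rule bt.P_row_sum[OF o])
      finally show ?thesis .
    qed
    have reg: "f \<theta>' \<delta> \<Delta> n s - e \<le> f \<theta>' \<delta> \<Delta> n s'" if s: "0 \<le> s" "s \<le> s'" "s' \<le> s + \<rho>" for s s'
    proof -
      have "(1 - e) * f \<theta>' \<delta> \<Delta> n s = (\<Sum>y\<in>win \<delta> \<Delta> n. P n s o' y * (1 - e) * F y)"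
        by (simp add: feq sum_distrib_left mult_ac)
      also have "\<dots> \<le> (\<Sum>y\<in>win \<delta> \<Delta> n. P n s' o' y * F y)"
      proof (rule sum_mono, rule mult_right_mono)
        fix y assume y: "y \<in> win \<delta> \<Delta> n"
        note yt = yw[OF y]
        have vy: "\<delta> \<le> v n y" using y by (simp add: win_def)
        have "1 - e \<le> P n (s' - s) y y"
        proof -
          have "\<bar>P n \<rho> y y - exp (- (\<rho> / v n y))\<bar> \<le> e / 2" using elim(2) yt vy by blast
          moreover have "1 - \<rho> / v n y \<le> exp (- (\<rho> / v n y))" using exp_ge_add_one_self[of "- (\<rho> / v n y)"] by simp
          moreover have "\<rho> / v n y \<le> e / 2"
          proof -
            have "\<rho> / v n y \<le> \<rho> / \<delta>" using vy \<delta>0 \<rho> by (intro frac_le) auto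
            also have "\<dots> \<le> e / 2" using \<rho> \<delta>0 by (simp add: divide_le_eq)
            finally show ?thesis .
          qed
          moreover have "P n \<rho> y y \<le> P n (s' - s) y y" using s by (intro bt.P_diag_antimono[OF yt]) auto
          ultimately show ?thesis by linarith
        qed
        then have "P n s o' y * (1 - e) \<le> P n s o' y * P n (s' - s) y y"
          using bt.P_nonneg[OF s(1) o yt] by (intro mult_left_mono) auto
        also have "\<dots> \<le> P n (s + (s' - s)) o' y" using s by (intro bt.P_stay o yt) auto
        finally show "P n s o' y * (1 - e) \<le> P n s' o' y" by simp
        show "0 \<le> F y" by (rule F[OF yt])
      qed
      finally have "(1 - e) * f \<theta>' \<delta> \<Delta> n s \<le> f \<theta>' \<delta> \<Delta> n s'" by (simp add: feq)
      moreover have "e * f \<theta>' \<delta> \<Delta> n s \<le> e * 1" using f1[OF s(1)] e by (intro mult_left_mono) auto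
      ultimately show ?thesis by (simp add: left_diff_distrib)
    qed
    have "\<bar>f \<theta>' \<delta> \<Delta> n 1 - h 1\<bar> \<le> 3 * e"
    proof (rule taub[of "f \<theta>' \<delta> \<Delta> n" h])
      have [measurable]: "(\<lambda>s. P n s o' y) \<in> borel_measurable borel" for y by (rule bt.P_measurable[OF o])
      have "(\<lambda>s. \<Sum>y\<in>win \<delta> \<Delta> n. P n s o' y * F y) \<in> borel_measurable borel" by measurable
      then show "f \<theta>' \<delta> \<Delta> n \<in> borel_measurable borel" unfolding feq[abs_def] .
      show "h \<in> borel_measurable borel" unfolding h_def by measurable
      show "h r \<ge> 0" for r unfolding h_def by (rule hlim_nonneg)
      show "set_integrable lborel {0..} (\<lambda>r. f \<theta>' \<delta> \<Delta> n r * exp (- r))"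
        "set_integrable lborel {0..} (\<lambda>r. h r * exp (- r))"
        using f_int[of 1] h_int[of 1] by simp_all
      have "(\<Sum>y\<in>win \<delta> \<Delta> n. J n 1 o' y * F y) \<le> (\<Sum>y\<in>win \<delta> \<Delta> n. J n 1 o' y)"
        using bt.J_nonneg[OF o] F yw by (intro sum_mono mult_left_le) auto
      also have "\<dots> \<le> (\<Sum>y\<in>torus n. J n 1 o' y)"
        using bt.J_nonneg[OF o] by (intro sum_mono2 win_subset) auto
      also have "\<dots> = 1" using bt.J_sum[of 1, OF _ o] by simp
      finally show "(LBINT r:{0..}. f \<theta>' \<delta> \<Delta> n r * exp (- r)) \<le> B"
        using f_LT[of 1] LT0 by (simp add: B_def)
      show "(LBINT r:{0..}. h r * exp (- r)) \<le> B" using h_LT[of 1] by (simp add: B_def)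
      show "f \<theta>' \<delta> \<Delta> n r - e \<le> f \<theta>' \<delta> \<Delta> n 1" if "1 - \<rho> \<le> r" "r \<le> 1" for r
        using that \<rho> by (intro reg) auto
      show "f \<theta>' \<delta> \<Delta> n 1 - e \<le> f \<theta>' \<delta> \<Delta> n r" if "1 \<le> r" "r \<le> 1 + \<rho>" for r
        using that \<rho> by (intro reg) auto
      show "\<bar>h r - h 1\<bar> \<le> e" if "1 - \<rho> \<le> r" "r \<le> 1 + \<rho>" for r
        using that \<rho> by (intro less_imp_le d(2)) auto
      show "\<bar>(LBINT r:{0..}. f \<theta>' \<delta> \<Delta> n r * exp (- (real a * r))) - (LBINT r:{0..}. h r * exp (- (real a * r)))\<bar> \<le> \<eta>"
        if "1 \<le> a" "a \<le> K" for a :: nat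
        unfolding f_LT[OF that(1)] h_LT[OF that(1)]
        using elim(1) that by (auto simp: F_def o'_def intro: less_imp_le)
    qed (rule f0)
    then have "\<bar>f \<theta>' \<delta> \<Delta> n 1 - h 1\<bar> < \<epsilon>" using \<epsilon> by (simp add: e_def)
    then show ?case by (simp add: dist_real_def h_def p_def q_def)
  qed
qed

lemma same_pos_tendsto:
  "(\<lambda>n. btm_same_pos n (\<tau> \<omega>) (t_w \<alpha> \<gamma> n) ((1 + \<theta>) * t_w \<alpha> \<gamma> n)) \<longlonglongrightarrow> Asl \<alpha> (1 / (1 + \<theta>))"
proof (rule tendstoI)
  fix \<epsilon> :: real assume \<epsilon>: "\<epsilon> > 0"
  then have e4: "\<epsilon> / 4 > 0" by simp
  have l0: "(\<lambda>j. hlim 0 (1 / real (Suc j)) (real (Suc j)) 1) \<longlonglongrightarrow> 1"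
    using hlim_1_tendsto[of 0] Asl_1[OF \<alpha>] by simp
  have "eventually (\<lambda>j. dist (hlim \<theta> (1 / real (Suc j)) (real (Suc j)) 1) (Asl \<alpha> (1 / (1 + \<theta>))) < \<epsilon> / 4
      \<and> dist (hlim 0 (1 / real (Suc j)) (real (Suc j)) 1) 1 < \<epsilon> / 4) sequentially"
    by (intro eventually_conj tendstoD[OF hlim_1_tendsto[OF \<theta>_nonneg] e4] tendstoD[OF l0 e4])
  then obtain j where j: "dist (hlim \<theta> (1 / real (Suc j)) (real (Suc j)) 1) (Asl \<alpha> (1 / (1 + \<theta>))) < \<epsilon> / 4"
    "dist (hlim 0 (1 / real (Suc j)) (real (Suc j)) 1) 1 < \<epsilon> / 4"
    by (auto simp: eventually_sequentially)
  define \<delta> \<Delta> where "\<delta> = 1 / real (Suc j)" and "\<Delta> = real (Suc j)"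
  have t1: "(\<lambda>n. f \<theta> \<delta> \<Delta> n 1) \<longlonglongrightarrow> hlim \<theta> (1 / real (Suc j)) (real (Suc j)) 1"
    by (rule f_tendsto) (auto simp: \<delta>_def \<Delta>_def)
  have t0: "(\<lambda>n. f 0 \<delta> \<Delta> n 1) \<longlonglongrightarrow> hlim 0 (1 / real (Suc j)) (real (Suc j)) 1"
    by (rule f_tendsto) (auto simp: \<delta>_def \<Delta>_def)
  show "eventually (\<lambda>n. dist (btm_same_pos n (\<tau> \<omega>) (t_w \<alpha> \<gamma> n) ((1 + \<theta>) * t_w \<alpha> \<gamma> n)) (Asl \<alpha> (1 / (1 + \<theta>))) < \<epsilon>) sequentially"
    using tendstoD[OF t1 e4] tendstoD[OF t0 e4] eventually_ge_at_top[of 1]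
  proof eventually_elim
    case (elim n)
    interpret bt: btm n "\<tau> \<omega>" "T n" by (rule btm[OF elim(3)])
    define u where "u = (\<Sum>y\<in>torus n. P n 1 (0,0) y * P n \<theta> y y)"
    have u: "btm_same_pos n (\<tau> \<omega>) (t_w \<alpha> \<gamma> n) ((1 + \<theta>) * t_w \<alpha> \<gamma> n) = u"
      unfolding btm_same_pos_def u_def bt.P_def by (simp add: T_def distrib_right)
    have nn: "0 \<le> P n 1 (0,0) y" "0 \<le> P n \<theta> y y" "P n \<theta> y y \<le> 1" if "y \<in> torus n" for y
      using bt.P_nonneg[OF _ zero_in_torus that, of 1] bt.P_nonneg[OF \<theta>_nonneg that that]
        bt.P_le_1[OF \<theta>_nonneg that that] by auto
    have lo: "f \<theta> \<delta> \<Delta> n 1 \<le> u"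
      unfolding f_def u_def using nn by (intro sum_mono2 win_subset) auto
    have f0: "f 0 \<delta> \<Delta> n 1 = (\<Sum>y\<in>win \<delta> \<Delta> n. P n 1 (0,0) y)"
      by (simp add: f_def bt.P_0)
    have "u = f \<theta> \<delta> \<Delta> n 1 + (\<Sum>y\<in>torus n - win \<delta> \<Delta> n. P n 1 (0,0) y * P n \<theta> y y)"
      unfolding u_def f_def by (subst sum.subset_diff[OF win_subset[of \<delta> \<Delta> n] finite_torus]) simp
    also have "(\<Sum>y\<in>torus n - win \<delta> \<Delta> n. P n 1 (0,0) y * P n \<theta> y y) \<le> (\<Sum>y\<in>torus n - win \<delta> \<Delta> n. P n 1 (0,0) y)"
      using nn by (intro sum_mono mult_left_le) auto
    also have "\<dots> = (\<Sum>y\<in>torus n. P n 1 (0,0) y) - f 0 \<delta> \<Delta> n 1"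
      unfolding f0 by (rule sum_diff[OF finite_torus win_subset])
    also have "(\<Sum>y\<in>torus n. P n 1 (0,0) y) = 1" by (rule bt.P_row_sum[OF zero_in_torus])
    finally have hi: "u \<le> f \<theta> \<delta> \<Delta> n 1 + (1 - f 0 \<delta> \<Delta> n 1)" by simp
    \<comment> \<open>Off the window the second factor is bounded by 1, which leaves the mass that
      the window misses. There are four errors of \<epsilon>/4: the two window sums against their
      limits \<open>hlim\<close>, and these against the arcsine value and 1.\<close>
    show ?case unfolding u using lo hi j elim(1,2) unfolding dist_real_def by linarith
  qed
qed

end

theorem theoremt:
  fixes M :: "'w measure" and \<tau> :: "'w \<Rightarrow> int \<times> int \<Rightarrow> real"
    and \<alpha> \<gamma> :: real
  assumes "prob_space M"
    and "0 < \<alpha>" "\<alpha> < 1" "0 < \<gamma>" "\<gamma> < 1/6"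
    and "\<And>x. (\<lambda>\<omega>. \<tau> \<omega> x) \<in> borel_measurable M"
    and "prob_space.indep_vars M (\<lambda>_. borel) (\<lambda>x \<omega>. \<tau> \<omega> x) UNIV"
    and "\<And>x. distr M borel (\<lambda>\<omega>. \<tau> \<omega> x) = distr M borel (\<lambda>\<omega>. \<tau> \<omega> (0,0))"
    and "\<And>x. \<forall>\<omega>\<in>space M. \<tau> \<omega> x > 0"
    and "((\<lambda>u. u powr \<alpha> * measure M {\<omega>\<in>space M. \<tau> \<omega> (0,0) \<ge> u}) \<longlongrightarrow> 1) at_top"
  shows "\<forall>\<theta>>0. AE \<omega> in M.
           ((\<lambda>n. btm_same_pos n (\<tau> \<omega>) (t_w \<alpha> \<gamma> n) ((1 + \<theta>) * t_w \<alpha> \<gamma> n))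
              \<longlongrightarrow> Asl \<alpha> (1 / (1 + \<theta>))) sequentially"
proof (intro allI impI)
  fix \<theta> :: real
  assume \<theta>: "\<theta> > 0"
  interpret prob_space M by fact
  interpret trap_environment M \<tau> \<alpha> \<gamma>
    by unfold_locales (use assms in auto)
  have "AE \<omega> in M. good \<theta> \<omega>" using \<theta> by (intro AE_good) simp
  then show "AE \<omega> in M.
     ((\<lambda>n. btm_same_pos n (\<tau> \<omega>) (t_w \<alpha> \<gamma> n) ((1 + \<theta>) * t_w \<alpha> \<gamma> n))
        \<longlongrightarrow> Asl \<alpha> (1 / (1 + \<theta>))) sequentially"
  proof eventually_elim
    case (elim \<omega>)
    interpret good_env M \<tau> \<alpha> \<gamma> \<theta> \<omega>
      by unfold_locales (use \<theta> elim in auto)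
    show ?case by (rule same_pos_tendsto)
  qed
qed

end
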